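(* Let $\Phi$ be an optimality criterion satisfying Assumption A, and suppose that the single-covariate model satisfies one of the conditions (a)–(d) of the Complete Class Hypothesis (both defined in the context). If $\Phi$ is both strictly isotonic and strictly concave on PD$(d)$ and there exists a $\Phi$-optimal design $\xi^*$ which has at least $d$ support points, then $\xi^*$ is the unique $\Phi$-optimal design. In particular, suppose that the Complete Class Hypothesis holds with $m=d$ and complete class $\Xi$, that one of the four conditions [$\mathrm{fix}(\Xi)=\{L\}$ and $\mathbf M_U(\boldsymbol\theta)=0$], [$\mathrm{fix}(\Xi)=\{U\}$ and $\mathbf M_L(\boldsymbol\theta)=0$], [$\mathrm{fix}(\Xi)=\varnothing$ and $\mathbf M_U(\boldsymbol\theta)=\mathbf M_L(\boldsymbol\theta)=0$], [$\mathrm{fix}(\Xi)=\{L,U\}$] is met, and that $g(\boldsymbol\theta)$ is $\boldsymbol\theta$ or a reparameterization of $\boldsymbol\theta$. Then for every $p\in(-\infty,1)$ the $\Phi_p$-optimal design for $g(\boldsymbol\theta)$ is unique.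
   Context: **Model and designs.** The design space is an interval $[L,U]\subseteq\mathbb R$ ($L=-\infty$ or $U=\infty$ is allowed, $[L,U]$ then being half open or open; for an infinite endpoint, $\mathbf M_L(\boldsymbol\theta)$ or $\mathbf M_U(\boldsymbol\theta)$ is understood as the limit of $\mathbf M_x(\boldsymbol\theta)$ as $x$ tends to that endpoint). The unknown parameter is $\boldsymbol\theta\in\mathbb R^d$; a value of $\boldsymbol\theta$ is fixed throughout (local optimality). The model is a polynomial or nonlinear regression model or a generalized linear model with univariate response and one covariate $x\in[L,U]$; $\mathbf M_x(\boldsymbol\theta)$ denotes the $d\times d$ nonnegative definite Fisher information matrix of a single observation at $x$. It has the form $w(x)\,\mathbf f(x)\mathbf f(x)^T$, where $\mathbf f(x)=\partial\eta(x,\boldsymbol\theta)/\partial\boldsymbol\theta$, $\eta$ is the mean response (regression) or linear predictor (generalized linear model), and $w\ge 0$ is a scalar weight ($w\equiv1$ for regression with unit variance). A (approximate) design is $\xi=\{(x_i,\omega_i)\}_{i=1}^q$ with $x_i\in[L,U]$, $\omega_i\ge0$, $\sum_i\omega_i=1$; the $x_i$ are design points, those with positive weight are support points, and the number of support points is the support size. Two designs are regarded as equal if they have the same support points with the same weights. The information matrix is $\mathbf M_\xi(\boldsymbol\theta)=\sum_i\omega_i\mathbf M_{x_i}(\boldsymbol\theta)$. A design is $\Phi$-optimal if it maximizes $\Phi(\mathbf M_\xi(\boldsymbol\theta))$ over all designs $\xi$ on $[L,U]$. In the second paragraph of the claim, it is a standing assumption that a $\Phi_p$-optimal design exists. **Assumption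 A.** Let NND$(d)$ and PD$(d)$ be the sets of $d\times d$ nonnegative definite and positive definite matrices; inequalities between matrices are in the Loewner order ($\mathbf M>0$ means positive definite). $\Phi$ is a nonnegative, nonconstant real function on NND$(d)$ that is (1) concave; (2) isotonic: $\Phi(\mathbf M_1)\ge\Phi(\mathbf M_2)$ whenever $\mathbf M_1\ge\mathbf M_2$; (3) smooth on PD$(d)$: differentiable with continuous first-order partial derivatives, as a function of the $d(d+1)/2$ upper-triangular entries. **Strictness.** $\Phi$ is strictly isotonic on PD$(d)$ if $\Phi(\mathbf M_1)>\Phi(\mathbf M_2)$ for any $\mathbf M_1\ge\mathbf M_2>0$ with $\mathbf M_1\ne\mathbf M_2$. $\Phi$ is strictly concave on PD$(d)$ if $\Phi(\alpha\mathbf M_1+(1-\alpha)\mathbf M_2)>\alpha\Phi(\mathbf M_1)+(1-\alpha)\Phi(\mathbf M_2)$ for any $\alpha\in(0,1)$, $\mathbf M_1>0$, $\mathbf M_2\ge0$ with $\mathbf M_2$ not proportional to $\mathbf M_1$. **$\Phi_p$-criteria.** Let $g:\mathbb R^d\to\mathbb R^v$, $v\le d$, be smooth with $\mathbf K(\boldsymbol\theta)=(\partial g(\boldsymbol\theta)/\partial\boldsymbol\theta)^T$ (a $d\times v$ matrix) of full column rank $v$. If the columns of $\mathbf K(\boldsymbol\theta)$ lie in the range of $\mathbf M_\xi(\boldsymbol\theta)$ ($g(\boldsymbol\theta)$ is estimable under $\xi$), put $\mathbf I_\xi(\boldsymbol\theta)=(\mathbf K(\boldsymbol\theta)^T\mathbf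 M_\xi(\boldsymbol\theta)^-\mathbf K(\boldsymbol\theta))^{-1}$ ($^-$ a generalized inverse); the $\Phi_p$-criterion for $g(\boldsymbol\theta)$, $p\in(-\infty,1]$, is $$\Phi(\mathbf M_\xi(\boldsymbol\theta))=\Big(\tfrac1v\operatorname{trace}(\mathbf I_\xi^p(\boldsymbol\theta))\Big)^{1/p},$$ read as the limit $(\det\mathbf I_\xi)^{1/v}$ for $p=0$. If $g(\boldsymbol\theta)$ is not estimable under $\xi$, the criterion value is taken to be $0$. A reparameterization of $\boldsymbol\theta$ is a $g$ with $v=d$ (so $\mathbf K(\boldsymbol\theta)$ is nonsingular). **Complete Class Hypothesis.** There is a decomposition $\mathbf M_x(\boldsymbol\theta)=\mathbf P\,\mathbf C(c(x))\,\mathbf P^T$, where $\mathbf P$ is a nonsingular $d\times d$ matrix depending only on $\boldsymbol\theta$, $c$ is a smooth strictly monotone transformation of $[L,U]$ onto an interval $[A,B]$ (so $A,B$ correspond to $L,U$ if $c$ is increasing and to $U,L$ if $c$ is decreasing), and $\mathbf C(c)=(\Psi_{ij}(c))$ is a symmetric $d\times d$ matrix function. For some $1\le d_1<d$, let $\mathbf C_{22}(c)$ be the lower $d_1\times d_1$ principal submatrix of $\mathbf C(c)$; let $\Psi_1,\dots,\Psi_{k-1}$ be a maximal set of linearly independent nonconstant functions among the entries of the first $d-d_1$ columns of $\mathbf C(c)$; put $\Psi_k=\mathbf C_{22}$ (matrix valued). Define $f_{\ell,1}=\Psi_\ell'$ for $1\le\ell\le k$ and $f_{\ell,t}=(f_{\ell,t-1}/f_{t-1,t-1})'$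 for $2\le t\le\ell\le k$ (entrywise derivatives when $\ell=k$; all derivatives are assumed to exist), and $\mathbf F(c)=\prod_{\ell=1}^k f_{\ell,\ell}(c)$, a $d_1\times d_1$ matrix. One of the following holds, where $\mathbf F>0$ (resp. $\mathbf F<0$) means that $\mathbf F(c)$ (resp. $-\mathbf F(c)$) is positive definite for all $c\in[A,B]$: (a) $k=2m-1$ and $\mathbf F<0$; then $\Xi$ is the set of designs with at most $m$ design points including the point corresponding to $A$; (b) $k=2m-1$ and $\mathbf F>0$; then $\Xi$ is the set of designs with at most $m$ design points including the point corresponding to $B$; (c) $k=2m$ and $\mathbf F<0$; then $\Xi$ is the set of designs with at most $m$ design points; (d) $k=2m-2$ and $\mathbf F>0$; then $\Xi$ is the set of designs with at most $m$ design points including both endpoints. By a known theorem of Yang and Stufken (2012), $\Xi$ is a complete class: for every design $\xi$ there is $\tilde\xi\in\Xi$ with $\mathbf M_{\tilde\xi}(\boldsymbol\theta)\ge\mathbf M_\xi(\boldsymbol\theta)$. The required endpoints are called fixed design points (they may carry weight $0$), and $\mathrm{fix}(\Xi)\subseteq\{L,U\}$ denotes the set of fixed design points, expressed in the $x$ variable. It is understood that $m\ge d$.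
   Formalization: Both paragraphs additionally assume that some design has a positive definite information matrix; in the first paragraph, when m > d, the information matrix of ξ* is also assumed positive definite. Without these assumptions the claim is false. *)

theory Defs
  imports "HOL-Analysis.Analysis"
begin

text \<open>Written without \<open>^\<close>, which would force the sort \<open>finite\<close> on \<open>'d\<close>. The index type is linearly
  ordered where upper-triangular entries or first and last columns are referred to.\<close>

type_synonym 'd rvec = "(real, 'd) vec"
type_synonym 'd sqmat = "((real, 'd) vec, 'd) vec"

section \<open>Nonnegative definite matrices and the Loewner order\<close>

definition nnd :: "real^'d^'d \<Rightarrow> bool" where
  "nnd A \<longleftrightarrow> transpose A = A \<and> (\<forall>v. 0 \<le> v \<bullet> (A *v v))"

definition posdef :: "real^'d^'d \<Rightarrow> bool" where
  "posdef A \<longleftrightarrow> transpose A = A \<and> (\<forall>v. v \<noteq> 0 \<longrightarrow> 0 < v \<bullet> (A *v v))"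

definition loewner_ge :: "real^'d^'d \<Rightarrow> real^'d^'d \<Rightarrow> bool" where
  "loewner_ge A B \<longleftrightarrow> nnd (A - B)"

text \<open>Positive definiteness of the principal submatrix with index set \<open>J\<close>: a vector indexed by
  \<open>J\<close> is represented by its extension by zero.\<close>

definition posdef_on :: "'d set \<Rightarrow> real^'d^'d \<Rightarrow> bool" where
  "posdef_on J A \<longleftrightarrow> (\<forall>i\<in>J. \<forall>j\<in>J. A $ i $ j = A $ j $ i) \<and>
     (\<forall>v. v \<noteq> 0 \<and> (\<forall>i. i \<notin> J \<longrightarrow> v $ i = 0) \<longrightarrow> 0 < v \<bullet> (A *v v))"


section \<open>Designs\<close>

text \<open>Endpoints are extended reals, design points are real: the design space is closed, half open
  or open according to which endpoints are finite.\<close>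

definition design_space :: "ereal \<Rightarrow> ereal \<Rightarrow> real set" where
  "design_space L U = {x. L \<le> ereal x \<and> ereal x \<le> U}"

text \<open>A design is its weight function. Points of weight zero leave no trace in it, so
  equality of weight functions is equality of support points together with their weights.\<close>

definition support :: "(real \<Rightarrow> real) \<Rightarrow> real set" where
  "support \<xi> = {x. \<xi> x \<noteq> 0}"

definition is_design :: "ereal \<Rightarrow> ereal \<Rightarrow> (real \<Rightarrow> real) \<Rightarrow> bool" where
  "is_design L U \<xi> \<longleftrightarrow> finite (support \<xi>) \<and> support \<xi> \<subseteq> design_space L U \<and>
     (\<forall>x. 0 \<le> \<xi> x) \<and> (\<Sum>x\<in>support \<xi>. \<xi> x) = 1"

text \<open>Fisher information \<open>w(x) f(x) f(x)\<^sup>T\<close> of one observation at \<open>x\<close>.\<close>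

definition fisher_info :: "(real \<Rightarrow> real) \<Rightarrow> (real \<Rightarrow> real^'d) \<Rightarrow> real \<Rightarrow> real^'d^'d" where
  "fisher_info w f x = (\<chi> i j. w x * (f x $ i * f x $ j))"

definition design_info :: "(real \<Rightarrow> real^'d^'d) \<Rightarrow> (real \<Rightarrow> real) \<Rightarrow> real^'d^'d" where
  "design_info M \<xi> = (\<Sum>x\<in>support \<xi>. \<xi> x *\<^sub>R M x)"

definition is_optimal ::
    "ereal \<Rightarrow> ereal \<Rightarrow> (real \<Rightarrow> real^'d^'d) \<Rightarrow> (real^'d^'d \<Rightarrow> real) \<Rightarrow> (real \<Rightarrow> real) \<Rightarrow> bool" where
  "is_optimal L U M \<Phi> \<xi> \<longleftrightarrow> is_design L U \<xi> \<and>
     (\<forall>\<zeta>. is_design L U \<zeta> \<longrightarrow> \<Phi> (design_info M \<zeta>) \<le> \<Phi> (design_info M \<xi>))"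

text \<open>\<open>M_e = N\<close> for an endpoint \<open>e\<close>, by a limit when \<open>e\<close> is infinite.\<close>

definition endpoint_info_eq :: "(real \<Rightarrow> real^'d^'d) \<Rightarrow> ereal \<Rightarrow> real^'d^'d \<Rightarrow> bool" where
  "endpoint_info_eq M e N \<longleftrightarrow>
     (case e of ereal x \<Rightarrow> M x = N | PInfty \<Rightarrow> (M \<longlongrightarrow> N) at_top | MInfty \<Rightarrow> (M \<longlongrightarrow> N) at_bot)"


section \<open>Optimality criteria\<close>

text \<open>The symmetric matrix with the upper-triangular entries of \<open>u\<close>. The entries of \<open>u\<close> below the
  diagonal are ignored, so \<open>\<lambda>u. \<Phi> (sym_of_upper u)\<close> is \<open>\<Phi>\<close> as a function of the upper-triangular
  entries, and the entries of its gradient on and above the diagonal are the partial derivatives.\<close>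

definition sym_of_upper :: "('d::{finite,linorder}) sqmat \<Rightarrow> ('d::{finite,linorder}) sqmat" where
  "sym_of_upper u = (\<chi> i j. if i \<le> j then u $ i $ j else u $ j $ i)"

definition assumption_A :: "(('d::{finite,linorder}) sqmat \<Rightarrow> real) \<Rightarrow> bool" where
  "assumption_A \<Phi> \<longleftrightarrow>
     (\<forall>A. nnd A \<longrightarrow> 0 \<le> \<Phi> A) \<and>
     (\<exists>A B. nnd A \<and> nnd B \<and> \<Phi> A \<noteq> \<Phi> B) \<and>
     concave_on {A. nnd A} \<Phi> \<and>
     (\<forall>A B. nnd A \<and> nnd B \<and> loewner_ge A B \<longrightarrow> \<Phi> B \<le> \<Phi> A) \<and>
     (\<exists>D. (\<forall>u. posdef (sym_of_upper u) \<longrightarrow> (GDERIV (\<lambda>u. \<Phi> (sym_of_upper u)) u :> D u)) \<and>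
          continuous_on {u. posdef (sym_of_upper u)} D)"

definition strictly_isotonic :: "(real^'d^'d \<Rightarrow> real) \<Rightarrow> bool" where
  "strictly_isotonic \<Phi> \<longleftrightarrow>
     (\<forall>A B. loewner_ge A B \<and> posdef B \<and> A \<noteq> B \<longrightarrow> \<Phi> B < \<Phi> A)"

definition strictly_concave :: "(real^'d^'d \<Rightarrow> real) \<Rightarrow> bool" where
  "strictly_concave \<Phi> \<longleftrightarrow>
     (\<forall>\<alpha> A B. 0 < \<alpha> \<and> \<alpha> < 1 \<and> posdef A \<and> nnd B \<and> \<not> (\<exists>t. B = t *\<^sub>R A) \<longrightarrow>
        \<alpha> * \<Phi> A + (1 - \<alpha>) * \<Phi> B < \<Phi> (\<alpha> *\<^sub>R A + (1 - \<alpha>) *\<^sub>R B))"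


section \<open>\<open>\<Phi>\<^sub>p\<close>-criteria\<close>

definition generalized_inverse :: "real^'d^'d \<Rightarrow> real^'d^'d" where
  "generalized_inverse A = (SOME G. A ** G ** A = A)"

definition diag_matrix :: "real^'v \<Rightarrow> real^'v^'v" where
  "diag_matrix l = (\<chi> i j. if i = j then l $ i else 0)"

text \<open>Real powers of a symmetric positive definite matrix, by spectral decomposition.\<close>

definition matrix_powr :: "real^'v^'v \<Rightarrow> real \<Rightarrow> real^'v^'v" where
  "matrix_powr A p = (THE B. \<exists>Q l. orthogonal_matrix Q \<and>
     A = Q ** diag_matrix l ** transpose Q \<and>
     B = Q ** diag_matrix (\<chi> i. l $ i powr p) ** transpose Q)"

definition estimable :: "real^'v^'d \<Rightarrow> real^'d^'d \<Rightarrow> bool" where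
  "estimable K A \<longleftrightarrow> (\<forall>j. column j K \<in> range (\<lambda>v. A *v v))"

definition info_for :: "real^'v^'d \<Rightarrow> real^'d^'d \<Rightarrow> real^'v^'v" where
  "info_for K A = matrix_inv (transpose K ** generalized_inverse A ** K)"

definition Phi_p :: "real^'v^'d \<Rightarrow> real \<Rightarrow> real^'d^'d \<Rightarrow> real" where
  "Phi_p K p A =
     (if \<not> estimable K A then 0
      else if p = 0 then det (info_for K A) powr (1 / real CARD('v))
      else (trace (matrix_powr (info_for K A) p) / real CARD('v)) powr (1 / p))"

definition K_matrix :: "(real^'d \<Rightarrow> real^'v) \<Rightarrow> real^'d \<Rightarrow> real^'v^'d" where
  "K_matrix g \<theta> = transpose (matrix (frechet_derivative g (at \<theta>)))"

text \<open>Smooth means continuously differentiable, as in \<open>assumption_A\<close>. A reparameterization is the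
  case \<open>'v = 'd\<close>; it includes the identity.\<close>

definition smooth_full_rank :: "(real^'d \<Rightarrow> real^'v) \<Rightarrow> real^'d \<Rightarrow> bool" where
  "smooth_full_rank g \<theta> \<longleftrightarrow>
     (\<forall>t. g differentiable (at t)) \<and> continuous_on UNIV (K_matrix g) \<and>
     rank (K_matrix g \<theta>) = CARD('v)"


section \<open>The complete class hypothesis\<close>

text \<open>The last \<open>d1\<close> indices; the first columns are those with index in the complement.\<close>

definition last_indices :: "nat \<Rightarrow> ('d::{finite,linorder}) set" where
  "last_indices d1 = {j. card {i. j < i} < d1}"

text \<open>The functions \<open>f_{\<ell>,t}\<close>, with one-sided derivatives at endpoints belonging to \<open>I\<close>.
  The value at \<open>t = 0\<close> is not used.\<close>

fun f_chain :: "real set \<Rightarrow> (nat \<Rightarrow> real \<Rightarrow> real) \<Rightarrow> nat \<Rightarrow> nat \<Rightarrow> real \<Rightarrow> real" where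
  "f_chain I \<Psi> l 0 c = \<Psi> l c"
| "f_chain I \<Psi> l (Suc 0) c = vector_derivative (\<Psi> l) (at c within I)"
| "f_chain I \<Psi> l (Suc (Suc t)) c =
     vector_derivative (\<lambda>s. f_chain I \<Psi> l (Suc t) s / f_chain I \<Psi> (Suc t) (Suc t) s) (at c within I)"

definition chain_differentiable :: "real set \<Rightarrow> (nat \<Rightarrow> real \<Rightarrow> real) \<Rightarrow> nat \<Rightarrow> bool" where
  "chain_differentiable I \<Psi> l \<longleftrightarrow> \<Psi> l differentiable_on I \<and>
     (\<forall>t\<in>{2..l}. (\<lambda>s. f_chain I \<Psi> l (t - 1) s / f_chain I \<Psi> (t - 1) (t - 1) s) differentiable_on I)"

text \<open>\<open>\<Psi>\<^sub>k\<close> is the matrix \<open>C\<^sub>2\<^sub>2\<close> and its chain is formed entrywise: \<open>with_entry \<Psi> k C i j\<close> has the entry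
  \<open>(i,j)\<close> of \<open>C\<close> in position \<open>k\<close>. Only indices in \<open>last_indices d1\<close> are relevant for \<open>F_matrix\<close>.\<close>

definition with_entry ::
    "(nat \<Rightarrow> real \<Rightarrow> real) \<Rightarrow> nat \<Rightarrow> (real \<Rightarrow> real^'d^'d) \<Rightarrow> 'd \<Rightarrow> 'd \<Rightarrow> nat \<Rightarrow> real \<Rightarrow> real" where
  "with_entry \<Psi> k C i j = \<Psi>(k := (\<lambda>c. C c $ i $ j))"

definition F_matrix ::
    "real set \<Rightarrow> (nat \<Rightarrow> real \<Rightarrow> real) \<Rightarrow> nat \<Rightarrow> (real \<Rightarrow> real^'d^'d) \<Rightarrow> real \<Rightarrow> real^'d^'d" where
  "F_matrix I \<Psi> k C c =
     (\<chi> i j. (\<Prod>l=1..<k. f_chain I \<Psi> l l c) * f_chain I (with_entry \<Psi> k C i j) k k c)"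

definition lin_indep_on :: "real set \<Rightarrow> nat set \<Rightarrow> (nat \<Rightarrow> real \<Rightarrow> real) \<Rightarrow> bool" where
  "lin_indep_on I N \<Psi> \<longleftrightarrow>
     (\<forall>a. (\<forall>c\<in>I. (\<Sum>l\<in>N. a l * \<Psi> l c) = 0) \<longrightarrow> (\<forall>l\<in>N. a l = 0))"

definition maximal_indep_entries ::
    "real set \<Rightarrow> (real \<Rightarrow> ('d::{finite,linorder}) sqmat) \<Rightarrow> nat \<Rightarrow> nat \<Rightarrow> (nat \<Rightarrow> real \<Rightarrow> real) \<Rightarrow> bool" where
  "maximal_indep_entries I C d1 k \<Psi> \<longleftrightarrow>
     (\<forall>l\<in>{1..<k}. (\<exists>i j. j \<notin> last_indices d1 \<and> \<Psi> l = (\<lambda>c. C c $ i $ j)) \<and>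
                   \<not> \<Psi> l constant_on I) \<and>
     lin_indep_on I {1..<k} \<Psi> \<and>
     (\<forall>i j. j \<notin> last_indices d1 \<and> \<not> (\<lambda>c. C c $ i $ j) constant_on I \<longrightarrow>
        \<not> lin_indep_on I {1..k} (with_entry \<Psi> k C i j))"

text \<open>\<open>complete_class_hyp L U M m Fx\<close>: one of the conditions (a)-(d) holds for the model with information
  matrices \<open>M\<close> on the design space, with the given \<open>m\<close>, and \<open>Fx\<close> is the resulting set of fixed design
  points \<open>fix(\<Xi>)\<close>, expressed in the variable \<open>x\<close>. The interval \<open>[A,B]\<close> is the image \<open>I\<close> of the design space
  under \<open>c\<close>; \<open>eA\<close> and \<open>eB\<close> are the endpoints of the design space corresponding to \<open>A\<close> and \<open>B\<close>.\<close>

definition complete_class_hyp ::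
    "ereal \<Rightarrow> ereal \<Rightarrow> (real \<Rightarrow> ('d::{finite,linorder}) sqmat) \<Rightarrow> nat \<Rightarrow> ereal set \<Rightarrow> bool" where
  "complete_class_hyp L U M m Fx \<longleftrightarrow> CARD('d) \<le> m \<and>
    (\<exists>(P :: 'd sqmat) c c' C d1 k \<Psi> I J eA eB.
       invertible P \<and>
       (\<forall>x\<in>design_space L U. (c has_real_derivative c' x) (at x within design_space L U)) \<and>
       continuous_on (design_space L U) c' \<and>
       (strict_mono_on (design_space L U) c \<and> eA = L \<and> eB = U \<or>
        strict_antimono_on (design_space L U) c \<and> eA = U \<and> eB = L) \<and>
       I = c ` design_space L U \<and>
       (\<forall>s\<in>I. transpose (C s) = C s) \<and>
       (\<forall>x\<in>design_space L U. M x = P ** C (c x) ** transpose P) \<and>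
       1 \<le> d1 \<and> d1 < CARD('d) \<and> J = last_indices d1 \<and>
       1 \<le> k \<and> maximal_indep_entries I C d1 k \<Psi> \<and>
       (\<forall>l\<in>{1..<k}. chain_differentiable I \<Psi> l) \<and>
       (\<forall>i\<in>J. \<forall>j\<in>J. chain_differentiable I (with_entry \<Psi> k C i j) k) \<and>
       (k + 1 = 2 * m \<and> (\<forall>s\<in>I. posdef_on J (- F_matrix I \<Psi> k C s)) \<and> Fx = {eA} \<or>
        k + 1 = 2 * m \<and> (\<forall>s\<in>I. posdef_on J (F_matrix I \<Psi> k C s)) \<and> Fx = {eB} \<or>
        k = 2 * m \<and> (\<forall>s\<in>I. posdef_on J (- F_matrix I \<Psi> k C s)) \<and> Fx = {} \<or>
        k + 2 = 2 * m \<and> (\<forall>s\<in>I. posdef_on J (F_matrix I \<Psi> k C s)) \<and> Fx = {eA, eB}))"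

end

theory Submission
  imports Defs
begin

text \<open>
  Two optimal designs are compared first through their information matrices and then as measures.

  The matrices agree. If \<open>A\<close> is positive definite, \<open>B \<noteq> A\<close> is nonnegative definite and both attain the
  optimal value, then their midpoint is the information matrix of the averaged design and has a larger
  value; this is the property \<open>midpoint_strict\<close>. For a criterion that is strictly concave and strictly
  isotonic it is strict concavity when \<open>A\<close> and \<open>B\<close> are not proportional, and monotonicity along the
  ray otherwise. A \<open>\<Phi>\<^sub>p\<close>-criterion is an increasing function of \<open>\<Sum> \<phi>(\<lambda>\<^sub>i)\<close>, where the \<open>\<lambda>\<^sub>i\<close> are the
  eigenvalues of \<open>K\<inverse> M K\<^sup>-\<^sup>T\<close> and \<open>\<phi>\<close> is a strictly concave, increasing function of one variable, and
  Peierls' inequality transfers both properties of \<open>\<phi>\<close> to the sum.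

  The designs agree. Write \<open>Q\<^sub>v(c) = v\<^sup>T C\<^sub>2\<^sub>2(c) v\<close>. Definiteness of \<open>F\<close> says that the functions
  \<open>f\<^bsub>l,l\<^esub>\<close> belonging to the system \<open>1, \<Psi>\<^sub>1, \<dots>, \<Psi>\<^bsub>k-1\<^esub>, Q\<^sub>v\<close> have no zeros, for each \<open>v \<noteq> 0\<close>. By
  Rolle's theorem, applied \<open>k\<close> times, a nontrivial linear combination of these \<open>k + 1\<close> functions has at
  most \<open>k\<close> zeros. Dually, a nonzero signed measure on at most \<open>k + 1\<close> points which annihilates
  \<open>1, \<Psi>\<^sub>1, \<dots>, \<Psi>\<^bsub>k-1\<^esub>\<close> does not annihilate any \<open>Q\<^sub>v\<close>, so by connectedness its integral of \<open>C\<^sub>2\<^sub>2\<close> is a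
  definite matrix, while all other entries of \<open>C\<close> integrate to zero. On \<open>k + 1\<close> support points of a
  design such a measure exists, and because all these points carry positive weight a small multiple of it, of
  either sign, may be added to the design. With the right sign the information grows strictly. Hence an
  optimal design with positive definite information has at most \<open>k\<close> support points. Apply this to the
  average of two optimal designs with the same information matrix: their difference lives on at most
  \<open>k\<close> points and annihilates \<open>1\<close>, all \<open>\<Psi>\<^sub>l\<close> and all \<open>Q\<^sub>v\<close>, so it is zero.

  It remains to see that the optimal information is positive definite. For \<open>\<Phi>\<^sub>p\<close> singular matrices have the
  value \<open>0\<close>. In the first assertion with \<open>m = d\<close>, if some support point carries no information, moving its
  weight to a nonsingular design gives an optimal design with positive definite information, and
  the information matrices agree by the first step. Otherwise let \<open>z\<close> be in the kernel. The function
  \<open>q(c(x)) = z\<^sup>T M\<^sub>x z\<close> is a nonnegative combination of the \<open>k + 1\<close> functions and vanishes at \<open>d\<close> points.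
  As \<open>M\<^sub>x\<close> has rank one, \<open>q\<close> is essentially a square and these zeros are double, also at the
  endpoints. So \<open>q'\<close> has \<open>2 d - 1\<close> zeros, too many if \<open>k \<le> 2 d - 1\<close>. If \<open>k = 2 d\<close>, condition (c) holds,
  and the signs of \<open>q'\<close> between the zeros force the leading coefficient of \<open>q\<close> to have the sign that
  \<open>F < 0\<close> excludes. Thus \<open>q\<close> vanishes identically and no design is nonsingular, a contradiction.
\<close>

section \<open>Zeros and sign changes along a chain of derivatives\<close>

text \<open>Darboux' property of derivatives: if the derivative were positive at \<open>a\<close> and negative at
  \<open>b > a\<close>, the maximum on \<open>[a, b]\<close> would be attained inside and the derivative would vanish there. No
  continuity of the derivative is available for the functions \<open>f\<^bsub>l,l\<^esub>\<close>.\<close>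

lemma derivative_nonzero_sgn_constant:
  fixes h h' :: "real \<Rightarrow> real"
  assumes I: "is_interval I"
    and der: "\<And>x. x \<in> I \<Longrightarrow> (h has_real_derivative h' x) (at x within I)"
    and nz: "\<And>x. x \<in> I \<Longrightarrow> h' x \<noteq> 0"
    and xy: "x \<in> I" "y \<in> I"
  shows "sgn (h' x) = sgn (h' y)"
proof -
  have no_change: False
    if d: "\<And>x. x \<in> I \<Longrightarrow> (h has_real_derivative h' x) (at x within I)"
      and nz: "\<And>x. x \<in> I \<Longrightarrow> h' x \<noteq> 0"
      and ab: "a \<in> I" "b \<in> I" "a < b" "0 < h' a" "h' b < 0"
    for h h' :: "real \<Rightarrow> real" and a b
  proof -
    have sub: "{a..b} \<subseteq> I"
      using I ab by (meson atLeastAtMost_iff is_interval_1 subsetI)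
    have d': "(h has_real_derivative h' z) (at z within {a..b})" if "z \<in> {a..b}" for z
      using d[of z] sub that by (meson DERIV_subset subsetD)
    have "continuous_on {a..b} h"
      using d' by (meson DERIV_continuous continuous_on_eq_continuous_within)
    then obtain z where z: "z \<in> {a..b}" "\<And>t. t \<in> {a..b} \<Longrightarrow> h t \<le> h z"
      using continuous_attains_sup[of "{a..b}" h] ab by auto
    have "z \<noteq> a"
    proof
      assume "z = a"
      obtain e where e: "e > 0" "\<And>t. 0 < t \<Longrightarrow> a + t \<in> {a..b} \<Longrightarrow> t < e \<Longrightarrow> h a < h (a + t)"
        using has_real_derivative_pos_inc_right[OF d'[of a]] ab by auto
      define t where "t = min (e/2) (b - a)"
      have "0 < t" "t < e" "a + t \<in> {a..b}" using e ab unfolding t_def by auto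
      then show False using e(2)[of t] z(2)[of "a+t"] \<open>z = a\<close> by auto
    qed
    moreover have "z \<noteq> b"
    proof
      assume "z = b"
      obtain e where e: "e > 0" "\<And>t. 0 < t \<Longrightarrow> b - t \<in> {a..b} \<Longrightarrow> t < e \<Longrightarrow> h b < h (b - t)"
        using has_real_derivative_neg_dec_left[OF d'[of b]] ab by auto
      define t where "t = min (e/2) (b - a)"
      have "0 < t" "t < e" "b - t \<in> {a..b}" using e ab unfolding t_def by auto
      then show False using e(2)[of t] z(2)[of "b-t"] \<open>z = b\<close> by auto
    qed
    ultimately have zi: "z \<in> {a<..<b}" using z by auto
    then have "(h has_real_derivative h' z) (at z)"
      using d'[of z] at_within_Icc_at[of a z b] by auto
    then have "h' z = 0"
      using zi z(2) by (intro DERIV_local_max[of h "h' z" z "min (z - a) (b - z)"]) (auto simp: abs_if split: if_splits)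
    moreover have "z \<in> I" using z(1) sub by blast
    ultimately show False using nz by blast
  qed
  have neg: "\<And>x. x \<in> I \<Longrightarrow> ((\<lambda>t. - h t) has_real_derivative - h' x) (at x within I)"
    using der by (simp add: DERIV_minus)
  have *: "sgn (h' x) = sgn (h' y)" if "x \<in> I" "y \<in> I" "x < y" for x y
  proof -
    have "\<not> (0 < h' x \<and> h' y < 0)"
      using no_change[OF der nz that] by blast
    moreover have "\<not> (0 < - h' x \<and> - h' y < 0)"
      using no_change[OF neg _ that] nz by force
    ultimately show ?thesis using nz[OF that(1)] nz[OF that(2)] by (auto simp: sgn_if linorder_neq_iff)
  qed
  show ?thesis using *[OF xy] *[OF xy(2) xy(1)] by (metis linorder_neqE)
qed

lemma mvt_on_interval:
  fixes h h' :: "real \<Rightarrow> real"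
  assumes I: "is_interval I" and ab: "a \<in> I" "b \<in> I" "a < b"
    and der: "\<And>x. x \<in> I \<Longrightarrow> (h has_real_derivative h' x) (at x within I)"
  obtains y where "y \<in> I" "a < y" "y < b" "h b - h a = h' y * (b - a)"
proof -
  have sub: "{a..b} \<subseteq> I" using I ab by (meson atLeastAtMost_iff is_interval_1 subsetI)
  have "\<exists>y\<in>{a<..<b}. h b - h a = (\<lambda>d. h' y * d) (b - a)"
  proof (rule mvt_simple[OF ab(3)])
    show "(h has_derivative (*) (h' y)) (at y within {a..b})" if "a \<le> y" "y \<le> b" for y
      using DERIV_subset[OF der sub, of y] sub that by (auto simp: has_field_derivative_def)
  qed
  then obtain y where y: "a < y" "y < b" "h b - h a = h' y * (b - a)" by auto
  moreover have "y \<in> I" using y(1,2) sub by (meson atLeastAtMost_iff less_imp_le subsetD)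
  ultimately show ?thesis using that by blast
qed

text \<open>\<open>\<phi> l 0\<close> is the function with index \<open>l\<close> itself, and \<open>\<phi> l t\<close> with \<open>t \<ge> 1\<close> is the function \<open>f\<^bsub>l,t\<^esub>\<close> of the
  complete class hypothesis. The constant \<open>1\<close> is the member with index \<open>0\<close>, which makes the first
  differentiation an instance of the general rule: divide by the diagonal function, then differentiate.\<close>

definition derivative_chain :: "real set \<Rightarrow> (nat \<Rightarrow> nat \<Rightarrow> real \<Rightarrow> real) \<Rightarrow> nat \<Rightarrow> bool" where
  "derivative_chain I \<phi> k \<longleftrightarrow> is_interval I \<and> (\<forall>s\<in>I. \<phi> 0 0 s = 1) \<and>
     (\<forall>l\<le>k. \<forall>s\<in>I. \<phi> l l s \<noteq> 0) \<and>
     (\<forall>l\<le>k. \<forall>t<l. \<forall>s\<in>I.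
        ((\<lambda>r. \<phi> l t r / \<phi> t t r) has_real_derivative \<phi> l (Suc t) s) (at s within I))"

lemma derivative_chain_mono: "derivative_chain I \<phi> k \<Longrightarrow> j \<le> k \<Longrightarrow> derivative_chain I \<phi> j"
  unfolding derivative_chain_def by (meson le_trans)

lemma derivative_chain_sgn_constant:
  assumes ch: "derivative_chain I \<phi> k" and l: "l \<le> k" and xy: "x \<in> I" "y \<in> I"
  shows "sgn (\<phi> l l x) = sgn (\<phi> l l y)"
proof (cases l)
  case 0
  then show ?thesis using ch xy by (auto simp: derivative_chain_def)
next
  case (Suc t)
  show ?thesis unfolding Suc
    by (rule derivative_nonzero_sgn_constant[of I "\<lambda>r. \<phi> (Suc t) t r / \<phi> t t r"])
       (use ch l xy Suc in \<open>auto simp: derivative_chain_def\<close>)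
qed

text \<open>A combination of the functions \<open>\<phi> l t\<close> with \<open>t \<le> l \<le> k\<close> whose values at \<open>k - t + 1\<close> points alternate
  weakly in sign, ending with a nonnegative one, has a leading coefficient of known sign. Dividing by
  \<open>\<phi> t t\<close>, which has constant sign, keeps the pattern up to a global sign, and the mean value theorem
  finds a derivative of the right sign between two neighbours; so one step of the chain costs one
  point. Weak inequalities suffice at every step, which is why zeros may be counted with either sign.\<close>

lemma weak_alternation_top_sign:
  assumes ch: "derivative_chain I \<phi> k" and "t + n = k"
    and "\<And>i. i \<le> n \<Longrightarrow> x i \<in> I" and "\<And>i. i < n \<Longrightarrow> x i < x (Suc i)"
    and "\<And>i. i \<le> n \<Longrightarrow> 0 \<le> (-1) ^ (n - i) * (\<Sum>l=t..k. a l * \<phi> l t (x i))"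
  shows "\<exists>s\<in>I. 0 \<le> (\<Prod>l=t..<k. sgn (\<phi> l l s)) * (a k * \<phi> k k s)"
  using assms(2-)
proof (induction n arbitrary: t x a)
  case 0
  then show ?case by auto
next
  case (Suc n)
  have tk: "t < k" using Suc.prems(1) by simp
  define e where "e = sgn (\<phi> t t (x 0))"
  have e: "sgn (\<phi> t t s) = e" if "s \<in> I" for s
    unfolding e_def using derivative_chain_sgn_constant[OF ch _ that Suc.prems(2)[of 0]] tk by simp
  define h where "h = (\<lambda>s. (\<Sum>l=t..k. a l * (\<phi> l t s / \<phi> t t s)))"
  define h' where "h' = (\<lambda>s. (\<Sum>l=Suc t..k. a l * \<phi> l (Suc t) s))"
  have nz: "\<phi> t t s \<noteq> 0" if "s \<in> I" for s
    using ch tk that by (auto simp: derivative_chain_def)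
  have split: "{t..k} = insert t {Suc t..k}" using tk by auto
  have h_eq: "h s = a t + (\<Sum>l=Suc t..k. a l * (\<phi> l t s / \<phi> t t s))" if "s \<in> I" for s
    unfolding h_def split using nz[OF that] by simp
  have der: "(h has_real_derivative h' s) (at s within I)" if s: "s \<in> I" for s
  proof -
    have "((\<lambda>s. a t + (\<Sum>l=Suc t..k. a l * (\<phi> l t s / \<phi> t t s))) has_real_derivative
        0 + h' s) (at s within I)"
      unfolding h'_def
      by (intro derivative_intros DERIV_cmult) (use ch s in \<open>auto simp: derivative_chain_def\<close>)
    then show ?thesis
      using has_field_derivative_transform_within[OF _ zero_less_one s] h_eq by simp
  qed
  have sgn_h: "0 \<le> (-1) ^ (Suc n - i) * (e * h (x i))" if "i \<le> Suc n" for i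
  proof -
    have xi: "x i \<in> I" using Suc.prems(2) that by simp
    have "h (x i) = (\<Sum>l=t..k. a l * \<phi> l t (x i)) / \<phi> t t (x i)"
      unfolding h_def by (simp add: sum_divide_distrib)
    moreover have "0 \<le> e / \<phi> t t (x i)"
      using e[OF xi] nz[OF xi] by (auto simp: sgn_if split: if_splits)
    ultimately show ?thesis
      using mult_nonneg_nonneg[OF Suc.prems(4)[OF that], of "e / \<phi> t t (x i)"]
      by (simp add: mult_ac)
  qed
  have I: "is_interval I" using ch by (simp add: derivative_chain_def)
  have "\<exists>y. y \<in> I \<and> x i < y \<and> y < x (Suc i) \<and> h (x (Suc i)) - h (x i) = h' y * (x (Suc i) - x i)"
    if i: "i \<le> n" for i
  proof -
    have xi: "x i \<in> I" "x (Suc i) \<in> I" "x i < x (Suc i)" using Suc.prems(2,3) i by auto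
    show ?thesis by (rule mvt_on_interval[OF I xi der]) blast+
  qed
  then obtain y where y: "\<And>i. i \<le> n \<Longrightarrow> y i \<in> I \<and> x i < y i \<and> y i < x (Suc i) \<and>
      h (x (Suc i)) - h (x i) = h' (y i) * (x (Suc i) - x i)"
    by metis
  have "\<exists>s\<in>I. 0 \<le> (\<Prod>l=Suc t..<k. sgn (\<phi> l l s)) * ((e * a k) * \<phi> k k s)"
  proof (rule Suc.IH)
    show "Suc t + n = k" using Suc.prems(1) by simp
    show "y i \<in> I" if "i \<le> n" for i using y[OF that] by blast
    show "y i < y (Suc i)" if "i < n" for i
      using y[of i] y[of "Suc i"] that by force
    show "0 \<le> (-1) ^ (n - i) * (\<Sum>l = Suc t..k. e * a l * \<phi> l (Suc t) (y i))"
      if i: "i \<le> n" for i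
    proof -
      have "0 \<le> (-1) ^ (n - i) * (e * h (x (Suc i)))" using sgn_h[of "Suc i"] i by simp
      moreover have "0 \<le> - ((-1) ^ (n - i) * (e * h (x i)))"
        using sgn_h[of i] i by (simp add: Suc_diff_le)
      ultimately have "0 \<le> (-1) ^ (n - i) * (e * (h (x (Suc i)) - h (x i)))"
        by (simp add: algebra_simps)
      also have "\<dots> = ((-1) ^ (n - i) * (e * h' (y i))) * (x (Suc i) - x i)"
        using y[OF i] by simp
      finally have "0 \<le> (-1) ^ (n - i) * (e * h' (y i))"
        using Suc.prems(3)[of i] i by (simp add: zero_le_mult_iff)
      then show ?thesis by (simp add: h'_def sum_distrib_left mult_ac)
    qed
  qed
  then obtain s where s: "s \<in> I" "0 \<le> (\<Prod>l=Suc t..<k. sgn (\<phi> l l s)) * ((e * a k) * \<phi> k k s)"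
    by blast
  have "(\<Prod>l=t..<k. sgn (\<phi> l l s)) = e * (\<Prod>l=Suc t..<k. sgn (\<phi> l l s))"
    using tk e[OF s(1)] by (simp add: prod.atLeast_Suc_lessThan)
  then show ?case using s by (intro bexI[of _ s]) (auto simp: mult_ac)
qed

text \<open>Zeros alternate weakly in sign for the combination and for its negative, so the leading
  coefficient is both nonnegative and nonpositive.\<close>

lemma zeros_imp_top_coeff_zero:
  assumes ch: "derivative_chain I \<phi> k" and tn: "t + n = k"
    and x: "\<And>i. i \<le> n \<Longrightarrow> x i \<in> I" "\<And>i. i < n \<Longrightarrow> x i < x (Suc i)"
    and z: "\<And>i. i \<le> n \<Longrightarrow> (\<Sum>l=t..k. a l * \<phi> l t (x i)) = 0"
  shows "a k = 0"
proof -
  \<comment> \<open>the sign of the product of the diagonal functions, constant and nonzero\<close>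
  define S where "S = (\<lambda>s. (\<Prod>l=t..<k. sgn (\<phi> l l s)) * sgn (\<phi> k k s))"
  have pull: "0 \<le> S s * b" if "s \<in> I" "0 \<le> (\<Prod>l=t..<k. sgn (\<phi> l l s)) * (b * \<phi> k k s)" for s b
  proof -
    have "S s * b * \<bar>\<phi> k k s\<bar> = (\<Prod>l=t..<k. sgn (\<phi> l l s)) * b * (sgn (\<phi> k k s) * \<bar>\<phi> k k s\<bar>)"
      unfolding S_def by (simp only: mult_ac)
    then have "0 \<le> S s * b * \<bar>\<phi> k k s\<bar>" using that(2) by (simp only: sgn_mult_abs mult.assoc)
    moreover have "0 < \<bar>\<phi> k k s\<bar>" using ch that(1) by (simp add: derivative_chain_def)
    ultimately show ?thesis unfolding zero_le_mult_iff[of "S s * b"] by linarith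
  qed
  have "\<exists>s\<in>I. 0 \<le> (\<Prod>l=t..<k. sgn (\<phi> l l s)) * (a k * \<phi> k k s)"
    by (rule weak_alternation_top_sign[where x = x, OF ch tn x]) (simp_all add: z)
  then obtain s where s: "s \<in> I" "0 \<le> S s * a k" using pull by blast
  have "\<exists>s\<in>I. 0 \<le> (\<Prod>l=t..<k. sgn (\<phi> l l s)) * ((- a k) * \<phi> k k s)"
    by (rule weak_alternation_top_sign[where x = x and a = "\<lambda>l. - a l", OF ch tn x])
       (simp_all add: sum_negf z)
  then obtain r where r: "r \<in> I" "0 \<le> S r * (- a k)" using pull by blast
  have "S s = S r"
    unfolding S_def using derivative_chain_sgn_constant[OF ch _ s(1) r(1)]
    by (auto intro!: arg_cong2[of _ _ _ _ "(*)"] prod.cong)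
  moreover have "S s \<noteq> 0"
    unfolding S_def using ch s(1) by (simp add: derivative_chain_def sgn_0_0)
  ultimately show ?thesis using s(2) r(2) by simp
qed

lemma zeros_imp_coeffs_zero:
  assumes "derivative_chain I \<phi> k" and "k \<le> t + n"
    and x: "\<And>i. i \<le> n \<Longrightarrow> x i \<in> I" "\<And>i. i < n \<Longrightarrow> x i < x (Suc i)"
    and "\<And>i. i \<le> n \<Longrightarrow> (\<Sum>l=t..k. a l * \<phi> l t (x i)) = 0"
  shows "\<forall>l\<in>{t..k}. a l = 0"
  using assms(1,2,5)
proof (induction k)
  case 0
  show ?case
  proof (cases "t = 0")
    case True
    then show ?thesis using 0(1) 0(3)[of 0] x(1)[of 0] by (auto simp: derivative_chain_def)
  qed auto
next
  case (Suc k)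
  show ?case
  proof (cases "t \<le> Suc k")
    case True
    have top: "a (Suc k) = 0"
      by (rule zeros_imp_top_coeff_zero[of I \<phi> "Suc k" t "Suc k - t" x])
         (use Suc.prems x True in auto)
    have "\<forall>l\<in>{t..k}. a l = 0"
    proof (rule Suc.IH)
      show "derivative_chain I \<phi> k" by (rule derivative_chain_mono[OF Suc.prems(1)]) simp
      show "k \<le> t + n" using Suc.prems(2) by simp
      show "(\<Sum>l=t..k. a l * \<phi> l t (x i)) = 0" if "i \<le> n" for i
        using Suc.prems(3)[OF that] top True by (simp add: atLeastAtMostSuc_conv)
    qed
    then show ?thesis using top by (auto simp: le_Suc_eq)
  qed auto
qed

lemma finite_set_increasing_enumeration:
  fixes Z :: "real set"
  assumes "finite Z" "card Z = Suc n"
  obtains x where "x ` {..n} = Z" "\<And>i j. i < j \<Longrightarrow> j \<le> n \<Longrightarrow> x i < x j"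
proof
  let ?xs = "sorted_list_of_set Z"
  have len: "length ?xs = Suc n" using assms by simp
  show "(!) ?xs ` {..n} = Z"
    using len assms(1) nth_image[of "Suc n" ?xs] set_sorted_list_of_set[OF assms(1)]
    by (simp add: lessThan_Suc_atMost[symmetric] lessThan_atLeast0)
  show "?xs ! i < ?xs ! j" if "i < j" "j \<le> n" for i j
    using sorted_wrt_nth_less[OF strict_sorted_list_of_set[of Z] that(1)] that len assms(2) by simp
qed

text \<open>For \<open>t = 0\<close> this says that \<open>\<phi> 0 0, \<dots>, \<phi> k 0\<close> is a Chebyshev system.\<close>

lemma zero_set_imp_coeffs_zero:
  assumes ch: "derivative_chain I \<phi> k"
    and Z: "finite Z" "k < t + card Z" "Z \<subseteq> I" "Z \<noteq> {}"
    and z: "\<And>s. s \<in> Z \<Longrightarrow> (\<Sum>l=t..k. a l * \<phi> l t s) = 0"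
  shows "\<forall>l\<in>{t..k}. a l = 0"
proof -
  obtain n where n: "card Z = Suc n" using Z by (metis card_0_eq not0_implies_Suc)
  obtain x where x: "x ` {..n} = Z" "\<And>i j. i < j \<Longrightarrow> j \<le> n \<Longrightarrow> x i < x j"
    using finite_set_increasing_enumeration[OF Z(1) n] by blast
  have xZ: "x i \<in> Z" if "i \<le> n" for i using x(1) that by blast
  show ?thesis
  proof (rule zeros_imp_coeffs_zero[OF ch, of t n x])
    show "k \<le> t + n" using n Z(2) by simp
    show "x i \<in> I" if "i \<le> n" for i using xZ[OF that] Z(3) by blast
    show "x i < x (Suc i)" if "i < n" for i using x(2)[of i "Suc i"] that by simp
    show "(\<Sum>l=t..k. a l * \<phi> l t (x i)) = 0" if "i \<le> n" for i by (rule z[OF xZ[OF that]])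
  qed
qed

section \<open>Underdetermined linear systems\<close>

text \<open>Gaussian elimination: an equation in which the unknown \<open>p\<close> occurs is solved for \<open>p\<close> and
  substituted into the other ones.\<close>

lemma underdetermined_system_nontrivial:
  fixes c :: "'e \<Rightarrow> 'x \<Rightarrow> real"
  assumes "finite E" "finite X" "card E < card X"
  shows "\<exists>a. (\<exists>x\<in>X. a x \<noteq> 0) \<and> (\<forall>e\<in>E. (\<Sum>x\<in>X. a x * c e x) = 0)"
  using assms
proof (induction E arbitrary: X c rule: finite_induct)
  case empty
  then show ?case by (intro exI[of _ "\<lambda>_. 1"]) (auto simp: card_gt_0_iff)
next
  case (insert e E)
  show ?case
  proof (cases "\<forall>x\<in>X. c e x = 0")
    case True
    obtain a where "\<exists>x\<in>X. a x \<noteq> 0" "\<forall>e\<in>E. (\<Sum>x\<in>X. a x * c e x) = 0"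
      using insert.IH[of X c] insert.prems insert.hyps by auto
    then show ?thesis using True by (intro exI[of _ a]) auto
  next
    case False
    then obtain p where p: "p \<in> X" "c e p \<noteq> 0" by blast
    define Y where "Y = X - {p}"
    have X: "X = insert p Y" "p \<notin> Y" "finite Y" using p insert.prems unfolding Y_def by auto
    obtain a where a: "\<exists>x\<in>Y. a x \<noteq> 0"
      "\<forall>g\<in>E. (\<Sum>x\<in>Y. a x * (c g x - c e x * c g p / c e p)) = 0"
      using insert.IH[of Y "\<lambda>g x. c g x - c e x * c g p / c e p"] insert.prems insert.hyps X by auto
    define b where "b = a(p := - (\<Sum>x\<in>Y. a x * c e x) / c e p)"
    have sum_b: "(\<Sum>x\<in>X. b x * c g x) = (\<Sum>x\<in>Y. a x * c g x) - (\<Sum>x\<in>Y. a x * c e x) / c e p * c g p" for g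
    proof -
      have "(\<Sum>x\<in>Y. b x * c g x) = (\<Sum>x\<in>Y. a x * c g x)"
        using X(2) by (intro sum.cong) (auto simp: b_def)
      then show ?thesis using X by (simp add: b_def)
    qed
    have "(\<Sum>x\<in>X. b x * c g x) = 0" if "g \<in> insert e E" for g
    proof (cases "g = e")
      case True
      then show ?thesis using sum_b[of e] p by simp
    next
      case False
      then have "(\<Sum>x\<in>Y. a x * (c g x - c e x * c g p / c e p)) = 0" using a that by auto
      then show ?thesis
        by (simp add: sum_b right_diff_distrib sum_subtractf sum_divide_distrib sum_distrib_left mult_ac)
    qed
    moreover have "\<exists>x\<in>X. b x \<noteq> 0" using a(1) X(1,2) unfolding b_def by auto
    ultimately show ?thesis by blast
  qed
qed

section \<open>Spectral theory of real symmetric matrices\<close>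

lemma symmetric_inner_swap:
  fixes A :: "real^'n^'n"
  assumes "transpose A = A"
  shows "x \<bullet> (A *v y) = (A *v x) \<bullet> y"
  by (metis assms dot_lmul_matrix transpose_matrix_vector)

lemma quadratic_form_add:
  fixes A :: "real^'n^'n"
  assumes "transpose A = A"
  shows "(x + t *\<^sub>R y) \<bullet> (A *v (x + t *\<^sub>R y)) = x \<bullet> (A *v x) + 2 * t * ((A *v x) \<bullet> y) + t\<^sup>2 * (y \<bullet> (A *v y))"
  using symmetric_inner_swap[OF assms, of x y]
  by (simp add: matrix_vector_right_distrib inner_simps matrix_vector_mult_scaleR power2_eq_square
      algebra_simps inner_commute)

text \<open>First-order condition at a minimum, in the form in which it is used for quadratic forms.\<close>

lemma quadratic_nonneg_linear_term_zero:
  fixes b c :: real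
  assumes "\<And>t. 0 \<le> 2 * t * b + t\<^sup>2 * c"
  shows "b = 0"
proof (rule ccontr)
  assume b: "b \<noteq> 0"
  \<comment> \<open>a step against the slope, short enough for the linear term to dominate\<close>
  define t where "t = - b / (\<bar>c\<bar> + 1)"
  have pos: "0 < \<bar>c\<bar> + 1" by simp
  have "t * (\<bar>c\<bar> + 1) = - b" using pos unfolding t_def by simp
  then have "t * b = t * (- (t * (\<bar>c\<bar> + 1)))" by simp
  then have tb: "t * b = - (t\<^sup>2 * (\<bar>c\<bar> + 1))" by (simp add: power2_eq_square)
  have "t\<^sup>2 * c \<le> t\<^sup>2 * \<bar>c\<bar>" by (intro mult_left_mono) auto
  then have "2 * t * b + t\<^sup>2 * c \<le> - (t\<^sup>2 * (\<bar>c\<bar> + 2))"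
    using tb by (simp add: algebra_simps)
  moreover have "0 < t\<^sup>2 * (\<bar>c\<bar> + 2)"
    using b pos unfolding t_def by (intro mult_pos_pos) (auto simp: zero_less_power2)
  ultimately show False using assms[of t] by linarith
qed

text \<open>A maximizer \<open>v\<close> of the Rayleigh quotient on the unit sphere of the subspace is an eigenvector: with
  \<open>r\<close> the maximum, \<open>r |y|\<^sup>2 - y \<bullet> A y\<close> is nonnegative on the subspace and zero at \<open>v\<close>, so its derivative at
  \<open>v\<close> in the direction \<open>r v - A v\<close> vanishes.\<close>

lemma symmetric_eigenvector_in_invariant_subspace:
  fixes A :: "real^'n^'n"
  assumes sym: "transpose A = A" and S: "subspace S" and inv: "\<And>x. x \<in> S \<Longrightarrow> A *v x \<in> S"
    and ne: "\<exists>x\<in>S. x \<noteq> 0"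
  shows "\<exists>v\<in>S. norm v = 1 \<and> (\<exists>r. A *v v = r *\<^sub>R v)"
proof -
  let ?K = "S \<inter> sphere 0 1"
  obtain x where x: "x \<in> S" "x \<noteq> 0" using ne by blast
  have "x /\<^sub>R norm x \<in> ?K" using x S by (auto simp: subspace_scale)
  then have "?K \<noteq> {}" by blast
  moreover have "compact ?K" using S by (simp add: closed_subspace closed_Int_compact)
  moreover have "continuous_on ?K (\<lambda>v. v \<bullet> (A *v v))"
    by (intro continuous_intros linear_continuous_on linear_conv_bounded_linear[THEN iffD1]
        matrix_vector_mul_linear)
  ultimately obtain v where "v \<in> ?K" "\<forall>y\<in>?K. y \<bullet> (A *v y) \<le> v \<bullet> (A *v v)"
    using continuous_attains_sup[of ?K "\<lambda>v. v \<bullet> (A *v v)"] by blast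
  then have v: "v \<in> S" "norm v = 1"
      "\<And>y. y \<in> S \<Longrightarrow> norm y = 1 \<Longrightarrow> y \<bullet> (A *v y) \<le> v \<bullet> (A *v v)"
    by auto
  define r where "r = v \<bullet> (A *v v)"
  have vv: "v \<bullet> v = 1" using v(2) by (simp add: norm_eq_1)
  have le: "y \<bullet> (A *v y) \<le> r * (y \<bullet> y)" if y: "y \<in> S" for y
  proof (cases "y = 0")
    case False
    have "(y /\<^sub>R norm y) \<bullet> (A *v (y /\<^sub>R norm y)) \<le> r"
      unfolding r_def using False y S by (intro v(3)) (auto simp: subspace_scale)
    then have "y \<bullet> (A *v y) / (norm y)\<^sup>2 \<le> r"
      by (simp add: matrix_vector_mult_scaleR power2_eq_square field_simps)
    then show ?thesis using False by (simp add: power2_norm_eq_inner field_simps)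
  qed auto
  define w where "w = r *\<^sub>R v - A *v v"
  have wS: "w \<in> S" unfolding w_def by (intro subspace_diff S subspace_scale v inv)
  have "w \<bullet> w = 0"
  proof (rule quadratic_nonneg_linear_term_zero)
    fix t :: real
    have "(v + t *\<^sub>R w) \<bullet> (A *v (v + t *\<^sub>R w)) \<le> r * ((v + t *\<^sub>R w) \<bullet> (v + t *\<^sub>R w))"
      by (intro le subspace_add S v subspace_scale wS)
    moreover have "(v + t *\<^sub>R w) \<bullet> (v + t *\<^sub>R w) = 1 + 2 * t * (v \<bullet> w) + t\<^sup>2 * (w \<bullet> w)"
      by (simp add: inner_simps vv power2_eq_square inner_commute algebra_simps)
    ultimately have 1: "r + 2 * t * ((A *v v) \<bullet> w) + t\<^sup>2 * (w \<bullet> (A *v w))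
        \<le> r * (1 + 2 * t * (v \<bullet> w) + t\<^sup>2 * (w \<bullet> w))"
      unfolding quadratic_form_add[OF sym, of v t w] r_def by simp
    have ww: "w \<bullet> w = r * (v \<bullet> w) - (A *v v) \<bullet> w"
      using inner_diff_left[of "r *\<^sub>R v" "A *v v" w] unfolding w_def by simp
    have "2 * t * (w \<bullet> w) = 2 * t * (r * (v \<bullet> w)) - 2 * t * ((A *v v) \<bullet> w)"
      unfolding ww by (rule right_diff_distrib)
    with 1 show "0 \<le> 2 * t * (w \<bullet> w) + t\<^sup>2 * (r * (w \<bullet> w) - w \<bullet> (A *v w))"
      by (simp add: distrib_left right_diff_distrib mult_ac)
  qed
  then show ?thesis using v unfolding w_def by (intro bexI[of _ v] conjI exI[of _ r]) auto
qed

definition orthonormal_basis :: "('n \<Rightarrow> real^'n) \<Rightarrow> bool" where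
  "orthonormal_basis e \<longleftrightarrow> (\<forall>i j. e i \<bullet> e j = (if i = j then 1 else 0))"

text \<open>A largest orthonormal set of eigenvectors is a basis, since its orthogonal complement is invariant
  and would otherwise contain another eigenvector.\<close>

lemma spectral_theorem_symmetric:
  fixes A :: "real^'n^'n"
  assumes sym: "transpose A = A"
  shows "\<exists>e l. orthonormal_basis e \<and> (\<forall>i. A *v e i = l i *\<^sub>R e i)"
proof -
  \<comment> \<open>orthonormal sets of eigenvectors\<close>
  define F where "F = (\<lambda>B. pairwise orthogonal B \<and> (\<forall>b\<in>B. norm b = 1 \<and> (\<exists>r. A *v b = r *\<^sub>R b)))"
  have indep: "independent B" if "F B" for B
    using that pairwise_orthogonal_independent[of B] unfolding F_def by force
  have bound: "finite B \<and> card B \<le> CARD('n)" if "F B" for B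
    using independent_bound[OF indep[OF that]] by simp
  have "F {}" unfolding F_def by simp
  then obtain B where B: "F B" "\<And>B'. F B' \<Longrightarrow> card B' \<le> card B"
    using ex_has_greatest_nat[of F "{}" card "Suc (CARD('n))"] bound by (metis le_SucI less_Suc_eq_le)
  have cardB: "card B = CARD('n)"
  proof (rule ccontr)
    assume "card B \<noteq> CARD('n)"
    then have "card B < CARD('n)" using bound[OF B(1)] by simp
    then have "dim B < DIM(real^'n)" using dim_le_card'[of B] bound[OF B(1)] by simp
    then obtain x :: "real^'n" where x: "x \<noteq> 0" "\<And>y. y \<in> span B \<Longrightarrow> orthogonal x y"
      using orthogonal_to_subspace_exists by blast
    define S where "S = {y. \<forall>b\<in>B. orthogonal b y}"
    have S: "subspace S"
      unfolding S_def by (auto simp: subspace_def orthogonal_def inner_simps)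
    have inv: "A *v y \<in> S" if y: "y \<in> S" for y
    proof -
      have "b \<bullet> (A *v y) = 0" if b: "b \<in> B" for b
      proof -
        obtain r where "A *v b = r *\<^sub>R b" using B(1) b unfolding F_def by blast
        then show ?thesis
          using symmetric_inner_swap[OF sym, of b y] y b by (auto simp: S_def orthogonal_def)
      qed
      then show ?thesis by (simp add: S_def orthogonal_def)
    qed
    have "x \<in> S" unfolding S_def using x(2) by (simp add: orthogonal_commute span_base)
    then obtain v r where v: "v \<in> S" "norm v = 1" "A *v v = r *\<^sub>R v"
      using symmetric_eigenvector_in_invariant_subspace[OF sym S inv] x(1) by blast
    have "v \<notin> B" using v by (auto simp: S_def orthogonal_def)
    have "F (insert v B)"
      using B(1) v unfolding F_def S_def by (auto simp: pairwise_insert orthogonal_commute)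
    then have "card (insert v B) \<le> card B" by (rule B(2))
    then show False using \<open>v \<notin> B\<close> bound[OF B(1)] by simp
  qed
  obtain e :: "'n \<Rightarrow> real^'n" where e: "bij_betw e UNIV B"
    using finite_same_card_bij[of "UNIV :: 'n set" B] bound[OF B(1)] cardB by auto
  have eB: "e i \<in> B" for i using e by (auto simp: bij_betw_def)
  have "\<forall>i. \<exists>r. A *v e i = r *\<^sub>R e i" using B(1) eB unfolding F_def by blast
  then obtain l where "\<And>i. A *v e i = l i *\<^sub>R e i" by metis
  moreover have "e i \<bullet> e j = (if i = j then 1 else 0)" for i j
    using B(1) eB[of i] eB[of j] e
    by (auto simp: F_def norm_eq_1 pairwise_def orthogonal_def bij_betw_def inj_eq)
  ultimately show ?thesis unfolding orthonormal_basis_def by blast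
qed

lemma orthonormal_basis_matrix:
  "orthonormal_basis e \<longleftrightarrow> orthogonal_matrix (\<chi> i j. e j $ i)"
  by (auto simp: orthonormal_basis_def orthogonal_matrix_orthonormal_columns norm_eq_1
      orthogonal_def column_def)

lemma orthonormal_basis_parseval:
  assumes "orthonormal_basis e"
  shows "(\<Sum>i\<in>UNIV. (e i \<bullet> x) * (e i \<bullet> y)) = x \<bullet> y"
    and "(\<Sum>i\<in>UNIV. (e i \<bullet> x) *\<^sub>R e i) = x"
proof -
  let ?Q = "\<chi> i j. e j $ i"
  have Q: "?Q ** transpose ?Q = mat 1"
    using assms by (simp add: orthonormal_basis_matrix orthogonal_matrix_def)
  have comp: "(transpose ?Q *v x) $ i = e i \<bullet> x" for i x
    by (simp add: matrix_vector_mult_def Finite_Cartesian_Product.transpose_def inner_vec_def del: transpose_matrix_vector)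
  have "x = ?Q *v (transpose ?Q *v x)"
    by (simp only: matrix_vector_mul_assoc Q matrix_vector_mul_lid)
  also have "\<dots> = (\<Sum>i\<in>UNIV. (e i \<bullet> x) *\<^sub>R e i)"
    unfolding matrix_mult_sum[of ?Q] comp
    by (intro sum.cong) (auto simp: column_def scalar_mult_eq_scaleR)
  finally show *: "(\<Sum>i\<in>UNIV. (e i \<bullet> x) *\<^sub>R e i) = x" by simp
  have "x \<bullet> y = (\<Sum>i\<in>UNIV. (e i \<bullet> x) *\<^sub>R e i) \<bullet> y" using * by simp
  then show "(\<Sum>i\<in>UNIV. (e i \<bullet> x) * (e i \<bullet> y)) = x \<bullet> y" by (simp add: inner_sum_left)
qed

definition eigensystem :: "real^'n^'n \<Rightarrow> ('n \<Rightarrow> real^'n) \<Rightarrow> ('n \<Rightarrow> real) \<Rightarrow> bool" where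
  "eigensystem A e l \<longleftrightarrow> orthonormal_basis e \<and> (\<forall>i. A *v e i = l i *\<^sub>R e i)"

lemma eigensystem_exists: "transpose A = A \<Longrightarrow> \<exists>e l. eigensystem A e l"
  unfolding eigensystem_def by (rule spectral_theorem_symmetric)

lemma eigenvalue_eq_diagonal: "eigensystem A e l \<Longrightarrow> l i = e i \<bullet> (A *v e i)"
  by (simp add: eigensystem_def orthonormal_basis_def)

lemma posdef_imp_nnd: "posdef A \<Longrightarrow> nnd A"
  unfolding posdef_def nnd_def
  by (metis inner_zero_left less_eq_real_def)

lemma orthonormal_basis_nonzero: "orthonormal_basis e \<Longrightarrow> e i \<noteq> 0"
  unfolding orthonormal_basis_def by (metis inner_zero_left zero_neq_one)

lemma eigenvalue_posdef: "eigensystem A e l \<Longrightarrow> posdef A \<Longrightarrow> 0 < l i"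
  by (metis eigenvalue_eq_diagonal orthonormal_basis_nonzero posdef_def eigensystem_def)

text \<open>A null vector of a nonnegative form minimizes it, so the gradient of the form vanishes there.\<close>

lemma nnd_quadratic_zero_imp_kernel:
  assumes A: "nnd A" and z: "v \<bullet> (A *v v) = 0"
  shows "A *v v = 0"
proof -
  have sym: "transpose A = A" using A by (simp add: nnd_def)
  have "(A *v v) \<bullet> (A *v v) = 0"
  proof (rule quadratic_nonneg_linear_term_zero)
    fix t :: real
    have "0 \<le> (v + t *\<^sub>R (A *v v)) \<bullet> (A *v (v + t *\<^sub>R (A *v v)))" using A by (simp add: nnd_def)
    then show "0 \<le> 2 * t * ((A *v v) \<bullet> (A *v v)) + t\<^sup>2 * ((A *v v) \<bullet> (A *v (A *v v)))"
      unfolding quadratic_form_add[OF sym] by (simp add: z)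
  qed
  then show ?thesis by simp
qed

lemma matrix_eq_on_orthonormal_basis:
  fixes A B :: "real^'n^'n"
  assumes e: "orthonormal_basis e" and eq: "\<And>i. A *v e i = B *v e i"
  shows "A = B"
proof -
  have "A *v x = B *v x" for x
  proof -
    have "A *v (\<Sum>i\<in>UNIV. (e i \<bullet> x) *\<^sub>R e i) = B *v (\<Sum>i\<in>UNIV. (e i \<bullet> x) *\<^sub>R e i)"
      by (simp add: linear_sum[OF matrix_vector_mul_linear] matrix_vector_mult_scaleR eq)
    then show ?thesis by (simp add: orthonormal_basis_parseval(2)[OF e])
  qed
  then show ?thesis by (simp add: matrix_eq)
qed

text \<open>Strict concavity on the positive half-line, expressed by supporting lines: \<open>d y\<close> is the slope at \<open>y\<close>.\<close>

definition strict_tangent :: "(real \<Rightarrow> real) \<Rightarrow> (real \<Rightarrow> real) \<Rightarrow> bool" where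
  "strict_tangent \<phi> d \<longleftrightarrow> (\<forall>x>0. \<forall>y>0. x \<noteq> y \<longrightarrow> \<phi> x < \<phi> y + d y * (x - y))"

lemma strict_tangent_le: "strict_tangent \<phi> d \<Longrightarrow> 0 < x \<Longrightarrow> 0 < y \<Longrightarrow> \<phi> x \<le> \<phi> y + d y * (x - y)"
  unfolding strict_tangent_def by (cases "x = y") (auto simp: less_imp_le)

text \<open>With weights \<open>W i j = (b\<^sub>j \<bullet> e\<^sub>i)\<^sup>2\<close>, a doubly stochastic matrix, the diagonal entry
  \<open>e\<^sub>i \<bullet> B e\<^sub>i\<close> is the mean of the eigenvalues with the weights of row \<open>i\<close>. Jensen's inequality in each row
  and summation over the rows give the claim. In the case of equality only eigenvectors \<open>b\<^sub>j\<close> with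
  eigenvalue \<open>e\<^sub>i \<bullet> B e\<^sub>i\<close> contribute to \<open>e\<^sub>i\<close>, which is therefore an eigenvector itself.\<close>

lemma peierls_inequality:
  fixes B :: "real^'n^'n"
  assumes B: "eigensystem B b \<mu>" "\<And>j. 0 < \<mu> j" and e: "orthonormal_basis e"
    and \<phi>: "strict_tangent \<phi> d"
  shows "(\<Sum>j\<in>UNIV. \<phi> (\<mu> j)) \<le> (\<Sum>i\<in>UNIV. \<phi> (e i \<bullet> (B *v e i)))"
    and "(\<Sum>j\<in>UNIV. \<phi> (\<mu> j)) = (\<Sum>i\<in>UNIV. \<phi> (e i \<bullet> (B *v e i))) \<Longrightarrow>
      B *v e i = (e i \<bullet> (B *v e i)) *\<^sub>R e i"
proof -
  have b: "orthonormal_basis b" and Bb: "\<And>j. B *v b j = \<mu> j *\<^sub>R b j"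
    using B(1) by (auto simp: eigensystem_def)
  define m where "m = (\<lambda>i. e i \<bullet> (B *v e i))"
  define W where "W = (\<lambda>i j. (b j \<bullet> e i)\<^sup>2)"
  have Be: "B *v e i = (\<Sum>j\<in>UNIV. (b j \<bullet> e i) *\<^sub>R (\<mu> j *\<^sub>R b j))" for i
  proof -
    have "B *v e i = B *v (\<Sum>j\<in>UNIV. (b j \<bullet> e i) *\<^sub>R b j)"
      by (simp add: orthonormal_basis_parseval(2)[OF b])
    then show ?thesis
      by (simp add: linear_sum[OF matrix_vector_mul_linear] matrix_vector_mult_scaleR Bb)
  qed
  have m: "m i = (\<Sum>j\<in>UNIV. W i j * \<mu> j)" for i
    unfolding m_def Be W_def
    by (simp add: inner_sum_right power2_eq_square inner_commute mult_ac)
  have row: "(\<Sum>j\<in>UNIV. W i j) = 1" for i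
    using orthonormal_basis_parseval(1)[OF b, of "e i" "e i"] e
    unfolding W_def orthonormal_basis_def by (simp add: power2_eq_square)
  have col: "(\<Sum>i\<in>UNIV. W i j) = 1" for j
    using orthonormal_basis_parseval(1)[OF e, of "b j" "b j"] b
    unfolding W_def orthonormal_basis_def by (simp add: power2_eq_square inner_commute)
  have W0: "0 \<le> W i j" for i j unfolding W_def by simp
  have m0: "0 < m i" for i
  proof -
    have "\<exists>j. W i j \<noteq> 0" using row[of i] by (metis sum.neutral zero_neq_one)
    then obtain j where "0 < W i j" using W0 by (metis less_eq_real_def)
    then show ?thesis unfolding m
      by (intro sum_pos2[of UNIV j]) (auto intro!: mult_pos_pos mult_nonneg_nonneg W0 B(2) less_imp_le[OF B(2)])
  qed
  have weighted: "W i j * \<phi> (\<mu> j) \<le> W i j * (\<phi> (m i) + d (m i) * (\<mu> j - m i))" for i j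
    by (intro mult_left_mono strict_tangent_le[OF \<phi>] B(2) m0 W0)
  have total: "(\<Sum>j\<in>UNIV. W i j * (\<phi> (m i) + d (m i) * (\<mu> j - m i))) = \<phi> (m i)" for i
  proof -
    have "(\<Sum>j\<in>UNIV. W i j * (\<phi> (m i) + d (m i) * (\<mu> j - m i)))
        = (\<Sum>j\<in>UNIV. W i j) * (\<phi> (m i) - d (m i) * m i) + d (m i) * (\<Sum>j\<in>UNIV. W i j * \<mu> j)"
      by (simp add: sum_distrib_left sum_distrib_right sum.distrib[symmetric] algebra_simps)
    then show ?thesis by (simp add: row m[symmetric])
  qed
  have jensen: "(\<Sum>j\<in>UNIV. W i j * \<phi> (\<mu> j)) \<le> \<phi> (m i)" for i
    using sum_mono[of UNIV "\<lambda>j. W i j * \<phi> (\<mu> j)", OF weighted] total by simp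
  have swap: "(\<Sum>j\<in>UNIV. \<phi> (\<mu> j)) = (\<Sum>i\<in>UNIV. \<Sum>j\<in>UNIV. W i j * \<phi> (\<mu> j))"
    by (subst sum.swap) (simp add: sum_distrib_right[symmetric] col)
  show le: "(\<Sum>j\<in>UNIV. \<phi> (\<mu> j)) \<le> (\<Sum>i\<in>UNIV. \<phi> (e i \<bullet> (B *v e i)))"
    unfolding swap by (intro sum_mono jensen[unfolded m_def])
  assume eq: "(\<Sum>j\<in>UNIV. \<phi> (\<mu> j)) = (\<Sum>i\<in>UNIV. \<phi> (e i \<bullet> (B *v e i)))"
  have "(\<Sum>i\<in>UNIV. \<Sum>j\<in>UNIV. W i j * \<phi> (\<mu> j)) = (\<Sum>i\<in>UNIV. \<phi> (m i))"
    using eq unfolding swap m_def .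
  then have eqi: "(\<Sum>j\<in>UNIV. W i j * \<phi> (\<mu> j)) = \<phi> (m i)"
    using sum_mono_inv[of "\<lambda>i. (\<Sum>j\<in>UNIV. W i j * \<phi> (\<mu> j))" UNIV "\<lambda>i. \<phi> (m i)" i] jensen by simp
  have "(b j \<bullet> e i) *\<^sub>R (\<mu> j *\<^sub>R b j) = m i *\<^sub>R ((b j \<bullet> e i) *\<^sub>R b j)" for j
  proof (cases "b j \<bullet> e i = 0 \<or> \<mu> j = m i")
    case False
    have "W i j * \<phi> (\<mu> j) = W i j * (\<phi> (m i) + d (m i) * (\<mu> j - m i))"
      using sum_mono_inv[of "\<lambda>j. W i j * \<phi> (\<mu> j)" UNIV
          "\<lambda>j. W i j * (\<phi> (m i) + d (m i) * (\<mu> j - m i))" j] eqi total weighted by simp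
    then have "\<phi> (\<mu> j) = \<phi> (m i) + d (m i) * (\<mu> j - m i)" using False by (simp add: W_def)
    then show ?thesis using \<phi> B(2)[of j] m0[of i] False unfolding strict_tangent_def by (metis less_irrefl)
  qed auto
  then have "B *v e i = m i *\<^sub>R (\<Sum>j\<in>UNIV. (b j \<bullet> e i) *\<^sub>R b j)"
    unfolding Be scaleR_sum_right by (intro sum.cong refl)
  then show "B *v e i = (e i \<bullet> (B *v e i)) *\<^sub>R e i"
    by (simp add: orthonormal_basis_parseval(2)[OF b] m_def)
qed

text \<open>Compare diagonals in an eigenbasis of the larger matrix: they increase strictly somewhere, and
  Peierls' inequality bounds the spectral sum of the smaller matrix by the sum over its diagonal.\<close>

lemma spectral_sum_strict_mono:
  fixes A B :: "real^'n^'n"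
  assumes AB: "loewner_ge A B" "A \<noteq> B" and B: "posdef B"
    and eA: "eigensystem A e l" and eB: "eigensystem B b \<mu>"
    and \<phi>: "strict_tangent \<phi> d" and mono: "\<And>x y. 0 < x \<Longrightarrow> x < y \<Longrightarrow> \<phi> x < \<phi> y"
  shows "(\<Sum>j\<in>UNIV. \<phi> (\<mu> j)) < (\<Sum>i\<in>UNIV. \<phi> (l i))"
proof -
  have e: "orthonormal_basis e" using eA by (simp add: eigensystem_def)
  have diff: "e i \<bullet> ((A - B) *v e i) = l i - e i \<bullet> (B *v e i)" for i
    using eigenvalue_eq_diagonal[OF eA, of i]
    by (simp add: matrix_vector_mult_diff_rdistrib inner_diff_right)
  have ge: "e i \<bullet> (B *v e i) \<le> l i" for i
    using AB(1) diff[of i] by (metis diff_ge_0_iff_ge loewner_ge_def nnd_def)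
  have pos: "0 < e i \<bullet> (B *v e i)" for i
    using B orthonormal_basis_nonzero[OF e] by (simp add: posdef_def)
  have "\<exists>i. e i \<bullet> (B *v e i) \<noteq> l i"
  proof (rule ccontr)
    assume "\<nexists>i. e i \<bullet> (B *v e i) \<noteq> l i"
    then have "(A - B) *v e i = 0" for i
      using nnd_quadratic_zero_imp_kernel[of "A - B" "e i"] AB(1) diff[of i] by (simp add: loewner_ge_def)
    then have "A *v e i = B *v e i" for i by (simp add: matrix_vector_mult_diff_rdistrib)
    then show False using matrix_eq_on_orthonormal_basis[OF e] AB(2) by blast
  qed
  then obtain k where k: "e k \<bullet> (B *v e k) < l k" using ge by (metis less_eq_real_def)
  have "(\<Sum>j\<in>UNIV. \<phi> (\<mu> j)) \<le> (\<Sum>i\<in>UNIV. \<phi> (e i \<bullet> (B *v e i)))"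
    by (rule peierls_inequality(1)[OF eB eigenvalue_posdef[OF eB B] e \<phi>])
  also have "\<dots> < (\<Sum>i\<in>UNIV. \<phi> (l i))"
  proof (rule sum_strict_mono_ex1)
    show "\<forall>i\<in>UNIV. \<phi> (e i \<bullet> (B *v e i)) \<le> \<phi> (l i)"
      using ge pos mono by (metis less_eq_real_def)
  qed (use mono[OF pos k] in auto)
  finally show ?thesis .
qed

text \<open>In an eigenbasis of the midpoint the three diagonals satisfy the scalar inequality, and
  Peierls' inequality passes to the eigenvalues of \<open>A\<close> and \<open>B\<close>. If no inequality were strict, the
  basis would diagonalize \<open>A\<close> and \<open>B\<close> as well, with the same eigenvalues.\<close>

lemma spectral_sum_strict_concave:
  fixes A B :: "real^'n^'n"
  assumes A: "posdef A" and B: "posdef B" and ne: "A \<noteq> B"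
    and eC: "eigensystem ((1/2) *\<^sub>R A + (1/2) *\<^sub>R B) e l"
    and eA: "eigensystem A a \<alpha>" and eB: "eigensystem B b \<beta>"
    and \<phi>: "strict_tangent \<phi> d"
  shows "((\<Sum>i\<in>UNIV. \<phi> (\<alpha> i)) + (\<Sum>i\<in>UNIV. \<phi> (\<beta> i))) / 2 < (\<Sum>i\<in>UNIV. \<phi> (l i))"
proof (rule ccontr)
  assume not_less: "\<not> ?thesis"
  have e: "orthonormal_basis e" using eC by (simp add: eigensystem_def)
  define x where "x = (\<lambda>i. e i \<bullet> (A *v e i))"
  define y where "y = (\<lambda>i. e i \<bullet> (B *v e i))"
  have pos: "0 < x i" "0 < y i" for i
    using A B orthonormal_basis_nonzero[OF e] by (auto simp: posdef_def x_def y_def)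
  have l: "l i = (x i + y i) / 2" for i
    using eigenvalue_eq_diagonal[OF eC, of i]
    by (simp add: x_def y_def matrix_vector_mult_add_rdistrib scaleR_matrix_vector_assoc[symmetric] inner_add_right)
  have mid: "(\<phi> (x i) + \<phi> (y i)) / 2 \<le> \<phi> (l i)" "x i \<noteq> y i \<Longrightarrow> (\<phi> (x i) + \<phi> (y i)) / 2 < \<phi> (l i)" for i
  proof -
    have "0 < l i" using pos[of i] l[of i] by simp
    then have t: "\<phi> (x i) \<le> \<phi> (l i) + d (l i) * (x i - l i)" "\<phi> (y i) \<le> \<phi> (l i) + d (l i) * (y i - l i)"
      using strict_tangent_le[OF \<phi>] pos by auto
    have z: "d (l i) * (x i - l i) + d (l i) * (y i - l i) = 0"
      unfolding l by (simp add: field_simps)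
    show "(\<phi> (x i) + \<phi> (y i)) / 2 \<le> \<phi> (l i)" using t z by simp
    assume "x i \<noteq> y i"
    then have "x i \<noteq> l i" unfolding l by simp
    then have "\<phi> (x i) < \<phi> (l i) + d (l i) * (x i - l i)"
      using \<phi> pos[of i] \<open>0 < l i\<close> unfolding strict_tangent_def by blast
    then show "(\<phi> (x i) + \<phi> (y i)) / 2 < \<phi> (l i)" using t z by simp
  qed
  have pA: "(\<Sum>i\<in>UNIV. \<phi> (\<alpha> i)) \<le> (\<Sum>i\<in>UNIV. \<phi> (x i))"
    unfolding x_def by (rule peierls_inequality(1)[OF eA eigenvalue_posdef[OF eA A] e \<phi>])
  have pB: "(\<Sum>i\<in>UNIV. \<phi> (\<beta> i)) \<le> (\<Sum>i\<in>UNIV. \<phi> (y i))"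
    unfolding y_def by (rule peierls_inequality(1)[OF eB eigenvalue_posdef[OF eB B] e \<phi>])
  have half: "(\<Sum>i\<in>UNIV. (\<phi> (x i) + \<phi> (y i)) / 2) = ((\<Sum>i\<in>UNIV. \<phi> (x i)) + (\<Sum>i\<in>UNIV. \<phi> (y i))) / 2"
    by (simp add: sum.distrib sum_divide_distrib[symmetric])
  have le: "((\<Sum>i\<in>UNIV. \<phi> (x i)) + (\<Sum>i\<in>UNIV. \<phi> (y i))) / 2 \<le> (\<Sum>i\<in>UNIV. \<phi> (l i))"
    unfolding half[symmetric] by (intro sum_mono mid)
  have squeeze: "a = x \<and> b = y \<and> (x + y) / 2 = l"
    if "a \<le> x" "b \<le> y" "(x + y) / 2 \<le> l" "\<not> (a + b) / 2 < l" for a b x y l :: real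
    using that by (auto simp: not_less field_simps)
  note sq = squeeze[OF pA pB le not_less]
  have eqA: "(\<Sum>i\<in>UNIV. \<phi> (\<alpha> i)) = (\<Sum>i\<in>UNIV. \<phi> (x i))"
    using sq by simp
  have eqB: "(\<Sum>i\<in>UNIV. \<phi> (\<beta> i)) = (\<Sum>i\<in>UNIV. \<phi> (y i))"
    using sq by simp
  have eqC: "(\<Sum>i\<in>UNIV. (\<phi> (x i) + \<phi> (y i)) / 2) = (\<Sum>i\<in>UNIV. \<phi> (l i))"
    unfolding half using sq by simp
  have xy: "x i = y i" for i
  proof (rule ccontr)
    assume "x i \<noteq> y i"
    then show False
      using mid(2)[of i] sum_mono_inv[OF eqC mid(1), of i] by simp
  qed
  have "A *v e i = B *v e i" for i
    using peierls_inequality(2)[OF eA eigenvalue_posdef[OF eA A] e \<phi>, of i]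
      peierls_inequality(2)[OF eB eigenvalue_posdef[OF eB B] e \<phi>, of i] eqA eqB xy[of i]
    by (simp add: x_def y_def)
  then show False using matrix_eq_on_orthonormal_basis[OF e] ne by blast
qed

lemma matrix_mult_diag_entry:
  "(X ** diag_matrix l) $ i $ j = X $ i $ j * l $ j"
  "(diag_matrix l ** X) $ i $ j = l $ i * X $ i $ j"
  by (simp_all add: matrix_matrix_mult_def diag_matrix_def if_distrib[of "\<lambda>t. _ * t"]
      if_distribR if_distrib[of "\<lambda>t. t * _"] cong: if_cong)

text \<open>Two diagonalizations of one matrix are intertwined by \<open>T = R\<^sup>T Q\<close>, and a nonzero entry of \<open>T\<close> forces
  the corresponding eigenvalues to coincide; hence \<open>T\<close> intertwines every function of them. This makes
  the definite description in \<open>matrix_powr\<close> meaningful.\<close>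

lemma orthogonal_diagonalization_function_unique:
  fixes Q R :: "real^'n^'n"
  assumes Q: "orthogonal_matrix Q" and R: "orthogonal_matrix R"
    and eq: "Q ** diag_matrix l ** transpose Q = R ** diag_matrix r ** transpose R"
  shows "Q ** diag_matrix (\<chi> i. f (l $ i)) ** transpose Q = R ** diag_matrix (\<chi> i. f (r $ i)) ** transpose R"
proof -
  have QQ: "transpose Q ** Q = mat 1" "Q ** transpose Q = mat 1"
   and RR: "transpose R ** R = mat 1" "R ** transpose R = mat 1"
    using Q R by (auto simp: orthogonal_matrix_def)
  define T where "T = transpose R ** Q"
  have "diag_matrix r ** T = (transpose R ** R) ** diag_matrix r ** transpose R ** Q"
    unfolding T_def RR by (simp add: matrix_mul_assoc)
  also have "\<dots> = transpose R ** (R ** diag_matrix r ** transpose R) ** Q"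
    by (simp add: matrix_mul_assoc)
  also have "\<dots> = T ** diag_matrix l ** (transpose Q ** Q)"
    unfolding eq[symmetric] T_def by (simp add: matrix_mul_assoc)
  finally have "diag_matrix r ** T = T ** diag_matrix l" unfolding QQ by simp
  then have ent: "r $ i * T $ i $ j = T $ i $ j * l $ j" for i j
    by (metis matrix_mult_diag_entry)
  have "diag_matrix (\<chi> i. f (r $ i)) ** T = T ** diag_matrix (\<chi> i. f (l $ i))"
  proof -
    have "f (r $ i) * T $ i $ j = T $ i $ j * f (l $ j)" for i j
      using ent[of i j] by (cases "T $ i $ j = 0") auto
    then show ?thesis by (simp add: vec_eq_iff matrix_mult_diag_entry)
  qed
  then have "R ** (diag_matrix (\<chi> i. f (r $ i)) ** T) ** transpose Q
      = R ** (T ** diag_matrix (\<chi> i. f (l $ i))) ** transpose Q" by simp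
  moreover have "R ** (diag_matrix (\<chi> i. f (r $ i)) ** T) ** transpose Q
      = R ** diag_matrix (\<chi> i. f (r $ i)) ** transpose R ** (Q ** transpose Q)"
    unfolding T_def by (simp only: matrix_mul_assoc)
  moreover have "R ** (T ** diag_matrix (\<chi> i. f (l $ i))) ** transpose Q
      = (R ** transpose R) ** Q ** diag_matrix (\<chi> i. f (l $ i)) ** transpose Q"
    unfolding T_def by (simp only: matrix_mul_assoc)
  ultimately show ?thesis unfolding QQ RR by simp
qed

lemma eigensystem_diagonalization:
  fixes A :: "real^'n^'n"
  assumes "eigensystem A e l"
  defines "Q \<equiv> \<chi> i j. e j $ i"
  shows "orthogonal_matrix Q" "A = Q ** diag_matrix (\<chi> i. l i) ** transpose Q"
proof -
  show Q: "orthogonal_matrix Q"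
    using assms by (simp add: eigensystem_def orthonormal_basis_matrix)
  have "(A ** Q) $ i $ j = (A *v e j) $ i" for i j
    by (simp add: Q_def matrix_matrix_mult_def matrix_vector_mult_def)
  then have "A ** Q = Q ** diag_matrix (\<chi> i. l i)"
    using assms by (simp add: vec_eq_iff matrix_mult_diag_entry eigensystem_def Q_def mult.commute)
  then have "A ** Q ** transpose Q = Q ** diag_matrix (\<chi> i. l i) ** transpose Q" by simp
  then show "A = Q ** diag_matrix (\<chi> i. l i) ** transpose Q"
    using Q by (simp add: orthogonal_matrix_def matrix_mul_assoc[symmetric])
qed

lemma trace_matrix_powr:
  assumes "eigensystem A e l"
  shows "trace (matrix_powr A p) = (\<Sum>i\<in>UNIV. l i powr p)"
proof -
  define Q where "Q = (\<chi> i j. e j $ i)"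
  have Q: "orthogonal_matrix Q" "A = Q ** diag_matrix (\<chi> i. l i) ** transpose Q"
    using eigensystem_diagonalization[OF assms] unfolding Q_def by auto
  have "matrix_powr A p = Q ** diag_matrix (\<chi> i. (\<chi> i. l i) $ i powr p) ** transpose Q"
    unfolding matrix_powr_def
  proof (rule the_equality)
    show "\<exists>Q' l'. orthogonal_matrix Q' \<and> A = Q' ** diag_matrix l' ** transpose Q' \<and>
        Q ** diag_matrix (\<chi> i. (\<chi> i. l i) $ i powr p) ** transpose Q
          = Q' ** diag_matrix (\<chi> i. l' $ i powr p) ** transpose Q'"
      using Q by blast
    show "B = Q ** diag_matrix (\<chi> i. (\<chi> i. l i) $ i powr p) ** transpose Q"
      if ex: "\<exists>Q' l'. orthogonal_matrix Q' \<and> A = Q' ** diag_matrix l' ** transpose Q' \<and>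
        B = Q' ** diag_matrix (\<chi> i. l' $ i powr p) ** transpose Q'" for B
    proof -
      obtain Q' l' where *: "orthogonal_matrix Q'" "A = Q' ** diag_matrix l' ** transpose Q'"
        "B = Q' ** diag_matrix (\<chi> i. l' $ i powr p) ** transpose Q'" using ex by blast
      show ?thesis unfolding *(3)
        by (rule orthogonal_diagonalization_function_unique[OF *(1) Q(1)]) (use * Q in metis)
    qed
  qed
  then have "trace (matrix_powr A p) = trace ((transpose Q ** Q) ** diag_matrix (\<chi> i. l i powr p))"
    by (simp add: trace_mul_sym[of _ "transpose Q"] matrix_mul_assoc)
  also have "\<dots> = (\<Sum>i\<in>UNIV. l i powr p)"
    using Q(1) by (simp add: orthogonal_matrix_def trace_def diag_matrix_def)
  finally show ?thesis .
qed

lemma det_eigensystem: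
  assumes "eigensystem A e l"
  shows "det A = (\<Prod>i\<in>UNIV. l i)"
proof -
  define Q where "Q = (\<chi> i j. e j $ i)"
  have Q: "orthogonal_matrix Q" "A = Q ** diag_matrix (\<chi> i. l i) ** transpose Q"
    using eigensystem_diagonalization[OF assms] unfolding Q_def by auto
  have "det A = det (transpose Q ** Q) * det (diag_matrix (\<chi> i. l i))"
    unfolding Q(2) by (simp add: det_mul)
  also have "\<dots> = (\<Prod>i\<in>UNIV. l i)"
    using Q(1) by (subst det_diagonal) (auto simp: orthogonal_matrix_def diag_matrix_def)
  finally show ?thesis .
qed

section \<open>The criteria for a reparameterization\<close>

lemma ln_strict_tangent: "strict_tangent ln (\<lambda>y. 1 / y)"
  unfolding strict_tangent_def
proof (intro allI impI)
  fix x y :: real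
  assume xy: "0 < x" "0 < y" "x \<noteq> y"
  have "ln (x / y) < x / y - 1"
    using ln_le_minus_one[of "x / y"] ln_eq_minus_one[of "x / y"] xy by fastforce
  then show "ln x < ln y + 1 / y * (x - y)"
    using xy by (simp add: ln_div diff_divide_distrib)
qed

text \<open>With \<open>r = x / y\<close>: \<open>r\<^sup>p \<ge> 1 + p ln r > 1 + p (r - 1)\<close> since \<open>ln r < r - 1\<close> and \<open>p < 0\<close>.\<close>

lemma powr_strict_tangent_neg:
  assumes p: "p < 0"
  shows "strict_tangent (\<lambda>t. - (t powr p)) (\<lambda>y. - (p * y powr (p - 1)))"
  unfolding strict_tangent_def
proof (intro allI impI)
  fix x y :: real
  assume xy: "0 < x" "0 < y" "x \<noteq> y"
  have "ln (x / y) < ln 1 + 1 / 1 * (x / y - 1)"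
    using ln_strict_tangent xy unfolding strict_tangent_def
    by (metis divide_eq_1_iff divide_pos_pos less_irrefl zero_less_one)
  then have "p * (x / y - 1) < p * ln (x / y)"
    using p by (intro mult_strict_left_mono_neg) auto
  also have "\<dots> \<le> (x / y) powr p - 1"
  proof -
    have "(x / y) powr p = exp (p * ln (x / y))" using xy by (simp add: powr_def)
    then show ?thesis using exp_ge_add_one_self[of "p * ln (x / y)"] by linarith
  qed
  finally have "y powr p * (1 + p * (x / y - 1)) < y powr p * (x / y) powr p"
    using xy by simp
  also have "\<dots> = x powr p" using xy by (simp add: powr_divide)
  finally show "- (x powr p) < - (y powr p) + - (p * y powr (p - 1)) * (x - y)"
    using xy by (simp add: powr_diff field_simps)
qed

text \<open>With \<open>r = x / y\<close> the claim is Bernoulli's inequality \<open>r\<^sup>p < 1 + p (r - 1)\<close>. The right-hand side \<open>m\<close> is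
  the mean of \<open>r\<close> and \<open>1\<close> with weights \<open>p\<close> and \<open>1 - p\<close>, so strict concavity of \<open>ln\<close> gives
  \<open>p ln r < ln m\<close>.\<close>

lemma powr_strict_tangent_pos:
  assumes p: "0 < p" "p < 1"
  shows "strict_tangent (\<lambda>t. t powr p) (\<lambda>y. p * y powr (p - 1))"
  unfolding strict_tangent_def
proof (intro allI impI)
  fix x y :: real
  assume xy: "0 < x" "0 < y" "x \<noteq> y"
  define r where "r = x / y"
  have r: "0 < r" "r \<noteq> 1" using xy by (auto simp: r_def)
  define m where "m = p * r + (1 - p)"
  have m: "0 < m" unfolding m_def using r p by (intro add_pos_pos) auto
  have mr: "m - 1 = p * (r - 1)" unfolding m_def by (simp add: algebra_simps)
  have m1: "1 \<noteq> m" using mr r p by auto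
  define d where "d = 1 / m"
  have a: "ln r \<le> ln m + d * (r - m)"
    unfolding d_def by (rule strict_tangent_le[OF ln_strict_tangent r(1) m])
  have b: "ln 1 < ln m + d * (1 - m)"
    using ln_strict_tangent m m1 unfolding strict_tangent_def d_def by (metis zero_less_one)
  have "p * ln r + (1 - p) * ln 1 < p * (ln m + d * (r - m)) + (1 - p) * (ln m + d * (1 - m))"
    using a b p by (intro add_le_less_mono mult_left_mono mult_strict_left_mono) auto
  also have "\<dots> = ln m + d * (p * r + (1 - p) - m)" by (simp add: algebra_simps)
  also have "\<dots> = ln m" by (simp add: m_def)
  finally have "p * ln r < ln m" by simp
  then have "r powr p < m" using r m by (metis exp_less_mono exp_ln powr_def less_irrefl)
  then have "y powr p * r powr p < y powr p * m" using xy by simp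
  moreover have "y powr p * r powr p = x powr p" using xy by (simp add: powr_divide r_def)
  moreover have "y powr p * m = y powr p + p * y powr (p - 1) * (x - y)"
    using xy unfolding m_def r_def by (simp add: powr_diff field_simps)
  ultimately show "x powr p < y powr p + p * y powr (p - 1) * (x - y)" by simp
qed

text \<open>The sign makes the function increasing for every \<open>p\<close>; it is strictly concave for \<open>p < 1\<close>.\<close>

definition power_utility :: "real \<Rightarrow> real \<Rightarrow> real" where
  "power_utility p t = (if p = 0 then ln t else sgn p * t powr p)"

lemma power_utility_strict_tangent: "p < 1 \<Longrightarrow> \<exists>d. strict_tangent (power_utility p) d"
proof -
  assume p: "p < 1"
  consider "p = 0" | "p < 0" | "0 < p" by linarith
  then show ?thesis
  proof cases
    case 1
    then show ?thesis using ln_strict_tangent unfolding power_utility_def by auto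
  next
    case 2
    then show ?thesis using powr_strict_tangent_neg[OF 2] unfolding power_utility_def by auto
  next
    case 3
    then show ?thesis using powr_strict_tangent_pos[OF 3 p] unfolding power_utility_def by auto
  qed
qed

lemma power_utility_strict_mono: "0 < x \<Longrightarrow> x < y \<Longrightarrow> power_utility p x < power_utility p y"
  unfolding power_utility_def
  by (auto simp: sgn_if intro: powr_less_mono2 powr_less_mono2_neg)

text \<open>The \<open>p\<close>-th power mean of \<open>n\<close> numbers as a function of the sum \<open>s\<close> of their utilities.\<close>

definition power_mean_of_utility :: "real \<Rightarrow> real \<Rightarrow> real \<Rightarrow> real" where
  "power_mean_of_utility n p s = (if p = 0 then exp (s / n) else (sgn p * s / n) powr (1 / p))"

lemma power_mean_of_utility_strict_mono:
  assumes n: "0 < n" and pos: "p \<noteq> 0 \<Longrightarrow> 0 < sgn p * s" "p \<noteq> 0 \<Longrightarrow> 0 < sgn p * t" and "s < t"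
  shows "power_mean_of_utility n p s < power_mean_of_utility n p t"
proof -
  consider "p = 0" | "p < 0" | "0 < p" by linarith
  then show ?thesis
  proof cases
    case 1
    then show ?thesis using assms by (simp add: power_mean_of_utility_def divide_strict_right_mono)
  next
    case 2
    have "(- s / n) powr (1 / p) < (- t / n) powr (1 / p)"
      using assms 2 by (intro powr_less_mono2_neg) (auto simp: divide_strict_right_mono field_simps)
    then show ?thesis using 2 by (simp add: power_mean_of_utility_def)
  next
    case 3
    have "(s / n) powr (1 / p) < (t / n) powr (1 / p)"
      using assms 3 by (intro powr_less_mono2) (auto simp: divide_strict_right_mono field_simps)
    then show ?thesis using 3 by (simp add: power_mean_of_utility_def)
  qed
qed

lemma posdef_invertible:
  fixes A :: "real^'n^'n"
  assumes "posdef A"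
  shows "invertible A"
proof -
  have "\<forall>x. A *v x = 0 \<longrightarrow> x = 0"
    using assms unfolding posdef_def by (metis inner_zero_right less_irrefl)
  then show ?thesis by (simp add: invertible_left_inverse matrix_left_invertible_ker)
qed

lemma nnd_invertible_imp_posdef:
  fixes A :: "real^'n^'n"
  assumes A: "nnd A" and inv: "invertible A"
  shows "posdef A"
proof -
  have "x = 0" if "A *v x = 0" for x
    using inv that by (simp add: invertible_left_inverse matrix_left_invertible_ker)
  then have "v \<bullet> (A *v v) \<noteq> 0" if "v \<noteq> 0" for v
    using nnd_quadratic_zero_imp_kernel[OF A] that by blast
  then show ?thesis using A unfolding nnd_def posdef_def by (metis less_eq_real_def)
qed

lemma matrix_inv_eqI:
  fixes X Y :: "real^'n^'n"
  assumes "X ** Y = mat 1" "Y ** X = mat 1"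
  shows "matrix_inv X = Y"
proof -
  have "X ** matrix_inv X = mat 1 \<and> matrix_inv X ** X = mat 1"
    unfolding matrix_inv_def by (rule someI[of _ Y]) (use assms in simp)
  then have "matrix_inv X = (Y ** X) ** matrix_inv X" using assms by simp
  also have "\<dots> = Y ** (X ** matrix_inv X)" by (simp only: matrix_mul_assoc)
  finally show ?thesis using \<open>X ** matrix_inv X = mat 1 \<and> _\<close> by simp
qed

lemma matrix_inv_both_sides:
  fixes X :: "real^'n^'n"
  assumes "invertible X"
  shows "X ** matrix_inv X = mat 1" "matrix_inv X ** X = mat 1"
  using assms matrix_inv_eqI unfolding invertible_def by metis+

text \<open>For nonsingular \<open>A\<close> the only generalized inverse is \<open>A\<inverse>\<close>, and \<open>(K\<^sup>T A\<inverse> K)\<inverse> = K\<inverse> A K\<^sup>-\<^sup>T\<close>.\<close>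

lemma info_for_nonsingular:
  fixes K A :: "real^'n^'n"
  assumes K: "invertible K" and A: "invertible A"
  shows "info_for K A = matrix_inv K ** A ** transpose (matrix_inv K)"
proof -
  define G where "G = generalized_inverse A"
  define R where "R = matrix_inv K"
  note KR = matrix_inv_both_sides[OF K, folded R_def]
  note AI = matrix_inv_both_sides[OF A]
  have "A ** matrix_inv A ** A = A" by (simp add: AI)
  then have G: "A ** G ** A = A"
    unfolding G_def generalized_inverse_def by (rule someI)
  have "A ** G = A ** G ** (A ** matrix_inv A)" by (simp add: AI)
  also have "\<dots> = A ** matrix_inv A" by (simp add: matrix_mul_assoc G)
  finally have AG: "A ** G = mat 1" by (simp add: AI)
  then have GA: "G ** A = mat 1" by (simp add: matrix_left_right_inverse)
  have KRt: "transpose K ** transpose R = mat 1" "transpose R ** transpose K = mat 1"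
    by (simp_all add: matrix_transpose_mul[symmetric] KR transpose_mat)
  have "(transpose K ** G ** K) ** (R ** A ** transpose R)
      = transpose K ** (G ** ((K ** R) ** A)) ** transpose R" by (simp only: matrix_mul_assoc)
  then have 1: "(transpose K ** G ** K) ** (R ** A ** transpose R) = mat 1"
    by (simp add: KR GA KRt)
  have "(R ** A ** transpose R) ** (transpose K ** G ** K)
      = R ** (A ** ((transpose R ** transpose K) ** G)) ** K" by (simp only: matrix_mul_assoc)
  then have 2: "(R ** A ** transpose R) ** (transpose K ** G ** K) = mat 1"
    by (simp add: KR AG KRt)
  show ?thesis
    unfolding info_for_def G_def[symmetric] R_def[symmetric] by (rule matrix_inv_eqI[OF 1 2])
qed

text \<open>The columns of a nonsingular \<open>K\<close> span the whole space, so they lie in the range of \<open>A\<close> only if \<open>A\<close> is onto.\<close>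

lemma estimable_nonsingular_iff:
  fixes K A :: "real^'n^'n"
  assumes K: "invertible K"
  shows "estimable K A \<longleftrightarrow> invertible A"
proof
  assume "estimable K A"
  then have "\<forall>j. \<exists>v. A *v v = column j K" unfolding estimable_def by (metis imageE)
  then obtain V where V: "\<And>j. A *v V j = column j K" by metis
  define X where "X = (\<chi> i j. V j $ i)"
  have "(A ** X) $ i $ j = (A *v V j) $ i" for i j
    by (simp add: X_def matrix_matrix_mult_def matrix_vector_mult_def)
  then have AX: "A ** X = K" by (simp add: V column_def vec_eq_iff)
  have "A ** (X ** matrix_inv K) = mat 1"
    by (simp add: matrix_mul_assoc AX matrix_inv_both_sides[OF K])
  then show "invertible A" by (metis invertible_right_inverse)
next
  assume "invertible A"
  then have "A *v (matrix_inv A *v x) = x" for x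
    by (simp add: matrix_vector_mul_assoc matrix_inv_both_sides)
  then show "estimable K A" unfolding estimable_def by (metis rangeI)
qed

lemma congruence_quadratic:
  fixes R A :: "real^'n^'n"
  shows "v \<bullet> ((R ** A ** transpose R) *v v) = (transpose R *v v) \<bullet> (A *v (transpose R *v v))"
  by (simp add: matrix_vector_mul_assoc[symmetric] dot_lmul_matrix[symmetric] del: transpose_matrix_vector)
     (simp add: dot_lmul_matrix)

lemma congruence_symmetric:
  "transpose A = A \<Longrightarrow> transpose (R ** A ** transpose R) = R ** A ** transpose R"
  for R A :: "real^'n^'n"
  by (simp add: matrix_transpose_mul matrix_mul_assoc)

lemma congruence_nnd:
  "nnd A \<Longrightarrow> nnd (R ** A ** transpose R)" for R A :: "real^'n^'n"
  unfolding nnd_def congruence_quadratic using congruence_symmetric by blast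

lemma congruence_posdef:
  fixes R A :: "real^'n^'n"
  assumes R: "invertible R" and A: "posdef A"
  shows "posdef (R ** A ** transpose R)"
proof -
  have "transpose (matrix_inv R) ** transpose R = mat 1"
    by (simp add: matrix_transpose_mul[symmetric] matrix_inv_both_sides[OF R] transpose_mat)
  then have "transpose R *v v \<noteq> 0" if "v \<noteq> 0" for v
    using that by (metis matrix_vector_mul_assoc matrix_vector_mul_lid matrix_vector_mult_0_right)
  then show ?thesis
    using A congruence_symmetric unfolding posdef_def congruence_quadratic by blast
qed

lemma congruence_inj:
  fixes R A :: "real^'n^'n"
  assumes R: "invertible R" and eq: "R ** A ** transpose R = R ** B ** transpose R"
  shows "A = B"
proof -
  let ?S = "matrix_inv R"
  note RS = matrix_inv_both_sides[OF R]
  have t: "transpose R ** transpose ?S = mat 1"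
    by (simp add: matrix_transpose_mul[symmetric] RS transpose_mat)
  have "X = ?S ** (R ** X ** transpose R) ** transpose ?S" for X
  proof -
    have "?S ** (R ** X ** transpose R) ** transpose ?S = (?S ** R) ** X ** (transpose R ** transpose ?S)"
      by (simp only: matrix_mul_assoc)
    then show ?thesis by (simp add: RS t)
  qed
  then show ?thesis using eq by metis
qed

lemma congruence_linear: "linear (\<lambda>A. R ** A ** transpose R)" for R :: "real^'n^'n"
  by (rule linearI)
     (simp_all add: matrix_matrix_mult_def vec_eq_iff algebra_simps sum.distrib sum_distrib_left sum_distrib_right)

lemma Phi_p_spectral:
  fixes K A :: "real^'n^'n"
  assumes K: "invertible K" and A: "posdef A"
    and eig: "eigensystem (matrix_inv K ** A ** transpose (matrix_inv K)) e l"
  shows "Phi_p K p A = power_mean_of_utility (real CARD('n)) p (\<Sum>i\<in>UNIV. power_utility p (l i))"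
    and "p \<noteq> 0 \<Longrightarrow> 0 < sgn p * (\<Sum>i\<in>UNIV. power_utility p (l i))"
proof -
  let ?N = "matrix_inv K ** A ** transpose (matrix_inv K)"
  have Ai: "invertible A" by (rule posdef_invertible[OF A])
  have info: "info_for K A = ?N" by (rule info_for_nonsingular[OF K Ai])
  have est: "estimable K A" using estimable_nonsingular_iff[OF K] Ai by blast
  have "invertible (matrix_inv K)"
    using matrix_inv_both_sides[OF K] unfolding invertible_def by blast
  then have l: "0 < l i" for i
    by (intro eigenvalue_posdef[OF eig] congruence_posdef A)
  have S: "sgn p * (\<Sum>i\<in>UNIV. power_utility p (l i)) = (\<Sum>i\<in>UNIV. l i powr p)" if "p \<noteq> 0"
    using that by (simp add: power_utility_def sum_distrib_left sgn_mult_self_eq mult.assoc[symmetric])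
  have "0 < (\<Sum>i\<in>UNIV. l i powr p)"
    by (intro sum_pos) (use l in \<open>auto simp: less_imp_neq[THEN not_sym]\<close>)
  with S show "p \<noteq> 0 \<Longrightarrow> 0 < sgn p * (\<Sum>i\<in>UNIV. power_utility p (l i))" by simp
  show "Phi_p K p A = power_mean_of_utility (real CARD('n)) p (\<Sum>i\<in>UNIV. power_utility p (l i))"
  proof (cases "p = 0")
    case True
    have "0 < (\<Prod>i\<in>UNIV. l i)" by (intro prod_pos) (use l in auto)
    moreover have l0: "l i \<noteq> 0" for i using l[of i] by simp
    ultimately have "det ?N powr (1 / real CARD('n)) = exp (ln (\<Prod>i\<in>UNIV. l i) / real CARD('n))"
      by (simp add: det_eigensystem[OF eig] powr_def)
    also have "ln (\<Prod>i\<in>UNIV. l i) = (\<Sum>i\<in>UNIV. ln (l i))"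
      by (intro ln_prod) (use l0 in auto)
    finally show ?thesis
      using True est by (simp add: Phi_p_def info power_mean_of_utility_def power_utility_def)
  next
    case False
    then show ?thesis
      using est S by (simp add: Phi_p_def info power_mean_of_utility_def trace_matrix_powr[OF eig])
  qed
qed

lemma Phi_p_eq_0_if_singular:
  fixes K A :: "real^'n^'n"
  shows "invertible K \<Longrightarrow> \<not> invertible A \<Longrightarrow> Phi_p K p A = 0"
  by (simp add: Phi_p_def estimable_nonsingular_iff)

lemma eigensystem_congruence_exists:
  "posdef A \<Longrightarrow> \<exists>e l. eigensystem (R ** A ** transpose R) e l"
  for R A :: "real^'n^'n"
  by (intro eigensystem_exists congruence_symmetric) (simp add: posdef_def)

lemma Phi_p_posdef_pos:
  fixes K A :: "real^'n^'n"
  assumes "invertible K" "posdef A"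
  shows "0 < Phi_p K p A"
proof -
  obtain e l where eig: "eigensystem (matrix_inv K ** A ** transpose (matrix_inv K)) e l"
    using eigensystem_congruence_exists[OF assms(2)] by blast
  show ?thesis
    unfolding Phi_p_spectral(1)[OF assms eig] power_mean_of_utility_def
    using Phi_p_spectral(2)[OF assms eig, of p]
    by (auto simp: zero_less_divide_iff less_imp_neq[THEN not_sym])
qed

lemma loewner_ge_posdef:
  fixes A B :: "real^'n^'n"
  assumes "loewner_ge A B" "posdef B"
  shows "posdef A"
proof -
  have "A = B + (A - B)" by simp
  moreover have "transpose (B + (A - B)) = B + (A - B)"
    using assms unfolding loewner_ge_def nnd_def posdef_def
    by (simp add: vec_eq_iff Finite_Cartesian_Product.transpose_def)
  moreover have "0 < v \<bullet> ((B + (A - B)) *v v)" if "v \<noteq> 0" for v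
    using assms that unfolding loewner_ge_def nnd_def posdef_def matrix_vector_mult_add_rdistrib inner_add_right
    by (intro add_pos_nonneg) auto
  ultimately show ?thesis unfolding posdef_def by metis
qed

lemma posdef_midpoint:
  fixes A B :: "real^'n^'n"
  assumes "posdef A" "posdef B"
  shows "posdef ((1/2) *\<^sub>R A + (1/2) *\<^sub>R B)"
  using assms unfolding posdef_def
  by (simp add: matrix_vector_mult_add_rdistrib scaleR_matrix_vector_assoc[symmetric] inner_add_right
      Finite_Cartesian_Product.transpose_def add_pos_pos) (simp add: vec_eq_iff)

text \<open>The congruence \<open>A \<mapsto> K\<inverse> A K\<^sup>-\<^sup>T\<close> is injective and respects the Loewner order, so the claim reduces to
  the spectral sums.\<close>

lemma Phi_p_strictly_isotonic:
  fixes K :: "real^'n^'n"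
  assumes K: "invertible K" and p: "p < 1"
  shows "strictly_isotonic (Phi_p K p)"
  unfolding strictly_isotonic_def
proof (intro allI impI, elim conjE)
  fix A B :: "real^'n^'n"
  assume AB: "loewner_ge A B" and B: "posdef B" and ne: "A \<noteq> B"
  let ?R = "matrix_inv K"
  have R: "invertible ?R" using matrix_inv_both_sides[OF K] unfolding invertible_def by blast
  have A: "posdef A" by (rule loewner_ge_posdef[OF AB B])
  obtain e l where eA: "eigensystem (?R ** A ** transpose ?R) e l"
    using eigensystem_congruence_exists[OF A] by blast
  obtain b \<mu> where eB: "eigensystem (?R ** B ** transpose ?R) b \<mu>"
    using eigensystem_congruence_exists[OF B] by blast
  obtain d where d: "strict_tangent (power_utility p) d"
    using power_utility_strict_tangent[OF p] by blast
  have "?R ** A ** transpose ?R - ?R ** B ** transpose ?R = ?R ** (A - B) ** transpose ?R"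
    by (rule linear_diff[OF congruence_linear, symmetric])
  then have "loewner_ge (?R ** A ** transpose ?R) (?R ** B ** transpose ?R)"
    using AB congruence_nnd unfolding loewner_ge_def by metis
  moreover have "?R ** A ** transpose ?R \<noteq> ?R ** B ** transpose ?R"
    using congruence_inj[OF R] ne by blast
  ultimately have "(\<Sum>i\<in>UNIV. power_utility p (\<mu> i)) < (\<Sum>i\<in>UNIV. power_utility p (l i))"
    by (rule spectral_sum_strict_mono[OF _ _ congruence_posdef[OF R B] eA eB d power_utility_strict_mono])
  then show "Phi_p K p B < Phi_p K p A"
    unfolding Phi_p_spectral(1)[OF K A eA] Phi_p_spectral(1)[OF K B eB]
    by (intro power_mean_of_utility_strict_mono Phi_p_spectral(2)[OF K A eA] Phi_p_spectral(2)[OF K B eB]) auto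
qed

text \<open>The consequence of strict concavity that uniqueness rests on. Unlike \<open>strictly_concave\<close> it
  concerns only matrices of equal value, so it is shared by all increasing functions of a
  strictly concave function; in this form it is proved for \<open>\<Phi>\<^sub>p\<close> by way of a spectral sum.\<close>

definition midpoint_strict :: "(real^'n^'n \<Rightarrow> real) \<Rightarrow> bool" where
  "midpoint_strict \<Phi> \<longleftrightarrow> (\<forall>A B. posdef A \<and> nnd B \<and> \<Phi> A = \<Phi> B \<and> A \<noteq> B \<longrightarrow>
      \<Phi> A < \<Phi> ((1/2) *\<^sub>R A + (1/2) *\<^sub>R B))"

text \<open>A matrix with the same value as a positive definite one has a positive value and so is positive
  definite. The spectral sum of the midpoint then exceeds the mean of the two spectral sums, hence one of them.\<close>

lemma Phi_p_midpoint_strict: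
  fixes K :: "real^'n^'n"
  assumes K: "invertible K" and p: "p < 1"
  shows "midpoint_strict (Phi_p K p)"
  unfolding midpoint_strict_def
proof (intro allI impI, elim conjE)
  fix A B :: "real^'n^'n"
  assume A: "posdef A" and B0: "nnd B" and eq: "Phi_p K p A = Phi_p K p B" and ne: "A \<noteq> B"
  have "invertible B"
    using Phi_p_eq_0_if_singular[OF K, of B p] Phi_p_posdef_pos[OF K A, of p] eq by (metis less_irrefl)
  then have B: "posdef B" by (rule nnd_invertible_imp_posdef[OF B0])
  let ?C = "(1/2) *\<^sub>R A + (1/2) *\<^sub>R B"
  have C: "posdef ?C" by (rule posdef_midpoint[OF A B])
  let ?R = "matrix_inv K"
  have R: "invertible ?R" using matrix_inv_both_sides[OF K] unfolding invertible_def by blast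
  obtain a \<alpha> where eA: "eigensystem (?R ** A ** transpose ?R) a \<alpha>"
    using eigensystem_congruence_exists[OF A] by blast
  obtain b \<beta> where eB: "eigensystem (?R ** B ** transpose ?R) b \<beta>"
    using eigensystem_congruence_exists[OF B] by blast
  obtain e l where eC: "eigensystem (?R ** ?C ** transpose ?R) e l"
    using eigensystem_congruence_exists[OF C] by blast
  obtain d where d: "strict_tangent (power_utility p) d"
    using power_utility_strict_tangent[OF p] by blast
  have Ceq: "?R ** ?C ** transpose ?R
      = (1/2) *\<^sub>R (?R ** A ** transpose ?R) + (1/2) *\<^sub>R (?R ** B ** transpose ?R)"
    by (simp only: linear_add[OF congruence_linear] linear_scale[OF congruence_linear])
  have "?R ** A ** transpose ?R \<noteq> ?R ** B ** transpose ?R"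
    using congruence_inj[OF R] ne by blast
  then have "((\<Sum>i\<in>UNIV. power_utility p (\<alpha> i)) + (\<Sum>i\<in>UNIV. power_utility p (\<beta> i))) / 2
      < (\<Sum>i\<in>UNIV. power_utility p (l i))" (is "(?a + ?b) / 2 < ?l")
    by (rule spectral_sum_strict_concave[OF congruence_posdef[OF R A] congruence_posdef[OF R B] _
          eC[unfolded Ceq] eA eB d])
  \<comment> \<open>the two values agree, so exceeding either of them is enough\<close>
  then consider "?a < ?l" | "?b < ?l" by argo
  then show "Phi_p K p A < Phi_p K p ?C"
  proof cases
    case 1
    then show ?thesis
      unfolding Phi_p_spectral(1)[OF K A eA] Phi_p_spectral(1)[OF K C eC]
      by (intro power_mean_of_utility_strict_mono Phi_p_spectral(2)[OF K A eA] Phi_p_spectral(2)[OF K C eC]) auto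
  next
    case 2
    then have "Phi_p K p B < Phi_p K p ?C"
      unfolding Phi_p_spectral(1)[OF K B eB] Phi_p_spectral(1)[OF K C eC]
      by (intro power_mean_of_utility_strict_mono Phi_p_spectral(2)[OF K B eB] Phi_p_spectral(2)[OF K C eC]) auto
    then show ?thesis using eq by simp
  qed
qed

text \<open>Strict concavity excludes only nonproportional matrices. If \<open>B = t A\<close>, equal values contradict
  strict isotonicity; for \<open>t < 1\<close> the matrix \<open>t A\<close> may be zero, and the comparison goes through
  the positive definite matrix \<open>(1 + t)/2 A\<close>.\<close>

lemma midpoint_strict_if_strictly_concave:
  fixes \<Phi> :: "('d::{finite,linorder}) sqmat \<Rightarrow> real"
  assumes A: "assumption_A \<Phi>" and iso: "strictly_isotonic \<Phi>" and conc: "strictly_concave \<Phi>"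
  shows "midpoint_strict \<Phi>"
  unfolding midpoint_strict_def
proof (intro allI impI, elim conjE)
  fix A B :: "'d sqmat"
  assume pd: "posdef A" and nB: "nnd B" and eq: "\<Phi> A = \<Phi> B" and ne: "A \<noteq> B"
  have "\<not> (\<exists>t. B = t *\<^sub>R A)"
  proof
    assume "\<exists>t. B = t *\<^sub>R A"
    then obtain t where t: "B = t *\<^sub>R A" by blast
    have scale_nnd: "nnd (a *\<^sub>R A)" if "0 \<le> a" for a
      using that posdef_imp_nnd[OF pd]
      by (simp add: nnd_def scaleR_matrix_vector_assoc[symmetric] vec_eq_iff Finite_Cartesian_Product.transpose_def)
    have scale: "loewner_ge (a *\<^sub>R A) (b *\<^sub>R A)" if "b \<le> a" for a b
      using scale_nnd[of "a - b"] that unfolding loewner_ge_def by (simp add: scaleR_diff_left)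
    have scale_pd: "posdef (a *\<^sub>R A)" if "0 < a" for a
      using that pd
      by (simp add: posdef_def scaleR_matrix_vector_assoc[symmetric] vec_eq_iff Finite_Cartesian_Product.transpose_def)
    obtain v :: "'d rvec" where v: "v \<noteq> 0" by (metis zero_neq_one)
    have "0 < v \<bullet> (A *v v)" "0 \<le> t * (v \<bullet> (A *v v))"
      using pd nB v unfolding posdef_def nnd_def t by (auto simp: scaleR_matrix_vector_assoc[symmetric])
    then have t0: "0 \<le> t" by (simp add: zero_le_mult_iff)
    have t1: "t \<noteq> 1" using ne t by auto
    have A0: "A \<noteq> 0" using pd v by (auto simp: posdef_def)
    show False
    proof (cases "t < 1")
      case True
      let ?r = "(1 + t) / 2"
      have r: "0 < ?r" "?r < 1" "t \<le> ?r" using True t0 by auto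
      have "loewner_ge A (?r *\<^sub>R A)" using scale[of ?r 1] r by simp
      moreover have "A \<noteq> ?r *\<^sub>R A" using A0 r by (metis less_irrefl scaleR_cancel_right scaleR_one)
      ultimately have "\<Phi> (?r *\<^sub>R A) < \<Phi> A"
        using iso scale_pd[OF r(1)] unfolding strictly_isotonic_def by blast
      moreover have "\<Phi> B \<le> \<Phi> (?r *\<^sub>R A)"
        using A scale[OF r(3)] posdef_imp_nnd[OF scale_pd[OF r(1)]] nB
        unfolding assumption_A_def t by blast
      ultimately show False using eq by simp
    next
      case False
      then have "loewner_ge B A" using scale[of 1 t] t by simp
      then have "\<Phi> A < \<Phi> B"
        using iso pd ne unfolding strictly_isotonic_def by metis
      then show False using eq by simp
    qed
  qed
  moreover have "0 < (1/2 :: real)" "(1/2 :: real) < 1" by simp_all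
  ultimately have "(1/2) * \<Phi> A + (1 - 1/2) * \<Phi> B < \<Phi> ((1/2) *\<^sub>R A + (1 - 1/2) *\<^sub>R B)"
    using conc pd nB unfolding strictly_concave_def by blast
  then show "\<Phi> A < \<Phi> ((1/2) *\<^sub>R A + (1/2) *\<^sub>R B)" using eq by simp
qed

section \<open>Designs and their information matrices\<close>

lemma design_info_superset:
  assumes "finite S" "support \<xi> \<subseteq> S"
  shows "design_info M \<xi> = (\<Sum>x\<in>S. \<xi> x *\<^sub>R M x)"
  unfolding design_info_def
  by (rule sum.mono_neutral_left) (use assms in \<open>auto simp: support_def\<close>)

lemma design_weight_superset:
  assumes "is_design L U \<xi>" "finite S" "support \<xi> \<subseteq> S"
  shows "(\<Sum>x\<in>S. \<xi> x) = 1"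
proof -
  have "(\<Sum>x\<in>S. \<xi> x) = (\<Sum>x\<in>support \<xi>. \<xi> x)"
    by (rule sum.mono_neutral_right) (use assms in \<open>auto simp: support_def\<close>)
  then show ?thesis using assms(1) by (simp add: is_design_def)
qed

lemma is_designI:
  assumes "finite S" "S \<subseteq> design_space L U" "\<And>x. x \<notin> S \<Longrightarrow> \<xi> x = 0" "\<And>x. x \<in> S \<Longrightarrow> 0 \<le> \<xi> x"
    and "(\<Sum>x\<in>S. \<xi> x) = 1"
  shows "is_design L U \<xi>"
proof -
  have sub: "support \<xi> \<subseteq> S" using assms(3) by (auto simp: support_def)
  have "(\<Sum>x\<in>support \<xi>. \<xi> x) = (\<Sum>x\<in>S. \<xi> x)"
    by (rule sum.mono_neutral_left) (use assms sub in \<open>auto simp: support_def\<close>)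
  moreover have "0 \<le> \<xi> x" for x using assms(3)[of x] assms(4)[of x] by (cases "x \<in> S") auto
  ultimately show ?thesis
    using assms sub unfolding is_design_def by (auto intro: finite_subset)
qed

lemma design_mixture:
  assumes \<xi>: "is_design L U \<xi>" and \<zeta>: "is_design L U \<zeta>" and t: "0 \<le> t" "t \<le> 1"
  shows "is_design L U (\<lambda>x. t * \<xi> x + (1 - t) * \<zeta> x)"
    and "design_info M (\<lambda>x. t * \<xi> x + (1 - t) * \<zeta> x) = t *\<^sub>R design_info M \<xi> + (1 - t) *\<^sub>R design_info M \<zeta>"
proof -
  let ?S = "support \<xi> \<union> support \<zeta>" and ?m = "\<lambda>x. t * \<xi> x + (1 - t) * \<zeta> x"
  have fin: "finite ?S" using \<xi> \<zeta> by (simp add: is_design_def)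
  have sub: "support ?m \<subseteq> ?S" by (auto simp: support_def)
  show "is_design L U ?m"
  proof (rule is_designI[OF fin])
    show "?S \<subseteq> design_space L U" using \<xi> \<zeta> by (simp add: is_design_def)
    show "?m x = 0" if "x \<notin> ?S" for x using that by (auto simp: support_def)
    show "0 \<le> ?m x" for x using \<xi> \<zeta> t by (simp add: is_design_def)
    show "(\<Sum>x\<in>?S. ?m x) = 1"
      using design_weight_superset[OF \<xi> fin] design_weight_superset[OF \<zeta> fin]
      by (simp add: sum.distrib sum_distrib_left[symmetric])
  qed
  show "design_info M ?m = t *\<^sub>R design_info M \<xi> + (1 - t) *\<^sub>R design_info M \<zeta>"
    using design_info_superset[OF fin sub, of M] design_info_superset[OF fin, of \<xi> M]
      design_info_superset[OF fin, of \<zeta> M]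
    by (simp add: sum.distrib scaleR_sum_right scaleR_add_left)
qed

lemma optimal_info_unique:
  assumes \<Phi>: "midpoint_strict \<Phi>" and nnd: "\<And>\<zeta>. is_design L U \<zeta> \<Longrightarrow> nnd (design_info M \<zeta>)"
    and \<xi>: "is_optimal L U M \<Phi> \<xi>" and \<zeta>: "is_optimal L U M \<Phi> \<zeta>" and pd: "posdef (design_info M \<xi>)"
  shows "design_info M \<zeta> = design_info M \<xi>"
proof (rule ccontr)
  assume ne: "design_info M \<zeta> \<noteq> design_info M \<xi>"
  have d: "is_design L U \<xi>" "is_design L U \<zeta>" using \<xi> \<zeta> by (auto simp: is_optimal_def)
  have eq: "\<Phi> (design_info M \<xi>) = \<Phi> (design_info M \<zeta>)"
    using \<xi> \<zeta> unfolding is_optimal_def by (meson antisym)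
  have "\<Phi> (design_info M \<xi>) < \<Phi> ((1/2) *\<^sub>R design_info M \<xi> + (1/2) *\<^sub>R design_info M \<zeta>)"
    using \<Phi> pd nnd[OF d(2)] eq ne unfolding midpoint_strict_def by metis
  also have "(1/2) *\<^sub>R design_info M \<xi> + (1/2) *\<^sub>R design_info M \<zeta>
      = design_info M (\<lambda>x. 1/2 * \<xi> x + (1 - 1/2) * \<zeta> x)"
    using design_mixture(2)[OF d, of "1/2" M] by simp
  finally show False
    using \<xi> design_mixture(1)[OF d, of "1/2"] unfolding is_optimal_def by (simp add: not_less[symmetric])
qed

text \<open>The quadratic form of the principal submatrix with index set \<open>J\<close>; for the last \<open>d\<^sub>1\<close> indices and
  \<open>A = C(c)\<close> this is \<open>v\<^sup>T C\<^sub>2\<^sub>2(c) v\<close>.\<close>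

definition block_form :: "'d set \<Rightarrow> real^'d^'d \<Rightarrow> real^'d \<Rightarrow> real" where
  "block_form J A v = (\<Sum>i\<in>J. \<Sum>j\<in>J. v $ i * v $ j * A $ i $ j)"

lemma quadratic_form_eq_sum:
  "v \<bullet> (A *v v) = (\<Sum>i\<in>UNIV. \<Sum>j\<in>UNIV. v $ i * v $ j * A $ i $ j)" for A :: "real^'n^'n"
  by (simp add: inner_vec_def matrix_vector_mult_def sum_distrib_left mult_ac)

lemma block_form_eq_quadratic:
  assumes "\<And>i j. i \<notin> J \<or> j \<notin> J \<Longrightarrow> A $ i $ j = 0"
  shows "block_form J A v = v \<bullet> (A *v v)"
proof -
  have "(\<Sum>i\<in>UNIV. \<Sum>j\<in>UNIV. v $ i * v $ j * A $ i $ j) = (\<Sum>i\<in>J. \<Sum>j\<in>UNIV. v $ i * v $ j * A $ i $ j)"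
    by (rule sum.mono_neutral_right) (use assms in auto)
  also have "\<dots> = block_form J A v"
    unfolding block_form_def
    by (intro sum.cong refl sum.mono_neutral_right) (use assms in auto)
  finally show ?thesis unfolding quadratic_form_eq_sum by simp
qed

lemma block_form_linear: "linear (\<lambda>A. block_form J A v)"
  by (rule linearI) (simp_all add: block_form_def sum.distrib sum_distrib_left algebra_simps)

lemma block_form_sum:
  "block_form J (\<Sum>x\<in>S. a x *\<^sub>R A x) v = (\<Sum>x\<in>S. a x * block_form J (A x) v)"
  by (simp add: linear_sum[OF block_form_linear] linear_scale[OF block_form_linear])

lemma fisher_info_quadratic: "y \<bullet> (fisher_info w f x *v y) = w x * (f x \<bullet> y)\<^sup>2"
  unfolding fisher_info_def power2_eq_square
  by (simp add: inner_vec_def matrix_vector_mult_def sum_distrib_left sum_distrib_right mult_ac)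

lemma fisher_info_nnd: "0 \<le> w x \<Longrightarrow> nnd (fisher_info w f x)"
  unfolding nnd_def fisher_info_quadratic
  by (simp add: fisher_info_def vec_eq_iff Finite_Cartesian_Product.transpose_def mult.commute)

lemma design_info_quadratic:
  "y \<bullet> (design_info M \<xi> *v y) = (\<Sum>x\<in>support \<xi>. \<xi> x * (y \<bullet> (M x *v y)))"
  unfolding design_info_def quadratic_form_eq_sum block_form_def[of UNIV, symmetric]
  by (rule block_form_sum)

lemma design_info_nnd:
  assumes M: "\<And>x. x \<in> design_space L U \<Longrightarrow> nnd (M x)" and \<xi>: "is_design L U \<xi>"
  shows "nnd (design_info M \<xi>)"
proof -
  have sub: "support \<xi> \<subseteq> design_space L U" and w: "\<And>x. 0 \<le> \<xi> x" using \<xi> by (auto simp: is_design_def)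
  have "M x $ j $ i = M x $ i $ j" if "x \<in> support \<xi>" for x i j
  proof -
    have "transpose (M x) = M x" using M sub that by (auto simp: nnd_def)
    then show ?thesis by (metis Finite_Cartesian_Product.transpose_def vec_lambda_beta)
  qed
  then have "transpose (design_info M \<xi>) = design_info M \<xi>"
    by (simp add: design_info_def vec_eq_iff Finite_Cartesian_Product.transpose_def)
  moreover have "0 \<le> v \<bullet> (design_info M \<xi> *v v)" for v
    unfolding design_info_quadratic
    by (intro sum_nonneg mult_nonneg_nonneg w) (use M sub in \<open>auto simp: nnd_def\<close>)
  ultimately show ?thesis unfolding nnd_def by blast
qed

text \<open>The weight of an uninformative point \<open>x\<close> is distributed according to \<open>\<nu>\<close>.\<close>

lemma reallocating_uninformative_weight:
  assumes \<xi>: "is_design L U \<xi>" and \<nu>: "is_design L U \<nu>" and x: "M x = 0"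
  obtains \<zeta> where "is_design L U \<zeta>" "design_info M \<zeta> = design_info M \<xi> + \<xi> x *\<^sub>R design_info M \<nu>"
proof (cases "x \<in> support \<xi>")
  case True
  define S where "S = support \<xi> \<union> support \<nu>"
  have S: "finite S" "S \<subseteq> design_space L U" "x \<in> S" using \<xi> \<nu> True by (auto simp: S_def is_design_def)
  define \<zeta> where "\<zeta> = (\<lambda>t. (if t = x then 0 else \<xi> t) + \<xi> x * \<nu> t)"
  have out: "\<zeta> t = 0" if "t \<notin> S" for t
    using that by (auto simp: \<zeta>_def S_def support_def)
  have sub: "support \<zeta> \<subseteq> S" using out by (auto simp: support_def)
  have "is_design L U \<zeta>"
  proof (rule is_designI[OF S(1,2) out])
    show "0 \<le> \<zeta> t" for t using \<xi> \<nu> by (simp add: \<zeta>_def is_design_def)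
    have "(\<Sum>t\<in>S. \<xi> t) = 1" "(\<Sum>t\<in>S. \<nu> t) = 1"
      using design_weight_superset[OF \<xi> S(1)] design_weight_superset[OF \<nu> S(1)] by (auto simp: S_def)
    moreover have "(\<Sum>t\<in>S. \<xi> t) = \<xi> x + (\<Sum>t\<in>S. if t = x then 0 else \<xi> t)"
      using S by (simp add: sum.remove[of S x])
    ultimately show "(\<Sum>t\<in>S. \<zeta> t) = 1"
      by (simp add: \<zeta>_def sum.distrib sum_distrib_left[symmetric])
  qed
  moreover have "design_info M \<zeta> = design_info M \<xi> + \<xi> x *\<^sub>R design_info M \<nu>"
  proof -
    have "(\<Sum>t\<in>S. \<zeta> t *\<^sub>R M t) = (\<Sum>t\<in>S. \<xi> t *\<^sub>R M t + \<xi> x *\<^sub>R (\<nu> t *\<^sub>R M t))"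
      by (rule sum.cong) (auto simp: \<zeta>_def x scaleR_add_left)
    then show ?thesis
      using design_info_superset[OF S(1) sub, of M] design_info_superset[OF S(1), of \<xi> M]
        design_info_superset[OF S(1), of \<nu> M]
      by (simp add: S_def sum.distrib scaleR_sum_right)
  qed
  ultimately show ?thesis by (rule that)
next
  case False
  then show ?thesis using that[of \<xi>] \<xi> by (simp add: support_def)
qed

lemma nnd_add_scaled_posdef:
  fixes A B :: "real^'n^'n"
  assumes A: "nnd A" and B: "posdef B" and r: "0 < r"
  shows "posdef (A + r *\<^sub>R B)" "loewner_ge (A + r *\<^sub>R B) A"
proof -
  have rB: "posdef (r *\<^sub>R B)"
    using B r by (simp add: posdef_def scaleR_matrix_vector_assoc[symmetric] vec_eq_iff Finite_Cartesian_Product.transpose_def)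
  then show "loewner_ge (A + r *\<^sub>R B) A" using posdef_imp_nnd by (auto simp: loewner_ge_def)
  have "loewner_ge (A + r *\<^sub>R B) (r *\<^sub>R B)" using A by (simp add: loewner_ge_def)
  then show "posdef (A + r *\<^sub>R B)" by (rule loewner_ge_posdef[OF _ rB])
qed

section \<open>Signed measures, double zeros and optimal designs\<close>

text \<open>What the complete class hypothesis is used for, with \<open>X\<close> the design space: the entries of \<open>C\<close> outside
  the block \<open>J \<times> J\<close> are combinations of \<open>u 0 = 1\<close> and the \<open>u l = \<Psi>\<^sub>l\<close> with \<open>l < k\<close>, and for each \<open>v\<close> that is not
  zero on \<open>J\<close> these functions followed by \<open>v\<^sup>T C\<^sub>2\<^sub>2 v\<close> start a derivative chain \<open>\<phi> v\<close>.\<close>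

locale complete_class_model =
  fixes X :: "real set" and M :: "real \<Rightarrow> real^'d^'d" and P :: "real^'d^'d"
    and c :: "real \<Rightarrow> real" and C :: "real \<Rightarrow> real^'d^'d" and J :: "'d set"
    and k :: nat and u :: "nat \<Rightarrow> real \<Rightarrow> real"
    and \<phi> :: "real^'d \<Rightarrow> nat \<Rightarrow> nat \<Rightarrow> real \<Rightarrow> real"
  assumes inf_X: "infinite X" and inj_c: "inj_on c X" and inv_P: "invertible P"
    and M_eq: "\<And>x. x \<in> X \<Longrightarrow> M x = P ** C (c x) ** transpose P"
    and sym_C: "\<And>s. s \<in> c ` X \<Longrightarrow> transpose (C s) = C s"
    and k_pos: "1 \<le> k" and J_ne: "J \<noteq> {}"
    and u_0: "\<And>s. s \<in> c ` X \<Longrightarrow> u 0 s = 1"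
    and u_entry: "\<And>l. 1 \<le> l \<Longrightarrow> l < k \<Longrightarrow> \<exists>i j. \<forall>s\<in>c ` X. u l s = C s $ i $ j"
    and C_span: "\<And>i j. j \<notin> J \<Longrightarrow> \<exists>a. \<forall>s\<in>c ` X. C s $ i $ j = (\<Sum>l<k. a l * u l s)"
    and chain: "\<And>v. \<exists>i\<in>J. v $ i \<noteq> 0 \<Longrightarrow> derivative_chain (c ` X) (\<phi> v) k"
    and chain_base: "\<And>v l s. l < k \<Longrightarrow> s \<in> c ` X \<Longrightarrow> \<phi> v l 0 s = u l s"
    and chain_top: "\<And>v s. s \<in> c ` X \<Longrightarrow> \<phi> v k 0 s = block_form J (C s) v"
begin

text \<open>Suppose all \<open>k + 1\<close> functions are annihilated, and pad \<open>S\<close> to \<open>k + 1\<close> points by points of mass zero.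
  Some nontrivial combination of the functions vanishes at all points except one point \<open>p\<close> of
  nonzero mass. Integrating it shows that it vanishes at \<open>p\<close> too, so it has more than \<open>k\<close> zeros.\<close>

lemma annihilator_top_nonzero:
  assumes S: "finite S" "S \<subseteq> X" "card S \<le> Suc k" and ne: "\<exists>x\<in>S. \<sigma> x \<noteq> 0"
    and ann: "\<And>l. l < k \<Longrightarrow> (\<Sum>x\<in>S. \<sigma> x * u l (c x)) = 0" and v: "\<exists>i\<in>J. v $ i \<noteq> 0"
  shows "(\<Sum>x\<in>S. \<sigma> x * block_form J (C (c x)) v) \<noteq> 0"
proof
  assume top: "(\<Sum>x\<in>S. \<sigma> x * block_form J (C (c x)) v) = 0"
  obtain T where T: "finite T" "card T = Suc k - card S" "T \<subseteq> X - S"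
    using infinite_arbitrarily_large[of "X - S" "Suc k - card S"] inf_X S(1) by auto
  define Y where "Y = S \<union> T"
  have "card Y = card S + card T"
    unfolding Y_def by (rule card_Un_disjoint) (use S T in auto)
  then have Y: "finite Y" "Y \<subseteq> X" "card Y = Suc k" "S \<subseteq> Y"
    using T S by (auto simp: Y_def)
  define \<tau> where "\<tau> = (\<lambda>x. if x \<in> S then \<sigma> x else 0)"
  have sum_\<tau>: "(\<Sum>x\<in>Y. \<tau> x * h x) = (\<Sum>x\<in>S. \<sigma> x * h x)" for h
    by (rule sum.mono_neutral_cong_right) (use Y in \<open>auto simp: \<tau>_def\<close>)
  have zero: "(\<Sum>x\<in>Y. \<tau> x * \<phi> v l 0 (c x)) = 0" if "l \<le> k" for l
  proof (cases "l = k")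
    case True
    have "(\<Sum>x\<in>S. \<sigma> x * \<phi> v k 0 (c x)) = (\<Sum>x\<in>S. \<sigma> x * block_form J (C (c x)) v)"
      using S(2) by (intro sum.cong) (auto simp: chain_top)
    then show ?thesis using top True sum_\<tau>[of "\<lambda>x. \<phi> v k 0 (c x)"] by simp
  next
    case False
    then have "(\<Sum>x\<in>S. \<sigma> x * \<phi> v l 0 (c x)) = (\<Sum>x\<in>S. \<sigma> x * u l (c x))"
      using S(2) that by (intro sum.cong) (auto simp: chain_base)
    then show ?thesis using ann[of l] that False sum_\<tau>[of "\<lambda>x. \<phi> v l 0 (c x)"] by simp
  qed
  obtain p where p: "p \<in> S" "\<sigma> p \<noteq> 0" using ne by blast
  have pY: "p \<in> Y" "\<tau> p \<noteq> 0" using p Y by (auto simp: \<tau>_def)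
  obtain a where a: "\<exists>l\<in>{0..k}. a l \<noteq> 0"
      "\<forall>x\<in>Y - {p}. (\<Sum>l\<in>{0..k}. a l * \<phi> v l 0 (c x)) = 0"
    using underdetermined_system_nontrivial[of "Y - {p}" "{0..k}" "\<lambda>x l. \<phi> v l 0 (c x)"] Y pY by auto
  have "(\<Sum>x\<in>Y. \<tau> x * (\<Sum>l\<in>{0..k}. a l * \<phi> v l 0 (c x)))
      = (\<Sum>l\<in>{0..k}. a l * (\<Sum>x\<in>Y. \<tau> x * \<phi> v l 0 (c x)))"
    unfolding sum_distrib_left by (subst sum.swap) (simp add: mult_ac)
  also have "\<dots> = 0" using zero by simp
  finally have "\<tau> p * (\<Sum>l\<in>{0..k}. a l * \<phi> v l 0 (c p)) = 0"
    using a(2) pY Y(1) by (simp add: sum.remove[of Y p])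
  then have z: "(\<Sum>l=0..k. a l * \<phi> v l 0 s) = 0" if "s \<in> c ` Y" for s
    using that a(2) pY by (cases "s = c p") auto
  have "card (c ` Y) = Suc k" using Y inj_c by (metis card_image inj_on_subset)
  moreover have "Y \<noteq> {}" using pY by blast
  ultimately have "\<forall>l\<in>{0..k}. a l = 0"
    using Y by (intro zero_set_imp_coeffs_zero[OF chain[OF v], of "c ` Y" 0 a] z) auto
  then show False using a(1) by blast
qed

text \<open>A signed measure on \<open>k + 1\<close> points annihilating the first \<open>k\<close> functions exists by counting
  dimensions. The form \<open>q\<close> that it assigns to the block \<open>J \<times> J\<close> has no zeros among vectors that are
  nonzero on \<open>J\<close>, so \<open>q\<close> has one sign; the measure or its negative is as required.\<close>

lemma annihilator_definite:
  assumes S: "finite S" "S \<subseteq> X" "card S = Suc k"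
  obtains \<sigma> where "\<And>x. x \<notin> S \<Longrightarrow> \<sigma> x = 0" "(\<Sum>x\<in>S. \<sigma> x) = 0"
    "nnd (\<Sum>x\<in>S. \<sigma> x *\<^sub>R M x)" "(\<Sum>x\<in>S. \<sigma> x *\<^sub>R M x) \<noteq> 0"
proof -
  obtain a where a: "\<exists>x\<in>S. a x \<noteq> 0" "\<forall>l\<in>{..<k}. (\<Sum>x\<in>S. a x * u l (c x)) = 0"
    using underdetermined_system_nontrivial[of "{..<k}" S "\<lambda>l x. u l (c x)"] S by auto
  define D where "D = (\<Sum>x\<in>S. a x *\<^sub>R C (c x))"
  have D_entry: "D $ i $ j = (\<Sum>x\<in>S. a x * C (c x) $ i $ j)" for i j
    by (simp add: D_def)
  have symD: "transpose D = D"
    unfolding vec_eq_iff Finite_Cartesian_Product.transpose_def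
  proof (simp add: D_entry, intro allI sum.cong refl)
    fix i j x assume "x \<in> S"
    then have "transpose (C (c x)) = C (c x)" using S(2) sym_C by blast
    then have "C (c x) $ j $ i = C (c x) $ i $ j"
      by (metis Finite_Cartesian_Product.transpose_def vec_lambda_beta)
    then show "a x * C (c x) $ j $ i = a x * C (c x) $ i $ j" by simp
  qed
  have col0: "D $ i $ j = 0" if jJ: "j \<notin> J" for i j
  proof -
    obtain b where b: "\<forall>s\<in>c ` X. C s $ i $ j = (\<Sum>l<k. b l * u l s)" using C_span[OF jJ] by blast
    have "D $ i $ j = (\<Sum>x\<in>S. a x * (\<Sum>l<k. b l * u l (c x)))"
      unfolding D_entry using b S(2) by (intro sum.cong) auto
    also have "\<dots> = (\<Sum>l<k. b l * (\<Sum>x\<in>S. a x * u l (c x)))"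
      unfolding sum_distrib_left by (subst sum.swap) (simp add: mult_ac)
    also have "\<dots> = 0" using a(2) by simp
    finally show ?thesis .
  qed
  then have off: "D $ i $ j = 0" if "i \<notin> J \<or> j \<notin> J" for i j
  proof (cases "j \<in> J")
    case True
    have "D $ i $ j = transpose D $ j $ i" by (simp add: Finite_Cartesian_Product.transpose_def)
    then show ?thesis using symD col0 that True by simp
  qed (rule col0)
  define q where "q = (\<lambda>v. v \<bullet> (D *v v))"
  have q_block: "q v = block_form J D v" for v
    unfolding q_def by (rule block_form_eq_quadratic[symmetric]) (rule off)
  have q_sum: "q v = (\<Sum>x\<in>S. a x * block_form J (C (c x)) v)" for v
    unfolding q_block D_def by (rule block_form_sum)
  have q_nz: "q v \<noteq> 0" if "\<exists>i\<in>J. v $ i \<noteq> 0" for v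
    unfolding q_sum by (rule annihilator_top_nonzero) (use S a that in auto)
  have same_sign: False if vw: "q v < 0" "0 < q w" for v w
  proof -
    have cont: "continuous_on {0..1} (\<lambda>t. q ((1 - t) *\<^sub>R v + t *\<^sub>R w))"
      unfolding q_def
      by (intro continuous_intros linear_continuous_on_compose[of _ _ "\<lambda>x. D *v x"] matrix_vector_mul_linear)
    \<comment> \<open>on the segment from \<open>v\<close> to \<open>w\<close> the form vanishes at a vector that is zero on \<open>J\<close>; then \<open>w\<close> is a
      multiple of \<open>v\<close> on \<open>J\<close>, and the two values have the same sign\<close>
    obtain t where t: "0 \<le> t" "t \<le> 1" "q ((1 - t) *\<^sub>R v + t *\<^sub>R w) = 0"
      using IVT'[of "\<lambda>t. q ((1 - t) *\<^sub>R v + t *\<^sub>R w)" 0 0 1] cont vw by auto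
    have t0: "t \<noteq> 0" using t vw by auto
    have z: "(1 - t) * v $ i + t * w $ i = 0" if "i \<in> J" for i
      using q_nz[of "(1 - t) *\<^sub>R v + t *\<^sub>R w"] t(3) that by auto
    define r where "r = - (1 - t) / t"
    have w: "w $ i = r * v $ i" if "i \<in> J" for i
      using z[OF that] t0 unfolding r_def by (simp add: field_simps)
    have "q w = r\<^sup>2 * q v"
      unfolding q_block block_form_def sum_distrib_left
      by (intro sum.cong refl) (simp add: w power2_eq_square)
    then show False using vw by (simp add: zero_less_mult_iff)
  qed
  define e :: real where "e = (if \<exists>v. q v < 0 then -1 else 1)"
  have eq: "0 \<le> e * q v" for v
    unfolding e_def using same_sign[of _ v] by (auto simp: not_less) (meson not_less)
  have info: "(\<Sum>x\<in>S. (e * a x) *\<^sub>R M x) = P ** (e *\<^sub>R D) ** transpose P"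
  proof -
    have "(\<Sum>x\<in>S. (e * a x) *\<^sub>R M x) = (\<Sum>x\<in>S. (e * a x) *\<^sub>R (P ** C (c x) ** transpose P))"
      using S(2) M_eq by (intro sum.cong) auto
    then show ?thesis
      unfolding D_def scaleR_sum_right scaleR_scaleR
      by (simp add: linear_sum[OF congruence_linear] linear_scale[OF congruence_linear])
  qed
  have nndD: "nnd (e *\<^sub>R D)"
    unfolding nnd_def
  proof
    show "transpose (e *\<^sub>R D) = e *\<^sub>R D"
      using symD by (simp add: vec_eq_iff Finite_Cartesian_Product.transpose_def)
    show "\<forall>v. 0 \<le> v \<bullet> (e *\<^sub>R D *v v)"
      using eq by (simp add: q_def scaleR_matrix_vector_assoc[symmetric])
  qed
  have "e *\<^sub>R D \<noteq> 0"
  proof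
    assume z: "e *\<^sub>R D = 0"
    then have "D = 0" by (auto simp: e_def split: if_splits)
    then have "q v = 0" for v by (simp add: q_def)
    moreover obtain j where "j \<in> J" using J_ne by blast
    then have "\<exists>i\<in>J. axis j (1::real) $ i \<noteq> 0" by (intro bexI[of _ j]) (simp_all add: axis_def)
    ultimately show False using q_nz[of "axis j 1"] by blast
  qed
  then have ne: "P ** (e *\<^sub>R D) ** transpose P \<noteq> 0"
    using congruence_inj[OF inv_P, of "e *\<^sub>R D" 0] by (auto simp: linear_0[OF congruence_linear])
  show ?thesis
  proof (rule that[of "\<lambda>x. if x \<in> S then e * a x else 0"])
    have "(\<Sum>x\<in>S. a x * u 0 (c x)) = (\<Sum>x\<in>S. a x)"
      using S(2) u_0 by (intro sum.cong) auto
    then have "(\<Sum>x\<in>S. a x) = 0" using a(2) k_pos by auto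
    then show "(\<Sum>x\<in>S. if x \<in> S then e * a x else 0) = 0"
      by (simp add: sum_distrib_left[symmetric])
    show "nnd (\<Sum>x\<in>S. (if x \<in> S then e * a x else 0) *\<^sub>R M x)"
      using congruence_nnd[OF nndD, of P] by (simp add: info[symmetric] cong: sum.cong)
    show "(\<Sum>x\<in>S. (if x \<in> S then e * a x else 0) *\<^sub>R M x) \<noteq> 0"
      using ne by (simp add: info[symmetric] cong: sum.cong)
  qed simp
qed

text \<open>On \<open>k + 1\<close> support points the measure from \<open>annihilator_definite\<close> could be added with a small positive
  factor without destroying nonnegativity of the weights, and would enlarge the information matrix.\<close>

lemma optimal_design_support_small:
  assumes X: "X = design_space L U" and \<Phi>: "strictly_isotonic \<Phi>"
    and \<zeta>: "is_optimal L U M \<Phi> \<zeta>" and pd: "posdef (design_info M \<zeta>)"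
  shows "card (support \<zeta>) \<le> k"
proof (rule ccontr)
  assume "\<not> card (support \<zeta>) \<le> k"
  then obtain S where S: "S \<subseteq> support \<zeta>" "card S = Suc k"
    by (metis not_less_eq_eq obtain_subset_with_card_n)
  have d: "is_design L U \<zeta>" using \<zeta> by (simp add: is_optimal_def)
  have fin: "finite (support \<zeta>)" "support \<zeta> \<subseteq> X" and nonneg: "\<And>x. 0 \<le> \<zeta> x"
    using d X by (auto simp: is_design_def)
  have finS: "finite S" using S fin finite_subset by blast
  obtain \<sigma> where \<sigma>: "\<And>x. x \<notin> S \<Longrightarrow> \<sigma> x = 0" "(\<Sum>x\<in>S. \<sigma> x) = 0"
      "nnd (\<Sum>x\<in>S. \<sigma> x *\<^sub>R M x)" "(\<Sum>x\<in>S. \<sigma> x *\<^sub>R M x) \<noteq> 0"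
    using annihilator_definite[OF finS subset_trans[OF S(1) fin(2)] S(2)] by blast
  define \<delta> where "\<delta> = Min (\<zeta> ` S)"
  define m where "m = (\<Sum>x\<in>S. \<bar>\<sigma> x\<bar>) + 1"
  have m: "0 < m" unfolding m_def by (simp add: add_nonneg_pos sum_nonneg)
  have "S \<noteq> {}" using S(2) by auto
  moreover have "0 < \<zeta> x" if "x \<in> S" for x
    using S(1) nonneg[of x] that by (auto simp: support_def less_le)
  ultimately have \<delta>: "0 < \<delta>"
    unfolding \<delta>_def using finS by (subst Min_gr_iff) auto
  \<comment> \<open>small enough for \<open>\<epsilon> |\<sigma> x|\<close> to stay below the least weight on \<open>S\<close>\<close>
  define \<epsilon> where "\<epsilon> = \<delta> / m"
  have \<epsilon>: "0 < \<epsilon>" unfolding \<epsilon>_def using \<delta> m by simp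
  define \<xi> where "\<xi> = (\<lambda>x. \<zeta> x + \<epsilon> * \<sigma> x)"
  have pos: "0 \<le> \<xi> x" for x
  proof (cases "x \<in> S")
    case True
    have "\<bar>\<sigma> x\<bar> \<le> (\<Sum>x\<in>S. \<bar>\<sigma> x\<bar>)"
      using finS True by (intro member_le_sum) auto
    then have "\<bar>\<sigma> x\<bar> \<le> m" unfolding m_def by simp
    then have "\<epsilon> * \<bar>\<sigma> x\<bar> \<le> \<epsilon> * m" using \<epsilon> by simp
    also have "\<dots> = \<delta>" unfolding \<epsilon>_def using m by simp
    also have "\<delta> \<le> \<zeta> x" unfolding \<delta>_def using finS True by simp
    finally have "\<epsilon> * \<bar>\<sigma> x\<bar> \<le> \<zeta> x" .
    moreover have "- (\<epsilon> * \<bar>\<sigma> x\<bar>) \<le> \<epsilon> * \<sigma> x"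
      using mult_left_mono[of "- \<bar>\<sigma> x\<bar>" "\<sigma> x" \<epsilon>] \<epsilon> by simp
    ultimately show ?thesis unfolding \<xi>_def by linarith
  next
    case False
    then show ?thesis using \<sigma>(1) nonneg by (simp add: \<xi>_def)
  qed
  have sub: "support \<xi> \<subseteq> support \<zeta>"
  proof
    fix x assume "x \<in> support \<xi>"
    then show "x \<in> support \<zeta>"
      using S(1) \<sigma>(1)[of x] by (cases "x \<in> S") (auto simp: support_def \<xi>_def)
  qed
  have ext: "(\<Sum>x\<in>support \<zeta>. \<sigma> x) = (\<Sum>x\<in>S. \<sigma> x)"
    "(\<Sum>x\<in>support \<zeta>. \<sigma> x *\<^sub>R M x) = (\<Sum>x\<in>S. \<sigma> x *\<^sub>R M x)"
    by (rule sum.mono_neutral_right; use \<sigma>(1) S(1) fin in auto)+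
  have "is_design L U \<xi>"
  proof (rule is_designI[OF fin(1)])
    show "\<xi> x = 0" if "x \<notin> support \<zeta>" for x using sub that by (auto simp: support_def)
    show "(\<Sum>x\<in>support \<zeta>. \<xi> x) = 1"
      using ext(1) \<sigma>(2) d
      by (simp add: \<xi>_def sum.distrib sum_distrib_left[symmetric] is_design_def)
  qed (use fin X pos in auto)
  moreover have info: "design_info M \<xi> = design_info M \<zeta> + \<epsilon> *\<^sub>R (\<Sum>x\<in>S. \<sigma> x *\<^sub>R M x)"
    unfolding design_info_superset[OF fin(1) sub] ext(2)[symmetric]
    by (simp add: \<xi>_def design_info_def scaleR_add_left sum.distrib scaleR_sum_right)
  moreover have "loewner_ge (design_info M \<xi>) (design_info M \<zeta>)"
    using \<sigma>(3) \<epsilon> unfolding loewner_ge_def info nnd_def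
    by (simp add: vec_eq_iff Finite_Cartesian_Product.transpose_def scaleR_matrix_vector_assoc[symmetric])
  moreover have "design_info M \<xi> \<noteq> design_info M \<zeta>" using \<sigma>(4) \<epsilon> info by simp
  ultimately show False
    using \<Phi> pd \<zeta> unfolding strictly_isotonic_def is_optimal_def by (meson not_less)
qed

text \<open>The average of the two designs is optimal with the same information matrix, so the union of the
  supports has at most \<open>k\<close> points. The difference of the designs annihilates all entries of \<open>C\<close> as well as
  the constant \<open>1\<close>, which is impossible for a nonzero signed measure on so few points.\<close>

lemma design_determined_by_optimal_info:
  assumes X: "X = design_space L U" and \<Phi>: "strictly_isotonic \<Phi>"
    and \<xi>: "is_optimal L U M \<Phi> \<xi>" and \<zeta>: "is_optimal L U M \<Phi> \<zeta>"
    and pd: "posdef (design_info M \<xi>)" and eq: "design_info M \<zeta> = design_info M \<xi>"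
  shows "\<zeta> = \<xi>"
proof (rule ccontr)
  assume ne: "\<zeta> \<noteq> \<xi>"
  have d: "is_design L U \<xi>" "is_design L U \<zeta>" using \<xi> \<zeta> by (auto simp: is_optimal_def)
  let ?h = "\<lambda>x. 1/2 * \<xi> x + (1 - 1/2) * \<zeta> x"
  have h: "is_design L U ?h" by (rule design_mixture(1)[OF d]) auto
  have h_info: "design_info M ?h = design_info M \<xi>"
    using design_mixture(2)[OF d, of "1/2" M] eq by (simp add: scaleR_add_left[symmetric])
  have h_opt: "is_optimal L U M \<Phi> ?h"
    using \<xi> h unfolding is_optimal_def h_info by blast
  have supp: "support ?h = support \<xi> \<union> support \<zeta>"
  proof -
    have "0 \<le> \<xi> x" "0 \<le> \<zeta> x" for x using d by (auto simp: is_design_def)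
    then have "?h x = 0 \<longleftrightarrow> \<xi> x = 0 \<and> \<zeta> x = 0" for x
      using add_nonneg_eq_0_iff[of "1/2 * \<xi> x" "1/2 * \<zeta> x"] by simp
    then show ?thesis by (auto simp: support_def)
  qed
  define S where "S = support \<xi> \<union> support \<zeta>"
  have S: "finite S" "S \<subseteq> X" using d X by (auto simp: S_def is_design_def)
  have card: "card S \<le> k"
    using optimal_design_support_small[OF X \<Phi> h_opt] pd h_info supp by (simp add: S_def)
  define \<nu> where "\<nu> = (\<lambda>x. \<zeta> x - \<xi> x)"
  have nz: "\<exists>x\<in>S. \<nu> x \<noteq> 0"
    using ne by (auto simp: \<nu>_def S_def support_def fun_eq_iff)
  have "(\<Sum>x\<in>S. \<nu> x *\<^sub>R M x) = 0"
    using eq design_info_superset[OF S(1), of \<xi> M] design_info_superset[OF S(1), of \<zeta> M]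
    by (simp add: \<nu>_def S_def scaleR_diff_left sum_subtractf)
  moreover have "(\<Sum>x\<in>S. \<nu> x *\<^sub>R M x) = P ** (\<Sum>x\<in>S. \<nu> x *\<^sub>R C (c x)) ** transpose P"
  proof -
    have "(\<Sum>x\<in>S. \<nu> x *\<^sub>R M x) = (\<Sum>x\<in>S. \<nu> x *\<^sub>R (P ** C (c x) ** transpose P))"
      using S(2) M_eq by (intro sum.cong) auto
    then show ?thesis
      by (simp add: linear_sum[OF congruence_linear] linear_scale[OF congruence_linear])
  qed
  ultimately have null: "(\<Sum>x\<in>S. \<nu> x *\<^sub>R C (c x)) = 0"
    using congruence_inj[OF inv_P, of "\<Sum>x\<in>S. \<nu> x *\<^sub>R C (c x)" 0] by (simp add: linear_0[OF congruence_linear])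
  then have entry: "(\<Sum>x\<in>S. \<nu> x * C (c x) $ i $ j) = 0" for i j
  proof -
    have "(\<Sum>x\<in>S. \<nu> x * C (c x) $ i $ j) = (\<Sum>x\<in>S. \<nu> x *\<^sub>R C (c x)) $ i $ j" by simp
    then show ?thesis unfolding null by simp
  qed
  obtain j where j: "j \<in> J" using J_ne by blast
  have "(\<Sum>x\<in>S. \<nu> x * block_form J (C (c x)) (axis j 1)) \<noteq> 0"
  proof (rule annihilator_top_nonzero[OF S _ nz])
    show "card S \<le> Suc k" using card by simp
    show "\<exists>i\<in>J. (axis j (1::real)) $ i \<noteq> 0" using j by (intro bexI[of _ j]) (simp_all add: axis_def)
    show "(\<Sum>x\<in>S. \<nu> x * u l (c x)) = 0" if lk: "l < k" for l
    proof (cases "l = 0")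
      case True
      have "(\<Sum>x\<in>S. \<nu> x * u 0 (c x)) = (\<Sum>x\<in>S. \<nu> x)"
        using S(2) u_0 by (intro sum.cong) auto
      also have "\<dots> = 0"
        using design_weight_superset[OF d(1) S(1)] design_weight_superset[OF d(2) S(1)]
        by (simp add: \<nu>_def S_def sum_subtractf)
      finally show ?thesis using True by simp
    next
      case False
      then obtain i j where "\<forall>s\<in>c ` X. u l s = C s $ i $ j" using u_entry[of l] lk by auto
      then have "(\<Sum>x\<in>S. \<nu> x * u l (c x)) = (\<Sum>x\<in>S. \<nu> x * C (c x) $ i $ j)"
        using S(2) by (intro sum.cong) auto
      then show ?thesis using entry by simp
    qed
  qed
  moreover have "(\<Sum>x\<in>S. \<nu> x * block_form J (C (c x)) (axis j 1)) = 0"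
    unfolding block_form_sum[symmetric] null by (rule linear_0[OF block_form_linear])
  ultimately show False by simp
qed

lemma interval_I: "is_interval (c ` X)"
proof -
  obtain j where "j \<in> J" using J_ne by blast
  then have "\<exists>i\<in>J. axis j (1::real) $ i \<noteq> 0" by (intro bexI[of _ j]) (simp_all add: axis_def)
  then show ?thesis using chain by (metis derivative_chain_def)
qed

text \<open>The form of \<open>C(s)\<close> at an arbitrary \<open>v\<close>, as a combination of one derivative chain. If \<open>v\<close> vanishes on
  \<open>J\<close>, the block contributes nothing and any chain serves, with last coefficient zero; otherwise the
  last coefficient is \<open>1\<close>.\<close>

lemma quadratic_form_expansion:
  obtains a v' where "\<exists>i\<in>J. v' $ i \<noteq> 0"
    and "\<And>s. s \<in> c ` X \<Longrightarrow> v \<bullet> (C s *v v) = (\<Sum>l=0..k. a l * \<phi> v' l 0 s)"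
    and "a k \<noteq> 0 \<Longrightarrow> a k = 1"
proof -
  have "\<exists>a. \<forall>s\<in>c ` X. C s $ i $ j = (\<Sum>l<k. a l * u l s)" if ij: "i \<notin> J \<or> j \<notin> J" for i j
  proof (cases "j \<in> J")
    case True
    obtain a where a: "\<forall>s\<in>c ` X. C s $ j $ i = (\<Sum>l<k. a l * u l s)"
      using C_span[of i j] True ij by auto
    have "C s $ i $ j = C s $ j $ i" if "s \<in> c ` X" for s
    proof -
      have "C s $ i $ j = transpose (C s) $ j $ i" by (simp add: Finite_Cartesian_Product.transpose_def)
      then show ?thesis using sym_C[OF that] by simp
    qed
    then show ?thesis using a by (intro exI[of _ a]) simp
  qed (rule C_span)
  then obtain A where A: "\<And>i j s. i \<notin> J \<or> j \<notin> J \<Longrightarrow> s \<in> c ` X \<Longrightarrow> C s $ i $ j = (\<Sum>l<k. A i j l * u l s)"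
    by metis
  define B where "B = (\<lambda>i j l. if i \<notin> J \<or> j \<notin> J then A i j l else 0)"
  define b where "b = (\<lambda>l. \<Sum>i\<in>UNIV. \<Sum>j\<in>UNIV. v $ i * v $ j * B i j l)"
  have quad: "v \<bullet> (C s *v v) = (\<Sum>l<k. b l * u l s) + block_form J (C s) v" if s: "s \<in> c ` X" for s
  proof -
    have "v $ i * v $ j * C s $ i $ j = (\<Sum>l<k. v $ i * v $ j * B i j l * u l s)
        + (if i \<in> J then (if j \<in> J then v $ i * v $ j * C s $ i $ j else 0) else 0)" for i j
      using A[of i j s] s by (simp add: B_def sum_distrib_left mult.assoc)
    then have "v \<bullet> (C s *v v) = (\<Sum>i\<in>UNIV. \<Sum>j\<in>UNIV. (\<Sum>l<k. v $ i * v $ j * B i j l * u l s)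
        + (if i \<in> J then (if j \<in> J then v $ i * v $ j * C s $ i $ j else 0) else 0))"
      unfolding quadratic_form_eq_sum by simp
    also have "\<dots> = (\<Sum>i\<in>UNIV. \<Sum>j\<in>UNIV. \<Sum>l<k. v $ i * v $ j * B i j l * u l s)
        + (\<Sum>i\<in>UNIV. if i \<in> J then (\<Sum>j\<in>UNIV. if j \<in> J then v $ i * v $ j * C s $ i $ j else 0) else 0)"
      unfolding sum.distrib by (intro arg_cong2[of _ _ _ _ "(+)"] sum.cong refl) auto
    also have "(\<Sum>i\<in>UNIV. if i \<in> J then (\<Sum>j\<in>UNIV. if j \<in> J then v $ i * v $ j * C s $ i $ j else 0) else 0)
        = block_form J (C s) v"
      unfolding block_form_def by (simp add: sum.If_cases)
    also have "(\<Sum>i\<in>UNIV. \<Sum>j\<in>UNIV. \<Sum>l<k. v $ i * v $ j * B i j l * u l s) = (\<Sum>l<k. b l * u l s)"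
    proof -
      have "(\<Sum>i\<in>UNIV. \<Sum>j\<in>UNIV. \<Sum>l<k. v $ i * v $ j * B i j l * u l s)
          = (\<Sum>i\<in>UNIV. \<Sum>l<k. \<Sum>j\<in>UNIV. v $ i * v $ j * B i j l * u l s)"
        by (intro sum.cong refl sum.swap)
      also have "\<dots> = (\<Sum>l<k. \<Sum>i\<in>UNIV. \<Sum>j\<in>UNIV. v $ i * v $ j * B i j l * u l s)"
        by (rule sum.swap)
      finally show ?thesis by (simp add: b_def sum_distrib_right)
    qed
    finally show ?thesis .
  qed
  have base: "(\<Sum>l<k. b l * u l s) = (\<Sum>l<k. b l * \<phi> w l 0 s)" if "s \<in> c ` X" for s w
    using that by (intro sum.cong) (auto simp: chain_base)
  have upto: "{0..k} = insert k {..<k}" by auto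
  show ?thesis
  proof (cases "\<exists>i\<in>J. v $ i \<noteq> 0")
    case True
    show ?thesis
    proof (rule that[OF True, of "b(k := 1)"])
      fix s assume s: "s \<in> c ` X"
      have "(\<Sum>l<k. (b(k := 1)) l * \<phi> v l 0 s) = (\<Sum>l<k. b l * \<phi> v l 0 s)"
        by (intro sum.cong) auto
      then show "v \<bullet> (C s *v v) = (\<Sum>l=0..k. (b(k := 1)) l * \<phi> v l 0 s)"
        using quad[OF s] base[OF s, of v] by (simp add: upto chain_top[OF s])
    qed simp
  next
    case False
    obtain j where "j \<in> J" using J_ne by blast
    then have ax: "\<exists>i\<in>J. axis j (1::real) $ i \<noteq> 0" by (intro bexI[of _ j]) (simp_all add: axis_def)
    have "block_form J (C s) v = 0" for s
      unfolding block_form_def using False by (intro sum.neutral ballI) simp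
    show ?thesis
    proof (rule that[OF ax, of "b(k := 0)"])
      fix s assume s: "s \<in> c ` X"
      have "(\<Sum>l<k. (b(k := 0)) l * \<phi> (axis j 1) l 0 s) = (\<Sum>l<k. b l * \<phi> (axis j 1) l 0 s)"
        by (intro sum.cong) auto
      then show "v \<bullet> (C s *v v) = (\<Sum>l=0..k. (b(k := 0)) l * \<phi> (axis j 1) l 0 s)"
        using quad[OF s] base[OF s, of "axis j 1"] \<open>block_form J (C s) v = 0\<close> by (simp add: upto)
    qed simp
  qed
qed

lemma chain_combination_derivative:
  assumes v: "\<exists>i\<in>J. v $ i \<noteq> 0" and s: "s \<in> c ` X"
  shows "((\<lambda>r. \<Sum>l=0..k. a l * \<phi> v l 0 r) has_real_derivative (\<Sum>l=1..k. a l * \<phi> v l 1 s)) (at s within c ` X)"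
proof -
  have ch: "derivative_chain (c ` X) (\<phi> v) k" by (rule chain[OF v])
  have one: "\<phi> v 0 0 r = 1" if "r \<in> c ` X" for r
    using ch that unfolding derivative_chain_def by blast
  have d: "(\<phi> v l 0 has_real_derivative \<phi> v l 1 s) (at s within c ` X)" if "l \<in> {1..k}" for l
  proof -
    have "((\<lambda>r. \<phi> v l 0 r / \<phi> v 0 0 r) has_real_derivative \<phi> v l 1 s) (at s within c ` X)"
      using ch s that unfolding derivative_chain_def by (metis One_nat_def atLeastAtMost_iff less_eq_Suc_le)
    then show ?thesis
      by (rule has_field_derivative_transform_within[OF _ zero_less_one s]) (simp add: one)
  qed
  have "((\<lambda>r. a 0 + (\<Sum>l=1..k. a l * \<phi> v l 0 r)) has_real_derivative 0 + (\<Sum>l=1..k. a l * \<phi> v l 1 s))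
      (at s within c ` X)"
    by (intro derivative_intros DERIV_cmult d) simp
  then have "((\<lambda>r. a 0 + (\<Sum>l=1..k. a l * \<phi> v l 0 r)) has_real_derivative (\<Sum>l=1..k. a l * \<phi> v l 1 s))
      (at s within c ` X)" by simp
  moreover have "a 0 + (\<Sum>l=1..k. a l * \<phi> v l 0 r) = (\<Sum>l=0..k. a l * \<phi> v l 0 r)" if "r \<in> c ` X" for r
    using one[OF that] by (simp add: sum.atLeast_Suc_atMost)
  ultimately show ?thesis
    by (rule has_field_derivative_transform_within[OF _ zero_less_one s]) simp
qed

lemma quadratic_form_differentiable:
  assumes s: "s \<in> c ` X"
  shows "\<exists>D. ((\<lambda>r. v \<bullet> (C r *v v)) has_real_derivative D) (at s within c ` X)"
proof -
  obtain a v' where v': "\<exists>i\<in>J. v' $ i \<noteq> 0"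
    and e: "\<And>r. r \<in> c ` X \<Longrightarrow> v \<bullet> (C r *v v) = (\<Sum>l=0..k. a l * \<phi> v' l 0 r)"
    using quadratic_form_expansion by metis
  show ?thesis
    by (rule exI, rule has_field_derivative_transform_within[OF chain_combination_derivative[OF v' s] zero_less_one s])
       (simp add: e)
qed

text \<open>By polarization from the quadratic forms.\<close>

lemma bilinear_form_differentiable:
  assumes s: "s \<in> c ` X"
  shows "\<exists>D. ((\<lambda>r. y \<bullet> (C r *v v)) has_real_derivative D) (at s within c ` X)"
proof -
  obtain D1 where D1: "((\<lambda>r. (y + v) \<bullet> (C r *v (y + v))) has_real_derivative D1) (at s within c ` X)"
    using quadratic_form_differentiable[OF s] by blast
  obtain D2 where D2: "((\<lambda>r. y \<bullet> (C r *v y)) has_real_derivative D2) (at s within c ` X)"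
    using quadratic_form_differentiable[OF s] by blast
  obtain D3 where D3: "((\<lambda>r. v \<bullet> (C r *v v)) has_real_derivative D3) (at s within c ` X)"
    using quadratic_form_differentiable[OF s] by blast
  have "((\<lambda>r. ((y + v) \<bullet> (C r *v (y + v)) - y \<bullet> (C r *v y) - v \<bullet> (C r *v v)) / 2)
      has_real_derivative (D1 - D2 - D3) / 2) (at s within c ` X)"
    by (intro DERIV_cdivide DERIV_diff D1 D2 D3)
  moreover have "((y + v) \<bullet> (C r *v (y + v)) - y \<bullet> (C r *v y) - v \<bullet> (C r *v v)) / 2 = y \<bullet> (C r *v v)"
    if "r \<in> c ` X" for r
    using quadratic_form_add[OF sym_C[OF that], of y 1 v] symmetric_inner_swap[OF sym_C[OF that], of y v] by simp
  ultimately have "((\<lambda>r. y \<bullet> (C r *v v)) has_real_derivative (D1 - D2 - D3) / 2) (at s within c ` X)"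
    by (rule has_field_derivative_transform_within[OF _ zero_less_one s])
  then show ?thesis by blast
qed

lemma form_eq_fisher:
  assumes x: "x \<in> X"
  shows "(transpose P *v y) \<bullet> (C (c x) *v (transpose P *v z)) = y \<bullet> (M x *v z)"
proof -
  have "y \<bullet> (M x *v z) = y \<bullet> (P *v (C (c x) *v (transpose P *v z)))"
    by (simp only: M_eq[OF x] matrix_vector_mul_assoc matrix_mul_assoc)
  then show ?thesis by (simp add: dot_lmul_matrix)
qed

lemma limit_point_I: "s \<in> c ` X \<Longrightarrow> at s within c ` X \<noteq> bot"
proof -
  assume s: "s \<in> c ` X"
  have "infinite (c ` X)" using inf_X inj_c by (simp add: finite_image_iff)
  then have "c ` X \<noteq> {t}" for t by (metis finite.emptyI finite.insertI)
  then have "s islimpt c ` X"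
    using connected_imp_perfect[OF _ s] interval_I is_interval_connected_1 by blast
  then show ?thesis by (simp add: trivial_limit_within)
qed

text \<open>For a rank one matrix \<open>M\<^sub>x = w f f\<^sup>T\<close> and any \<open>y\<close>, the product of the forms at \<open>y\<close> and \<open>z\<close> is the square of
  the bilinear form at \<open>(y, z)\<close>. At a zero of the form at \<open>z\<close> the derivative of this square vanishes. With
  \<open>y = f x\<close> the form at \<open>y\<close> is nonzero, so the derivative of the form at \<open>z\<close> is zero. The
  argument uses one-sided derivatives only and so covers endpoints of the interval.\<close>

lemma fisher_zero_is_double:
  assumes x: "x \<in> X" and M: "M = fisher_info w f" and nz: "M x \<noteq> 0" and zero: "z \<bullet> (M x *v z) = 0"
    and D: "((\<lambda>r. (transpose P *v z) \<bullet> (C r *v (transpose P *v z))) has_real_derivative D) (at (c x) within c ` X)"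
  shows "D = 0"
proof -
  have form: "y \<bullet> (M t *v y') = w t * (f t \<bullet> y) * (f t \<bullet> y')" for y y' t
    unfolding M fisher_info_def
    by (simp add: inner_vec_def matrix_vector_mult_def sum_distrib_left sum_distrib_right mult_ac)
  define y where "y = f x"
  define Y Z where "Y = transpose P *v y" and "Z = transpose P *v z"
  have cx: "c x \<in> c ` X" using x by blast
  obtain D1 where D1: "((\<lambda>r. Y \<bullet> (C r *v Y)) has_real_derivative D1) (at (c x) within c ` X)"
    using bilinear_form_differentiable[OF cx] by blast
  obtain D2 where D2: "((\<lambda>r. Y \<bullet> (C r *v Z)) has_real_derivative D2) (at (c x) within c ` X)"
    using bilinear_form_differentiable[OF cx] by blast
  have Dz: "((\<lambda>r. Z \<bullet> (C r *v Z)) has_real_derivative D) (at (c x) within c ` X)"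
    using D unfolding Z_def .
  let ?lhs = "\<lambda>r. (Y \<bullet> (C r *v Y)) * (Z \<bullet> (C r *v Z))"
  let ?rhs = "\<lambda>r. (Y \<bullet> (C r *v Z)) * (Y \<bullet> (C r *v Z))"
  have eq: "?lhs r = ?rhs r" if "r \<in> c ` X" for r
    using that form_eq_fisher unfolding Y_def Z_def by (auto simp: form mult_ac)
  have z0: "Z \<bullet> (C (c x) *v Z) = 0" using form_eq_fisher[OF x] zero by (simp add: Z_def)
  then have yz0: "Y \<bullet> (C (c x) *v Z) = 0" using eq[OF cx] by simp
  have wx: "w x \<noteq> 0" "y \<noteq> 0"
    using nz unfolding M y_def by (auto simp: fisher_info_def vec_eq_iff)
  have yy: "Y \<bullet> (C (c x) *v Y) \<noteq> 0"
    using form_eq_fisher[OF x, of y y] wx by (simp add: Y_def form y_def)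
  have "(?lhs has_real_derivative (D1 * (Z \<bullet> (C (c x) *v Z)) + D * (Y \<bullet> (C (c x) *v Y)))) (at (c x) within c ` X)"
    using DERIV_mult[OF D1 Dz] by simp
  then have 1: "(?lhs has_vector_derivative D * (Y \<bullet> (C (c x) *v Y))) (at (c x) within c ` X)"
    by (simp add: z0 has_real_derivative_iff_has_vector_derivative)
  have "(?rhs has_real_derivative 0) (at (c x) within c ` X)"
    using DERIV_mult[OF D2 D2] by (simp add: yz0)
  then have "(?lhs has_real_derivative 0) (at (c x) within c ` X)"
    by (rule has_field_derivative_transform_within[OF _ zero_less_one cx]) (simp add: eq)
  then have 2: "(?lhs has_vector_derivative 0) (at (c x) within c ` X)"
    by (simp add: has_real_derivative_iff_has_vector_derivative)
  have "D * (Y \<bullet> (C (c x) *v Y)) = 0"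
    by (rule vector_derivative_unique_within[OF limit_point_I[OF cx] 1 2])
  then show ?thesis using yy by simp
qed

text \<open>Let \<open>g\<close> be the derivative of \<open>q = v \<bullet> C v\<close>. Together with the points from Rolle's theorem, \<open>g\<close> has \<open>2 d - 1\<close>
  zeros, which settles the case that at most \<open>2 d - 1\<close> coefficients of \<open>g\<close> are present. In the
  remaining case \<open>k = 2 d\<close>, and \<open>g\<close> is a combination of \<open>2 d\<close> functions with leading coefficient \<open>1\<close>.
  As \<open>q \<ge> 0\<close>, it rises and falls between neighbouring zeros, so \<open>g\<close> has there a
  nonnegative and then a nonpositive value. Together with the zeros of \<open>g\<close> at the first and the last
  point these are \<open>2 d\<close> weakly alternating values, and \<open>weak_alternation_top_sign\<close> contradicts the
  negative sign.\<close>

lemma nonneg_form_with_double_zeros_vanishes: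
  assumes x: "\<And>i. i < d \<Longrightarrow> x i \<in> c ` X" "\<And>i. Suc i < d \<Longrightarrow> x i < x (Suc i)"
    and d: "2 \<le> d" and kd: "k \<le> 2 * d"
    and sign: "\<And>v s. k = 2 * d \<Longrightarrow> \<exists>i\<in>J. v $ i \<noteq> 0 \<Longrightarrow> s \<in> c ` X \<Longrightarrow>
      (\<Prod>l=1..<k. sgn (\<phi> v l l s)) * \<phi> v k k s < 0"
    and nonneg: "\<And>s. s \<in> c ` X \<Longrightarrow> 0 \<le> v \<bullet> (C s *v v)"
    and zero: "\<And>i. i < d \<Longrightarrow> v \<bullet> (C (x i) *v v) = 0"
    and double: "\<And>i D. i < d \<Longrightarrow> ((\<lambda>r. v \<bullet> (C r *v v)) has_real_derivative D) (at (x i) within c ` X) \<Longrightarrow> D = 0"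
    and s: "s \<in> c ` X"
  shows "v \<bullet> (C s *v v) = 0"
proof -
  obtain a v' where v': "\<exists>i\<in>J. v' $ i \<noteq> 0"
    and e: "\<And>r. r \<in> c ` X \<Longrightarrow> v \<bullet> (C r *v v) = (\<Sum>l=0..k. a l * \<phi> v' l 0 r)"
    and ak: "a k \<noteq> 0 \<Longrightarrow> a k = 1"
    using quadratic_form_expansion by metis
  note ch = chain[OF v']
  define q where "q = (\<lambda>r. v \<bullet> (C r *v v))"
  define g where "g = (\<lambda>r. \<Sum>l=1..k. a l * \<phi> v' l 1 r)"
  have der: "(q has_real_derivative g r) (at r within c ` X)" if "r \<in> c ` X" for r
    unfolding q_def g_def
    by (rule has_field_derivative_transform_within[OF chain_combination_derivative[OF v' that] zero_less_one that])
       (simp add: e)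
  have qx: "q (x i) = 0" and gx: "g (x i) = 0" if "i < d" for i
    using zero[OF that] double[OF that] der[OF x(1)[OF that]] unfolding q_def by auto
  have mid: "\<exists>p n. p \<in> c ` X \<and> n \<in> c ` X \<and> x i < p \<and> p < n \<and> n < x (Suc i) \<and> 0 \<le> g p \<and> g n \<le> 0"
    if i: "Suc i < d" for i
  proof -
    let ?m = "(x i + x (Suc i)) / 2"
    have lt: "x i < ?m" "?m < x (Suc i)" using x(2)[OF i] by auto
    have xi: "x i \<in> c ` X" "x (Suc i) \<in> c ` X" using x(1) i by auto
    have m: "?m \<in> c ` X" using interval_I xi lt unfolding is_interval_1 by (meson less_imp_le)
    have qm: "0 \<le> q ?m" using nonneg[OF m] by (simp add: q_def)
    obtain p where p: "p \<in> c ` X" "x i < p" "p < ?m" "q ?m - q (x i) = g p * (?m - x i)"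
      using mvt_on_interval[OF interval_I xi(1) m lt(1) der] .
    obtain n where n: "n \<in> c ` X" "?m < n" "n < x (Suc i)" "q (x (Suc i)) - q ?m = g n * (x (Suc i) - ?m)"
      using mvt_on_interval[OF interval_I m xi(2) lt(2) der] .
    have "0 \<le> g p * (?m - x i)" using p(4) qm qx[of i] i by simp
    then have "0 \<le> g p" using lt(1) by (simp add: zero_le_mult_iff)
    moreover have "g n * (x (Suc i) - ?m) \<le> 0" using n(4) qm qx[of "Suc i"] i by simp
    then have "g n \<le> 0" using lt(2) by (simp add: mult_le_0_iff)
    ultimately show ?thesis using p n by (intro exI[of _ p] exI[of _ n]) auto
  qed
  have rolle: "\<exists>r. r \<in> c ` X \<and> x i < r \<and> r < x (Suc i) \<and> g r = 0" if i: "Suc i < d" for i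
  proof -
    have xi: "x i \<in> c ` X" "x (Suc i) \<in> c ` X" using x(1) i by auto
    obtain r where r: "r \<in> c ` X" "x i < r" "r < x (Suc i)" "q (x (Suc i)) - q (x i) = g r * (x (Suc i) - x i)"
      using mvt_on_interval[OF interval_I xi x(2)[OF i] der] .
    then show ?thesis using qx[of i] qx[of "Suc i"] i by (intro exI[of _ r]) auto
  qed
  have coeffs: "\<forall>l\<in>{1..k}. a l = 0"
  proof (cases "a k = 0 \<or> k \<le> 2 * d - 1")
    case True
    obtain r where r: "\<And>i. Suc i < d \<Longrightarrow> r i \<in> c ` X \<and> x i < r i \<and> r i < x (Suc i) \<and> g (r i) = 0"
      using rolle by metis
    \<comment> \<open>the given zeros interlaced with those from Rolle's theorem\<close>
    define y where "y = (\<lambda>i. if even i then x (i div 2) else r (i div 2))"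
    have y: "y i \<in> c ` X" "g (y i) = 0" if "i \<le> 2 * d - 2" for i
    proof -
      have "even i \<Longrightarrow> i div 2 < d" "odd i \<Longrightarrow> Suc (i div 2) < d" using that d by presburger+
      then show "y i \<in> c ` X" "g (y i) = 0" using x(1) gx r by (auto simp: y_def)
    qed
    have y_less: "y i < y (Suc i)" if "i < 2 * d - 2" for i
    proof -
      have *: "Suc (i div 2) < d" using that by presburger
      show ?thesis
      proof (cases "even i")
        case True
        then show ?thesis using r[OF *] by (simp add: y_def)
      next
        case False
        then have "Suc i div 2 = Suc (i div 2)" by presburger
        then show ?thesis using False r[OF *] by (simp add: y_def)
      qed
    qed
    \<comment> \<open>a vanishing last coefficient shortens the chain by one\<close>
    define k' where "k' = (if a k = 0 then k - 1 else k)"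
    have k': "k' \<le> k" "k' \<le> 1 + (2 * d - 2)" using True kd d unfolding k'_def by auto
    have "(\<Sum>l=1..k'. a l * \<phi> v' l 1 (y i)) = g (y i)" for i
      unfolding g_def k'_def using k_pos by (cases k) (auto simp: atLeastAtMostSuc_conv)
    then have "\<forall>l\<in>{1..k'}. a l = 0"
      using y by (intro zeros_imp_coeffs_zero[OF derivative_chain_mono[OF ch k'(1)] k'(2), of y] y_less) simp_all
    moreover have "l = k \<and> a k = 0 \<or> l \<in> {1..k'}" if "l \<in> {1..k}" for l
      using that unfolding k'_def by auto
    ultimately show ?thesis by blast
  next
    case False
    then have k2d: "k = 2 * d" and a1: "a k = 1" using kd ak by auto
    obtain p n where pn: "\<And>i. Suc i < d \<Longrightarrow> p i \<in> c ` X \<and> n i \<in> c ` X \<and> x i < p i \<and> p i < n i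
        \<and> n i < x (Suc i) \<and> 0 \<le> g (p i) \<and> g (n i) \<le> 0"
      using mid by metis
    \<comment> \<open>the points \<open>x 0, p 0, n 0, p 1, n 1, \<dots>, x (d - 1)\<close>\<close>
    define y where "y = (\<lambda>i. if i = 0 then x 0 else if i = 2 * d - 1 then x (d - 1)
        else if odd i then p (i div 2) else n (i div 2 - 1))"
    have yc: "y 0 = x 0" "y (2 * d - 1) = x (d - 1)"
      "\<And>j. Suc j < d \<Longrightarrow> y (Suc (2 * j)) = p j" "\<And>j. Suc j < d \<Longrightarrow> y (Suc (Suc (2 * j))) = n j"
      using d by (auto simp: y_def)
    have cases: "i = 0 \<or> i = 2 * d - 1 \<or> (\<exists>j. Suc j < d \<and> i = Suc (2 * j)) \<or> (\<exists>j. Suc j < d \<and> i = Suc (Suc (2 * j)))"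
      if "i \<le> 2 * d - 1" for i
      using that by presburger
    have "\<exists>s\<in>c ` X. 0 \<le> (\<Prod>l=1..<k. sgn (\<phi> v' l l s)) * (a k * \<phi> v' k k s)"
    proof (rule weak_alternation_top_sign[OF ch, of 1 "2 * d - 1" y])
      show "1 + (2 * d - 1) = k" using k2d d by simp
      show "y i \<in> c ` X" if "i \<le> 2 * d - 1" for i
        using cases[OF that]
      proof (elim disjE exE conjE)
        assume "i = 2 * d - 1"
        then show ?thesis using yc(2) x(1)[of "d - 1"] d by (simp del: One_nat_def)
      qed (use yc pn x(1)[of 0] d in auto)
      show "y i < y (Suc i)" if i: "i < 2 * d - 1" for i
      proof -
        consider "i = 0" | j where "Suc j < d" "i = Suc (2 * j)" | j where "Suc j < d" "i = Suc (Suc (2 * j))"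
          using cases[of i] i by auto
        then show ?thesis
        proof cases
          case 1
          then show ?thesis using yc(1) yc(3)[of 0] pn[of 0] d by auto
        next
          case 2
          then show ?thesis using yc(3,4) pn by auto
        next
          case (3 j)
          show ?thesis
          proof (cases "Suc (Suc j) < d")
            case True
            then have "y (Suc i) = p (Suc j)" using yc(3)[of "Suc j"] 3 by simp
            then show ?thesis using 3 yc(4) pn[of j] pn[OF True] by auto
          next
            case False
            then have "Suc i = 2 * d - 1" "d - 1 = Suc j" using 3 by auto
            then have "y (Suc i) = x (Suc j)" using yc(2) by metis
            then show ?thesis using 3 yc(4) pn[of j] by auto
          qed
        qed
      qed
      show "0 \<le> (-1) ^ (2 * d - 1 - i) * (\<Sum>l=1..k. a l * \<phi> v' l 1 (y i))" if i: "i \<le> 2 * d - 1" for i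
      proof -
        have g: "(\<Sum>l=1..k. a l * \<phi> v' l 1 (y i)) = g (y i)" by (simp add: g_def)
        consider "i = 0 \<or> i = 2 * d - 1" | j where "Suc j < d" "i = Suc (2 * j)" | j where "Suc j < d" "i = Suc (Suc (2 * j))"
          using cases[OF i] by blast
        then show ?thesis unfolding g
        proof cases
          case 1
          then have "g (y i) = 0"
            using yc(1,2) gx[of 0] gx[of "d - 1"] d by (elim disjE) (simp_all del: One_nat_def)
          then show "0 \<le> (-1) ^ (2 * d - 1 - i) * g (y i)" by simp
        next
          case (2 j)
          then have "even (2 * d - 1 - i)" by presburger
          then show "0 \<le> (-1) ^ (2 * d - 1 - i) * g (y i)" using 2 yc(3) pn by auto
        next
          case (3 j)
          then have "odd (2 * d - 1 - i)" by presburger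
          then show "0 \<le> (-1) ^ (2 * d - 1 - i) * g (y i)" using 3 yc(4) pn by auto
        qed
      qed
    qed
    then show ?thesis using sign[OF k2d v'] a1 by (metis mult_1 not_less)
  qed
  have const: "q r = a 0 * \<phi> v' 0 0 r" if "r \<in> c ` X" for r
    using e[OF that] coeffs by (simp add: q_def sum.atLeast_Suc_atMost)
  have one: "\<phi> v' 0 0 r = 1" if "r \<in> c ` X" for r
    using ch that unfolding derivative_chain_def by blast
  have "q s = q (x 0)" using const one s x(1)[of 0] d by simp
  then show ?thesis using qx[of 0] d by (simp add: q_def)
qed

text \<open>An uninformative support point makes room for a nonsingular design, which gives a positive
  definite optimal information matrix and hence, by uniqueness of that matrix, the claim. Otherwise
  every null vector of the information matrix yields a form with \<open>d\<close> double zeros, which must vanish at all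
  points of the design space; this contradicts the existence of a nonsingular design.\<close>

lemma optimal_info_posdef:
  assumes X: "X = design_space L U" and M: "M = fisher_info w f"
    and w: "\<And>x. x \<in> X \<Longrightarrow> 0 \<le> w x"
    and \<nu>: "is_design L U \<nu>" "posdef (design_info M \<nu>)"
    and mid: "midpoint_strict \<Phi>"
    and iso: "\<And>A B. nnd A \<Longrightarrow> nnd B \<Longrightarrow> loewner_ge A B \<Longrightarrow> \<Phi> B \<le> \<Phi> A"
    and \<xi>: "is_optimal L U M \<Phi> \<xi>" and card: "CARD('d) \<le> card (support \<xi>)"
    and d2: "2 \<le> CARD('d)" and k: "k \<le> 2 * CARD('d)"
    and sign: "\<And>v s. k = 2 * CARD('d) \<Longrightarrow> \<exists>i\<in>J. v $ i \<noteq> 0 \<Longrightarrow> s \<in> c ` X \<Longrightarrow>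
      (\<Prod>l=1..<k. sgn (\<phi> v l l s)) * \<phi> v k k s < 0"
  shows "posdef (design_info M \<xi>)"
proof -
  have d\<xi>: "is_design L U \<xi>" using \<xi> by (simp add: is_optimal_def)
  have nndM: "nnd (M x)" if "x \<in> X" for x
    unfolding M by (rule fisher_info_nnd) (rule w[OF that])
  have nnd_info: "nnd (design_info M \<zeta>)" if "is_design L U \<zeta>" for \<zeta>
    by (rule design_info_nnd[OF _ that]) (use nndM X in auto)
  have wt: "0 \<le> \<xi> x" for x using d\<xi> by (simp add: is_design_def)
  have supp: "finite (support \<xi>)" "support \<xi> \<subseteq> X" using d\<xi> X by (auto simp: is_design_def)
  show ?thesis
  proof (cases "\<exists>x\<in>support \<xi>. M x = 0")
    case True
    then obtain x where x: "x \<in> support \<xi>" "M x = 0" by blast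
    have xpos: "0 < \<xi> x" using x(1) wt[of x] by (auto simp: support_def less_le)
    obtain \<zeta> where \<zeta>: "is_design L U \<zeta>" "design_info M \<zeta> = design_info M \<xi> + \<xi> x *\<^sub>R design_info M \<nu>"
      using reallocating_uninformative_weight[OF d\<xi> \<nu>(1), of M x] x(2) by blast
    have pd: "posdef (design_info M \<zeta>)" and ge: "loewner_ge (design_info M \<zeta>) (design_info M \<xi>)"
      unfolding \<zeta>(2) by (rule nnd_add_scaled_posdef[OF nnd_info[OF d\<xi>] \<nu>(2) xpos])+
    have "\<Phi> (design_info M \<xi>) \<le> \<Phi> (design_info M \<zeta>)"
      by (intro iso nnd_info d\<xi> \<zeta>(1) ge)
    then have opt: "is_optimal L U M \<Phi> \<zeta>"
      using \<xi> \<zeta>(1) unfolding is_optimal_def by (meson order_trans)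
    have "design_info M \<xi> = design_info M \<zeta>"
      by (rule optimal_info_unique[OF mid nnd_info opt \<xi> pd])
    then show ?thesis using pd by simp
  next
    case nonzero: False
    show ?thesis
    proof (rule ccontr)
      assume "\<not> ?thesis"
      then obtain z where z: "z \<noteq> 0" "\<not> 0 < z \<bullet> (design_info M \<xi> *v z)"
        using nnd_info[OF d\<xi>] unfolding posdef_def nnd_def by blast
      have q0: "0 \<le> z \<bullet> (M x *v z)" if "x \<in> X" for x using nndM[OF that] by (simp add: nnd_def)
      have "(\<Sum>x\<in>support \<xi>. \<xi> x * (z \<bullet> (M x *v z))) = 0"
        using z(2) nnd_info[OF d\<xi>] unfolding design_info_quadratic[symmetric] nnd_def by (meson antisym not_less)
      then have "\<forall>x\<in>support \<xi>. \<xi> x * (z \<bullet> (M x *v z)) = 0"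
        by (subst (asm) sum_nonneg_eq_0_iff) (use supp wt q0 in \<open>auto intro!: mult_nonneg_nonneg\<close>)
      then have null: "z \<bullet> (M x *v z) = 0" if "x \<in> support \<xi>" for x
        using that by (auto simp: support_def)
      obtain S where S: "S \<subseteq> support \<xi>" "card S = CARD('d)"
        using obtain_subset_with_card_n[OF card] by metis
      have finS: "finite S" using S(1) supp(1) finite_subset by blast
      have "inj_on c S" using inj_c S(1) supp(2) inj_on_subset by blast
      then have cS: "card (c ` S) = CARD('d)" using S(2) card_image by metis
      obtain n where n: "CARD('d) = Suc n" using d2 by (cases "CARD('d)") auto
      obtain y where y: "y ` {..n} = c ` S" "\<And>i j. i < j \<Longrightarrow> j \<le> n \<Longrightarrow> y i < y j"
        using finite_set_increasing_enumeration[of "c ` S" n] finS cS n by auto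
      have y_pt: "\<exists>x\<in>support \<xi>. y i = c x" if "i < CARD('d)" for i
      proof -
        have "y i \<in> c ` S" using y(1) that n by auto
        then show ?thesis using S(1) by blast
      qed
      have vanish: "(transpose P *v z) \<bullet> (C s *v (transpose P *v z)) = 0" if s: "s \<in> c ` X" for s
      proof (rule nonneg_form_with_double_zeros_vanishes[of "CARD('d)" y, OF _ _ d2 k sign _ _ _ s])
        show "y i \<in> c ` X" if "i < CARD('d)" for i using y_pt[OF that] supp(2) by blast
        show "y i < y (Suc i)" if "Suc i < CARD('d)" for i using y(2)[of i "Suc i"] that n by simp
        show "0 \<le> (transpose P *v z) \<bullet> (C s *v (transpose P *v z))" if "s \<in> c ` X" for s
          using that form_eq_fisher q0 by auto
        show "(transpose P *v z) \<bullet> (C (y i) *v (transpose P *v z)) = 0" if "i < CARD('d)" for i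
        proof -
          obtain x where "x \<in> support \<xi>" "y i = c x" using y_pt[OF \<open>i < CARD('d)\<close>] by blast
          then show ?thesis using form_eq_fisher[of x z z] null supp(2) by auto
        qed
        show "D = 0" if "i < CARD('d)" and D: "((\<lambda>r. (transpose P *v z) \<bullet> (C r *v (transpose P *v z)))
          has_real_derivative D) (at (y i) within c ` X)" for i D
        proof -
          obtain x where x: "x \<in> support \<xi>" "y i = c x" using y_pt[OF \<open>i < CARD('d)\<close>] by blast
          show ?thesis
            by (rule fisher_zero_is_double[OF _ M _ null[OF x(1)] D[unfolded x(2)]])
               (use x(1) supp(2) nonzero in auto)
        qed
      qed
      have "z \<bullet> (M x *v z) = 0" if "x \<in> X" for x
        using vanish[of "c x"] form_eq_fisher[OF that, of z z] that by simp
      then have "z \<bullet> (design_info M \<nu> *v z) = 0"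
        unfolding design_info_quadratic using \<nu>(1) X by (intro sum.neutral) (auto simp: is_design_def)
      then show False using \<nu>(2) z(1) unfolding posdef_def by (metis less_irrefl)
    qed
  qed
qed

end

section \<open>From the complete class hypothesis to derivative chains\<close>

text \<open>\<open>f\<^bsub>l,t\<^esub>\<close> involves \<open>\<Psi>\<^sub>l\<close> and the functions with index below \<open>t\<close> only. Hence replacing \<open>\<Psi>\<^sub>k\<close> by an
  entry of \<open>C\<close> leaves the divisors of its chain unchanged.\<close>

lemma f_chain_cong:
  assumes "\<Psi> l = \<Psi>' l" "\<And>j. 1 \<le> j \<Longrightarrow> j < t \<Longrightarrow> \<Psi> j = \<Psi>' j"
  shows "f_chain I \<Psi> l t = f_chain I \<Psi>' l t"
  using assms
proof (induction t arbitrary: l)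
  case 0
  then show ?case by (auto simp: fun_eq_iff)
next
  case (Suc t)
  show ?case
  proof (cases t)
    case 0
    then show ?thesis using Suc.prems(1) by (intro ext) simp
  next
    case (Suc r)
    have "f_chain I \<Psi> l t = f_chain I \<Psi>' l t" "f_chain I \<Psi> t t = f_chain I \<Psi>' t t"
      using Suc.IH[of l] Suc.IH[of t] Suc.prems \<open>t = Suc r\<close> by auto
    then show ?thesis using Suc by (intro ext) simp
  qed
qed

lemma f_chain_derivative:
  assumes ch: "chain_differentiable I \<Psi> l" and t: "t < l" and s: "s \<in> I"
  shows "((\<lambda>r. f_chain I \<Psi> l t r / (if t = 0 then 1 else f_chain I \<Psi> t t r)) has_real_derivative
    f_chain I \<Psi> l (Suc t) s) (at s within I)"
proof (cases t)
  case 0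
  have "\<Psi> l differentiable (at s within I)"
    using ch s by (auto simp: chain_differentiable_def differentiable_on_def)
  then show ?thesis
    using 0 by (simp add: vector_derivative_works has_real_derivative_iff_has_vector_derivative)
next
  case (Suc r)
  then have "Suc t \<in> {2..l}" using t by auto
  moreover have "\<forall>t\<in>{2..l}. (\<lambda>s. f_chain I \<Psi> l (t - 1) s / f_chain I \<Psi> (t - 1) (t - 1) s) differentiable_on I"
    using ch unfolding chain_differentiable_def by blast
  ultimately have "(\<lambda>s. f_chain I \<Psi> l (Suc t - 1) s / f_chain I \<Psi> (Suc t - 1) (Suc t - 1) s) differentiable_on I"
    by (rule bspec[rotated])
  then have "(\<lambda>s. f_chain I \<Psi> l t s / f_chain I \<Psi> t t s) differentiable_on I"
    by (simp only: diff_Suc_1)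
  then have "(\<lambda>s. f_chain I \<Psi> l t s / f_chain I \<Psi> t t s) differentiable (at s within I)"
    using s by (auto simp: differentiable_on_def)
  then show ?thesis
    using Suc by (simp add: vector_derivative_works has_real_derivative_iff_has_vector_derivative)
qed

lemma block_form_restrict:
  fixes A :: "real^'d^'d"
  shows "block_form J A v = (\<chi> i. if i \<in> J then v $ i else 0) \<bullet> (A *v (\<chi> i. if i \<in> J then v $ i else 0))"
proof -
  let ?v = "\<chi> i. if i \<in> J then v $ i else 0"
  have "(\<Sum>i\<in>UNIV. \<Sum>j\<in>UNIV. ?v $ i * ?v $ j * A $ i $ j) = (\<Sum>i\<in>J. \<Sum>j\<in>UNIV. ?v $ i * ?v $ j * A $ i $ j)"
    by (rule sum.mono_neutral_right) auto
  also have "\<dots> = (\<Sum>i\<in>J. \<Sum>j\<in>J. ?v $ i * ?v $ j * A $ i $ j)"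
    by (intro sum.cong refl sum.mono_neutral_right) auto
  also have "\<dots> = block_form J A v" unfolding block_form_def by (intro sum.cong refl) auto
  finally show ?thesis unfolding quadratic_form_eq_sum by simp
qed

lemma posdef_on_block_form_pos:
  fixes A :: "real^'d^'d"
  assumes "posdef_on J A" "\<exists>i\<in>J. v $ i \<noteq> 0"
  shows "0 < block_form J A v"
proof -
  have "(\<chi> i. if i \<in> J then v $ i else 0) \<noteq> 0" using assms(2) by (auto simp: vec_eq_iff)
  then show ?thesis using assms(1) unfolding block_form_restrict posdef_on_def by auto
qed

lemma last_indices_nonempty:
  assumes "1 \<le> d1"
  shows "last_indices d1 \<noteq> ({} :: 'd::{finite,linorder} set)"
proof -
  have "\<not> Max UNIV < i" for i :: 'd by (metis Max_ge UNIV_I finite not_less)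
  then have "{i :: 'd. Max UNIV < i} = {}" by blast
  then have "card {i :: 'd. Max UNIV < i} < d1" using assms by (metis card.empty less_le_trans zero_less_one)
  then have "Max UNIV \<in> (last_indices d1 :: 'd set)" unfolding last_indices_def by blast
  then show ?thesis by blast
qed

text \<open>In a dependence between an entry and the independent functions \<open>\<Psi>\<^sub>1, \<dots>, \<Psi>\<^bsub>k-1\<^esub>\<close> the entry has a
  nonzero coefficient. Constant entries are multiples of the function with index \<open>0\<close>.\<close>

lemma maximal_indep_entries_span:
  fixes C :: "real \<Rightarrow> ('d::{finite,linorder}) sqmat"
  assumes max: "maximal_indep_entries I C d1 k \<Psi>" and k: "1 \<le> k" and j: "j \<notin> last_indices d1"
  shows "\<exists>a. \<forall>s\<in>I. C s $ i $ j = (\<Sum>l<k. a l * (if l = 0 then 1 else \<Psi> l s))"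
proof -
  have split: "{..<k} = insert 0 {1..<k}" using k by auto
  show ?thesis
  proof (cases "(\<lambda>c. C c $ i $ j) constant_on I")
    case True
    then obtain b where b: "\<forall>s\<in>I. C s $ i $ j = b" by (auto simp: constant_on_def)
    show ?thesis
      by (rule exI[of _ "\<lambda>l. if l = 0 then b else 0"]) (simp add: split b)
  next
    case False
    then have "\<not> lin_indep_on I {1..k} (with_entry \<Psi> k C i j)"
      using max j unfolding maximal_indep_entries_def by blast
    then obtain a where a: "\<And>s. s \<in> I \<Longrightarrow> (\<Sum>l\<in>{1..k}. a l * with_entry \<Psi> k C i j l s) = 0"
        "\<exists>l\<in>{1..k}. a l \<noteq> 0"
      unfolding lin_indep_on_def by blast
    have upto: "{1..k} = insert k {1..<k}" using k by auto
    have eq: "a k * C s $ i $ j + (\<Sum>l=1..<k. a l * \<Psi> l s) = 0" if "s \<in> I" for s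
    proof -
      have "(\<Sum>l=1..<k. a l * with_entry \<Psi> k C i j l s) = (\<Sum>l=1..<k. a l * \<Psi> l s)"
        by (intro sum.cong) (auto simp: with_entry_def)
      then show ?thesis using a(1)[OF that] unfolding upto by (simp add: with_entry_def)
    qed
    have ak: "a k \<noteq> 0"
    proof
      assume "a k = 0"
      then have "\<forall>s\<in>I. (\<Sum>l=1..<k. a l * \<Psi> l s) = 0" using eq by auto
      then have "\<forall>l\<in>{1..<k}. a l = 0"
        using max unfolding maximal_indep_entries_def lin_indep_on_def by blast
      then show False using a(2) \<open>a k = 0\<close> upto by auto
    qed
    have "C s $ i $ j = (\<Sum>l<k. (if l = 0 then 0 else - a l / a k) * (if l = 0 then 1 else \<Psi> l s))"
      if s: "s \<in> I" for s
    proof -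
      have "C s $ i $ j = - (\<Sum>l=1..<k. a l * \<Psi> l s) / a k"
        using eq[OF s] ak by (simp add: field_simps)
      also have "\<dots> = (\<Sum>l=1..<k. - a l / a k * \<Psi> l s)"
        by (simp add: sum_divide_distrib sum_negf)
      also have "\<dots> = (\<Sum>l=1..<k. (if l = 0 then 0 else - a l / a k) * (if l = 0 then 1 else \<Psi> l s))"
        by (intro sum.cong) auto
      finally show ?thesis by (simp add: split)
    qed
    then show ?thesis by (intro exI[of _ "\<lambda>l. if l = 0 then 0 else - a l / a k"]) blast
  qed
qed

lemma prod_sgn: "(\<Prod>l\<in>A. sgn (h l)) = sgn (\<Prod>l\<in>A. h l)" for h :: "'a \<Rightarrow> real"
  by (induction A rule: infinite_finite_induct) (auto simp: sgn_mult)

lemma design_space_infinite: "L < U \<Longrightarrow> infinite (design_space L U)"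
proof -
  assume "L < U"
  then obtain a where a: "L < ereal a" "ereal a < U" using ereal_dense2 by blast
  obtain b where b: "ereal a < ereal b" "ereal b < U" using ereal_dense2[OF a(2)] by blast
  have "{a..b} \<subseteq> design_space L U"
    unfolding design_space_def
    using a b by (auto intro: order_trans[of L "ereal a"] order_trans[of _ "ereal b" U] less_imp_le)
  moreover have "infinite {a..b}" using b(1) by (simp add: infinite_Icc)
  ultimately show ?thesis using finite_subset by blast
qed

lemma design_space_interval: "is_interval (design_space L U)"
  unfolding is_interval_1
proof (intro ballI allI impI, elim conjE)
  fix a b x assume ab: "a \<in> design_space L U" "b \<in> design_space L U" and x: "a \<le> x" "x \<le> b"
  then have "ereal a \<le> ereal x" "ereal x \<le> ereal b" by simp_all
  then show "x \<in> design_space L U"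
    using ab unfolding design_space_def mem_Collect_eq by (meson order_trans)
qed

text \<open>The chain of \<open>v\<^sup>T C\<^sub>2\<^sub>2 v\<close> is the quadratic form in \<open>v\<close> of the entrywise chains, because all entries are
  divided by the same scalar functions. Hence \<open>v\<^sup>T F v\<close> is the product of the diagonal functions, none
  of which can vanish when \<open>F\<close> is definite. The value \<open>k = 2 m\<close> occurs in condition (c) only, where
  \<open>F < 0\<close>.\<close>

lemma complete_class_hyp_model:
  fixes M :: "real \<Rightarrow> ('d::{finite,linorder}) sqmat"
  assumes hyp: "complete_class_hyp L U M m Fx" and LU: "L < U"
  obtains P c C J k u \<phi> where "complete_class_model (design_space L U) M P c C J k u \<phi>"
    and "k \<le> 2 * m" and "2 \<le> CARD('d)"
    and "\<forall>v s. k = 2 * m \<and> (\<exists>i\<in>J. v $ i \<noteq> 0) \<and> s \<in> c ` design_space L U \<longrightarrow>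
      (\<Prod>l=1..<k. sgn (\<phi> v l l s)) * \<phi> v k k s < 0"
proof -
  let ?X = "design_space L U"
  obtain P :: "'d sqmat" and c c' C d1 k \<Psi> I J eA eB where
    P: "invertible P" and
    c': "\<forall>x\<in>?X. (c has_real_derivative c' x) (at x within ?X)" and
    mono: "strict_mono_on ?X c \<and> eA = L \<and> eB = U \<or> strict_antimono_on ?X c \<and> eA = U \<and> eB = L" and
    I: "I = c ` ?X" and symC: "\<forall>s\<in>I. transpose (C s) = C s" and
    M: "\<forall>x\<in>?X. M x = P ** C (c x) ** transpose P" and
    d1: "1 \<le> d1" "d1 < CARD('d)" and J: "J = last_indices d1" and k: "1 \<le> k" and
    max: "maximal_indep_entries I C d1 k \<Psi>" and
    diff: "\<forall>l\<in>{1..<k}. chain_differentiable I \<Psi> l" and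
    diffk: "\<forall>i\<in>J. \<forall>j\<in>J. chain_differentiable I (with_entry \<Psi> k C i j) k" and
    F: "k + 1 = 2 * m \<and> (\<forall>s\<in>I. posdef_on J (- F_matrix I \<Psi> k C s)) \<and> Fx = {eA} \<or>
        k + 1 = 2 * m \<and> (\<forall>s\<in>I. posdef_on J (F_matrix I \<Psi> k C s)) \<and> Fx = {eB} \<or>
        k = 2 * m \<and> (\<forall>s\<in>I. posdef_on J (- F_matrix I \<Psi> k C s)) \<and> Fx = {} \<or>
        k + 2 = 2 * m \<and> (\<forall>s\<in>I. posdef_on J (F_matrix I \<Psi> k C s)) \<and> Fx = {eA, eB}"
    using hyp unfolding complete_class_hyp_def by (elim conjE exE) (rule that)
  have J_ne: "J \<noteq> {}" unfolding J by (rule last_indices_nonempty[OF d1(1)])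
  define \<phi> :: "'d rvec \<Rightarrow> nat \<Rightarrow> nat \<Rightarrow> real \<Rightarrow> real" where
    "\<phi> = (\<lambda>v l t s. if l = 0 then 1 else if l < k then f_chain I \<Psi> l t s
      else block_form J (\<chi> i j. f_chain I (with_entry \<Psi> k C i j) k t s) v)"
  define u where "u = (\<lambda>l s. if l = 0 then 1 else \<Psi> l s)"
  have F_form: "block_form J (F_matrix I \<Psi> k C s) v = (\<Prod>l=1..<k. \<phi> v l l s) * \<phi> v k k s" for v s
  proof -
    have "(\<Prod>l=1..<k. \<phi> v l l s) = (\<Prod>l=1..<k. f_chain I \<Psi> l l s)"
      by (intro prod.cong) (auto simp: \<phi>_def)
    then show ?thesis
      using k by (simp add: \<phi>_def F_matrix_def block_form_def sum_distrib_left mult_ac)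
  qed
  have neg_form: "block_form J (- A) v = - block_form J A v" for A and v :: "'d rvec"
    by (simp add: block_form_def sum_negf)
  have F_nz: "(\<Prod>l=1..<k. \<phi> v l l s) * \<phi> v k k s \<noteq> 0" if "\<exists>i\<in>J. v $ i \<noteq> 0" "s \<in> I" for v s
    using F posdef_on_block_form_pos[OF _ that(1)] that(2) neg_form unfolding F_form[symmetric]
    by (metis less_irrefl neg_0_equal_iff_equal)
  have chain: "derivative_chain I (\<phi> v) k" if v: "\<exists>i\<in>J. v $ i \<noteq> 0" for v
    unfolding derivative_chain_def
  proof (intro conjI allI impI ballI)
    have "connected I"
      unfolding I using c' design_space_interval[of L U]
      by (intro connected_continuous_image)
         (auto simp: continuous_on_eq_continuous_within is_interval_connected_1 intro: DERIV_continuous)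
    then show "is_interval I" by (simp add: is_interval_connected_1)
    show "\<phi> v 0 0 s = 1" for s by (simp add: \<phi>_def)
    show "\<phi> v l l s \<noteq> 0" if "l \<le> k" "s \<in> I" for l s
    proof (cases "l = 0 \<or> l = k")
      case True
      then show ?thesis using F_nz[OF v that(2)] by (auto simp: \<phi>_def)
    next
      case False
      then have "l \<in> {1..<k}" using that by auto
      then show ?thesis using F_nz[OF v that(2)] by (auto simp: prod_zero_iff)
    qed
    show "((\<lambda>r. \<phi> v l t r / \<phi> v t t r) has_real_derivative \<phi> v l (Suc t) s) (at s within I)"
      if lt: "l \<le> k" "t < l" "s \<in> I" for l t s
    proof (cases "l < k")
      case True
      then have "((\<lambda>r. f_chain I \<Psi> l t r / (if t = 0 then 1 else f_chain I \<Psi> t t r)) has_real_derivative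
          f_chain I \<Psi> l (Suc t) s) (at s within I)"
        using diff lt by (intro f_chain_derivative) auto
      moreover have "(\<lambda>r. \<phi> v l t r / \<phi> v t t r)
          = (\<lambda>r. f_chain I \<Psi> l t r / (if t = 0 then 1 else f_chain I \<Psi> t t r))"
        using True lt by (intro ext) (simp add: \<phi>_def)
      moreover have "\<phi> v l (Suc t) s = f_chain I \<Psi> l (Suc t) s"
        using True lt by (simp add: \<phi>_def)
      ultimately show ?thesis by (simp only:)
    next
      case False
      then have lk: "l = k" using lt by simp
      define den where "den = (\<lambda>r. if t = 0 then 1 else f_chain I \<Psi> t t r)"
      have d: "((\<lambda>r. f_chain I (with_entry \<Psi> k C i j) k t r / den r) has_real_derivative
          f_chain I (with_entry \<Psi> k C i j) k (Suc t) s) (at s within I)" if "i \<in> J" "j \<in> J" for i j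
      proof -
        have eq: "f_chain I (with_entry \<Psi> k C i j) t t = f_chain I \<Psi> t t"
          by (rule f_chain_cong) (use lt lk in \<open>auto simp: with_entry_def\<close>)
        show ?thesis
          unfolding den_def eq[symmetric]
          by (rule f_chain_derivative) (use diffk that lt lk in auto)
      qed
      have "((\<lambda>r. \<Sum>i\<in>J. \<Sum>j\<in>J. v $ i * v $ j * (f_chain I (with_entry \<Psi> k C i j) k t r / den r))
          has_real_derivative (\<Sum>i\<in>J. \<Sum>j\<in>J. v $ i * v $ j * f_chain I (with_entry \<Psi> k C i j) k (Suc t) s))
          (at s within I)"
        by (intro DERIV_sum DERIV_cmult d)
      moreover have "(\<lambda>r. \<phi> v l t r / \<phi> v t t r)
          = (\<lambda>r. \<Sum>i\<in>J. \<Sum>j\<in>J. v $ i * v $ j * (f_chain I (with_entry \<Psi> k C i j) k t r / den r))"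
        using lk lt by (intro ext) (simp add: \<phi>_def den_def block_form_def sum_divide_distrib)
      moreover have "\<phi> v l (Suc t) s
          = (\<Sum>i\<in>J. \<Sum>j\<in>J. v $ i * v $ j * f_chain I (with_entry \<Psi> k C i j) k (Suc t) s)"
        using lk k by (simp add: \<phi>_def block_form_def)
      ultimately show ?thesis by (simp only:)
    qed
  qed
  have "complete_class_model ?X M P c C J k u \<phi>"
  proof
    show "infinite ?X" by (rule design_space_infinite[OF LU])
    show "inj_on c ?X"
      using mono by (auto simp: inj_on_def monotone_on_def) (metis linorder_neqE less_irrefl)+
    show "\<exists>i j. \<forall>s\<in>c ` ?X. u l s = C s $ i $ j" if "1 \<le> l" "l < k" for l
    proof -
      have "l \<in> {1..<k}" using that by simp
      then obtain i j where "\<Psi> l = (\<lambda>c. C c $ i $ j)"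
        using max unfolding maximal_indep_entries_def by blast
      then show ?thesis using that by (auto simp: u_def)
    qed
    show "\<exists>a. \<forall>s\<in>c ` ?X. C s $ i $ j = (\<Sum>l<k. a l * u l s)" if "j \<notin> J" for i j
      using maximal_indep_entries_span[OF max k, of j i] that unfolding J I u_def by simp
    show "derivative_chain (c ` ?X) (\<phi> v) k" if "\<exists>i\<in>J. v $ i \<noteq> 0" for v
      using chain[OF that] I by simp
    show "\<phi> v k 0 s = block_form J (C s) v" for v s
      using k by (simp add: \<phi>_def with_entry_def block_form_def)
  qed (use P M symC I k J_ne in \<open>auto simp: u_def \<phi>_def\<close>)
  moreover have "k \<le> 2 * m" using F by auto
  moreover have "2 \<le> CARD('d)" using d1 by simp
  moreover have "\<forall>v s. k = 2 * m \<and> (\<exists>i\<in>J. v $ i \<noteq> 0) \<and> s \<in> c ` ?X \<longrightarrow>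
      (\<Prod>l=1..<k. sgn (\<phi> v l l s)) * \<phi> v k k s < 0"
  proof (intro allI impI, elim conjE)
    fix v :: "'d rvec" and s assume that: "k = 2 * m" "\<exists>i\<in>J. v $ i \<noteq> 0" "s \<in> c ` ?X"
    have "posdef_on J (- F_matrix I \<Psi> k C s)" using F that I by auto
    then have "(\<Prod>l=1..<k. \<phi> v l l s) * \<phi> v k k s < 0"
      using posdef_on_block_form_pos[OF _ that(2)] neg_form F_form by (metis neg_0_less_iff_less)
    then show "(\<Prod>l=1..<k. sgn (\<phi> v l l s)) * \<phi> v k k s < 0"
      unfolding prod_sgn by (auto simp: mult_less_0_iff)
  qed
  ultimately show ?thesis by (rule that)
qed

section \<open>Uniqueness of optimal designs\<close>

theorem theorem2p5:
  fixes L U :: ereal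
    and \<eta> :: "real \<Rightarrow> ('d::{finite,linorder}) rvec \<Rightarrow> real"
    and \<theta> :: "'d rvec" and w :: "real \<Rightarrow> real" and f :: "real \<Rightarrow> 'd rvec"
    and M :: "real \<Rightarrow> 'd sqmat"
  assumes interval: "L < U"
    and gradient: "\<And>x. x \<in> design_space L U \<Longrightarrow> GDERIV (\<eta> x) \<theta> :> f x"
    and weight: "\<And>x. x \<in> design_space L U \<Longrightarrow> 0 \<le> w x"
    and M: "M = fisher_info w f"
    and identifiable: "\<exists>\<xi>. is_design L U \<xi> \<and> posdef (design_info M \<xi>)"
  shows "(\<forall>(\<Phi> :: 'd sqmat \<Rightarrow> real) m Fx \<xi>opt.
            assumption_A \<Phi> \<and> complete_class_hyp L U M m Fx \<and>
            strictly_isotonic \<Phi> \<and> strictly_concave \<Phi> \<and>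
            is_optimal L U M \<Phi> \<xi>opt \<and> CARD('d) \<le> card (support \<xi>opt) \<and>
            (CARD('d) < m \<longrightarrow> posdef (design_info M \<xi>opt)) \<longrightarrow>
            (\<forall>\<xi>. is_optimal L U M \<Phi> \<xi> \<longrightarrow> \<xi> = \<xi>opt))
       \<and> (\<forall>Fx (g :: 'd rvec \<Rightarrow> 'd rvec) p.
            complete_class_hyp L U M (CARD('d)) Fx \<and>
            (Fx = {L} \<and> endpoint_info_eq M U 0 \<or>
             Fx = {U} \<and> endpoint_info_eq M L 0 \<or>
             Fx = {} \<and> endpoint_info_eq M U 0 \<and> endpoint_info_eq M L 0 \<or>
             Fx = {L, U}) \<and>
            smooth_full_rank g \<theta> \<and> p < 1 \<and>
            (\<exists>\<xi>. is_optimal L U M (Phi_p (K_matrix g \<theta>) p) \<xi>) \<longrightarrow>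
            (\<exists>!\<xi>. is_optimal L U M (Phi_p (K_matrix g \<theta>) p) \<xi>))"
proof (intro conjI allI impI; elim conjE)
  have nnd_info: "nnd (design_info M \<zeta>)" if "is_design L U \<zeta>" for \<zeta>
    by (rule design_info_nnd[OF _ that]) (simp add: M fisher_info_nnd weight)
  have unique: "\<zeta> = \<xi>"
    if hyp: "complete_class_hyp L U M m Fx" and iso: "strictly_isotonic \<Phi>" and mid: "midpoint_strict \<Phi>"
      and \<xi>: "is_optimal L U M \<Phi> \<xi>" and pd: "posdef (design_info M \<xi>)" and \<zeta>: "is_optimal L U M \<Phi> \<zeta>"
    for \<Phi> m Fx \<xi> \<zeta>
  proof -
    have eq: "design_info M \<zeta> = design_info M \<xi>"
      by (rule optimal_info_unique[OF mid nnd_info \<xi> \<zeta> pd])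
    obtain P c C J k u \<phi> where "complete_class_model (design_space L U) M P c C J k u \<phi>"
      using complete_class_hyp_model[OF hyp interval] by metis
    then show ?thesis
      by (rule complete_class_model.design_determined_by_optimal_info[OF _ refl iso \<xi> \<zeta> pd eq])
  qed
  {
    fix \<Phi> :: "'d sqmat \<Rightarrow> real" and m Fx \<xi>opt \<xi>
    assume A: "assumption_A \<Phi>" and hyp: "complete_class_hyp L U M m Fx"
      and iso: "strictly_isotonic \<Phi>" and conc: "strictly_concave \<Phi>"
      and opt: "is_optimal L U M \<Phi> \<xi>opt" and card: "CARD('d) \<le> card (support \<xi>opt)"
      and large: "CARD('d) < m \<longrightarrow> posdef (design_info M \<xi>opt)"
      and \<xi>: "is_optimal L U M \<Phi> \<xi>"
    have mid: "midpoint_strict \<Phi>" by (rule midpoint_strict_if_strictly_concave[OF A iso conc])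
    have "posdef (design_info M \<xi>opt)"
    proof (cases "CARD('d) < m")
      case False
      then have m: "m = CARD('d)" using hyp by (simp add: complete_class_hyp_def)
      obtain \<nu> where \<nu>: "is_design L U \<nu>" "posdef (design_info M \<nu>)" using identifiable by blast
      obtain P c C J k u \<phi> where model: "complete_class_model (design_space L U) M P c C J k u \<phi>"
        and k: "k \<le> 2 * m" and d2: "2 \<le> CARD('d)"
        and sign: "\<forall>v s. k = 2 * m \<and> (\<exists>i\<in>J. v $ i \<noteq> 0) \<and> s \<in> c ` design_space L U \<longrightarrow>
          (\<Prod>l=1..<k. sgn (\<phi> v l l s)) * \<phi> v k k s < 0"
        by (rule complete_class_hyp_model[OF hyp interval])
      have isoA: "\<Phi> B \<le> \<Phi> A" if "nnd A" "nnd B" "loewner_ge A B" for A B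
        using A that unfolding assumption_A_def by blast
      have signs: "(\<Prod>l=1..<k. sgn (\<phi> v l l s)) * \<phi> v k k s < 0"
        if "k = 2 * CARD('d)" "\<exists>i\<in>J. v $ i \<noteq> 0" "s \<in> c ` design_space L U" for v s
        using sign that m by blast
      show ?thesis
        by (rule complete_class_model.optimal_info_posdef[OF model refl M weight \<nu> mid isoA opt card d2
              k[unfolded m] signs])
    qed (use large in blast)
    then show "\<xi> = \<xi>opt" by (rule unique[OF hyp iso mid opt _ \<xi>])
  }
  {
    fix Fx p and g :: "'d rvec \<Rightarrow> 'd rvec"
    assume hyp: "complete_class_hyp L U M (CARD('d)) Fx" and g: "smooth_full_rank g \<theta>" and p: "p < 1"
      and ex: "\<exists>\<xi>. is_optimal L U M (Phi_p (K_matrix g \<theta>) p) \<xi>"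
    let ?K = "K_matrix g \<theta>"
    have "rank ?K = CARD('d)" using g by (simp add: smooth_full_rank_def)
    then have "\<forall>x. ?K *v x = 0 \<longrightarrow> x = 0"
      by (metis full_rank_injective matrix_vector_mult_0_right injD)
    then have K: "invertible ?K" by (simp add: invertible_left_inverse matrix_left_invertible_ker)
    obtain \<nu> where \<nu>: "is_design L U \<nu>" "posdef (design_info M \<nu>)" using identifiable by blast
    obtain \<xi> where \<xi>: "is_optimal L U M (Phi_p ?K p) \<xi>" using ex by blast
    have "0 < Phi_p ?K p (design_info M \<nu>)" by (rule Phi_p_posdef_pos[OF K \<nu>(2)])
    also have "\<dots> \<le> Phi_p ?K p (design_info M \<xi>)" using \<xi> \<nu>(1) by (simp add: is_optimal_def)
    finally have "invertible (design_info M \<xi>)" using Phi_p_eq_0_if_singular[OF K] by (metis less_irrefl)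
    then have pd: "posdef (design_info M \<xi>)"
      using \<xi> nnd_info by (intro nnd_invertible_imp_posdef) (auto simp: is_optimal_def)
    show "\<exists>!\<xi>. is_optimal L U M (Phi_p ?K p) \<xi>"
      using \<xi> unique[OF hyp Phi_p_strictly_isotonic[OF K p] Phi_p_midpoint_strict[OF K p] \<xi> pd] by blast
  }
qed

end
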